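(* Let $F$ be a Finsler metric on a smooth manifold $M$, with geodesic spray $S$, canonical connection $\Gamma_S$, fundamental tensor $g$, Cartan tensor ${\rm C}$ and associated tensor ${\rm C}'$. Using the conditions (T2), (T3), (M3)–(M7) listed in the context, consider the (unique) lifts $\nabla$ of $\Gamma_S$ satisfying, respectively: Berwald: (T3) and (M5); Cartan: (T2), (M6) and (M7); Chern-Rund: (T3) and (M3); Hashiguchi: (T2), (M4) and (M7). Then, for every open $\mathcal{O}\subseteq M$, every nowhere null $W\in\mathfrak{X}(\mathcal{O})$ and all $U,V,T\in\mathfrak{X}(\mathcal{O})$: (a) the families of affine connections $D^W$ corresponding to the Cartan and Chern-Rund connections satisfy both $$D^W_UV-D^W_VU=[U,V],\qquad (D^W_Ug_W)(T,V)=2{\rm C}_W(D^W_UW,T,V);$$ (b) the families of affine connections $D^W$ corresponding to the Berwald and Hashiguchi connections satisfy both $$D^W_UV-D^W_VU=[U,V],\qquad (D^W_Ug_W)(T,V)=2{\rm C}_W(D^W_UW,T,V)+2{\rm C}'_W(U,T,V).$$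
   Context: Let $\pi:TM\setminus 0\to M$ be the tangent bundle with the zero section removed, $\mathscr{V}TM=\ker({\rm d}\pi)\subset T(TM\setminus 0)$ the vertical bundle, regarded as a vector bundle over $TM\setminus 0$. For $w\in TM\setminus 0$, $i_w:T_{\pi(w)}M\to\mathscr{V}_wTM$, $i_w(u)=\frac{d}{dt}|_{t=0}(w+tu)$. The canonical vector field is $C(w)=i_w(w)$, and $\mathscr{J}(X)=i_w({\rm d}\pi(X))$ for $X\in T_w(TM\setminus 0)$. A Finsler metric is a function $F:TM\to[0,\infty)$, smooth on $TM\setminus 0$, with $F(u)=0$ iff $u=0$, $F(\lambda u)=\lambda F(u)$ for $\lambda>0$, and such that for each $w\in T_xM\setminus 0$ the fundamental tensor $g_w(u,v)=\frac12\frac{\partial^2}{\partial t\partial s}|_{(0,0)}F(w+su+tv)^2$ is positive definite on $T_xM$. Via $i_w$, $g$ is regarded as a Riemannian metric on $\mathscr{V}TM\to TM\setminus 0$. The geodesic spray $S$ of $F$ is the vector field on $TM\setminus 0$ with ${\rm d}(\frac12F^2)=\omega_F(S,\cdot)$, where $\omega_F$ is the pull-back of the canonical symplectic form $\sum dx^i\wedge dp_i$ of $T^*M$ by $w\mapsto g_w(w,\cdot)$; it satisfies $\mathscr{J}(S)=C$ and $[C,S]=S$. Geodesics are curves $\gamma$ with $\dot\gamma$ an integral curve of $S$. The canonical connection is $\Gamma_S=-[S,\mathscr{J}]$, i.e. $\Gamma_S(Y)=\mathscr{J}[S,Y]-[S,\mathscr{J}(Y)]$; $\Gamma_S^2={\bf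 I}$, $\ker(\Gamma_S+{\bf I})=\mathscr{V}TM$. With $\mathscr{H}TM=\ker(\Gamma_S-{\bf I})$ (horizontal vectors), $T(TM\setminus 0)=\mathscr{H}TM\oplus\mathscr{V}TM$, with projections $\mathscr{H},\mathscr{V}$. $u^{\mathfrak h}$ is the horizontal lift at $w$ of $u\in T_{\pi(w)}M$. A linear connection $\nabla$ on $\mathscr{V}TM\to TM\setminus 0$ is a lift of $\Gamma_S$ if $\nabla_XC=\mathscr{V}X$ for all $X$. Its torsion is ${\rm T}(X,Y)=\nabla_X\mathscr{J}(Y)-\nabla_Y\mathscr{J}(X)-\mathscr{J}[X,Y]$. Put $\mathscr{C}(X,Y)={\rm T}(\mathscr{J}(X),Y)$ and $\mathscr{C}_\flat(X,Y,Z)=g(\mathscr{C}(X,Y),\mathscr{J}(Z))$. The family of affine connections corresponding to $\nabla$: for $w\in T_xM\setminus 0$, $u\in T_xM$ and $V$ a vector field near $x$, $D^w_uV=i_w^{-1}\nabla_{u^{\mathfrak h}}V^{\mathfrak v}$, where $V^{\mathfrak v}(z)=i_z(V(\pi(z)))$; for nowhere null $W\in\mathfrak{X}(\mathcal{O})$, $(D^W_UV)(x)=D^{W(x)}_{U(x)}V$. $g_W$, ${\rm C}_W$, ${\rm C}'_W$ denote the tensor fields $x\mapsto g_{W(x)}$, ${\rm C}_{W(x)}$, ${\rm C}'_{W(x)}$ on $\mathcal{O}$. The Cartan tensor is ${\rm C}_w(u,v,z)=\frac14\frac{\partial^3}{\partial r\partial s\partial t}|_{r=s=t=0}F(w+ru+sv+tz)^2$.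 The tensor ${\rm C}'$ is ${\rm C}'_w(u,v,z)=(D^W_W{\rm C}_W)|_{\pi(w)}(u,v,z)$, where $W$ is any nowhere null vector field near $\pi(w)$ with $W(\pi(w))=w$ whose integral curve through $\pi(w)$ is a geodesic, and $D^W$ comes from any lift of $\Gamma_S$ with ${\rm T}(S,\cdot)=0$ (the result is independent of choices). Both are identified with tensors on $\mathscr{V}TM$ via $i_w$. Conditions on $\nabla$ (for all $X,Y,Z$): (T2) ${\rm T}(\mathscr{H}X,\mathscr{H}Y)=0$; (T3) ${\rm T}(X,Y)=0$; (M3) $(\nabla_Xg)(\cdot,\cdot)=2{\rm C}(\mathscr{V}X,\cdot,\cdot)$; (M4) $(\nabla_Xg)(\cdot,\cdot)=2{\rm C}'(\mathscr{J}(X),\cdot,\cdot)$; (M5) $(\nabla_Xg)(\cdot,\cdot)=2{\rm C}(\mathscr{V}X,\cdot,\cdot)+2{\rm C}'(\mathscr{J}(X),\cdot,\cdot)$; (M6) $\nabla g=0$; (M7) $\mathscr{C}_\flat(X,Y,Z)=\mathscr{C}_\flat(X,Z,Y)$. *)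

theory Defs
  imports "HOL-Analysis.Analysis" "HOL-Library.Function_Algebras"
begin

section \<open>Preliminaries\<close>

text \<open>A tangent vector will be the family of its components in all the charts, that is, a function
  from chart indices to the model space. The pointwise vector space structure makes every tangent
  space a linear subspace of this function type.\<close>

instantiation "fun" :: (type, real_vector) real_vector
begin

definition scaleR_fun :: "real \<Rightarrow> ('a \<Rightarrow> 'b) \<Rightarrow> 'a \<Rightarrow> 'b"
  where "scaleR_fun c f = (\<lambda>x. c *\<^sub>R f x)"

instance
  by standard (auto simp: scaleR_fun_def plus_fun_def fun_eq_iff scaleR_add_right scaleR_add_left)

end

text \<open>Only used on open sets, where the derivative at a point is unique.\<close>

primrec Ck_on :: "nat \<Rightarrow> 'a::real_normed_vector set \<Rightarrow> ('a \<Rightarrow> 'b::real_normed_vector) \<Rightarrow> bool"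
  where
    "Ck_on 0 A f \<longleftrightarrow> continuous_on A f"
  | "Ck_on (Suc k) A f \<longleftrightarrow> (\<forall>x\<in>A. f differentiable (at x)) \<and>
       (\<forall>v. Ck_on k A (\<lambda>x. frechet_derivative f (at x) v))"

definition smooth_on :: "'a::real_normed_vector set \<Rightarrow> ('a \<Rightarrow> 'b::real_normed_vector) \<Rightarrow> bool"
  where "smooth_on A f \<longleftrightarrow> (\<forall>k. Ck_on k A f)"


section \<open>Smooth manifolds\<close>

text \<open>A manifold is given by an indexed smooth atlas; the model space \<^typ>\<open>'e\<close> is a Euclidean space.
  The function \<open>chart M i\<close> is meaningful on \<open>cdom M i\<close> only.\<close>

record ('p, 'i, 'e) atlas =
  points :: "'p set"
  index :: "'i set"
  cdom :: "'i \<Rightarrow> 'p set"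
  chart :: "'i \<Rightarrow> 'p \<Rightarrow> 'e"

definition charts_at :: "('p, 'i, 'e) atlas \<Rightarrow> 'p \<Rightarrow> 'i set"
  where "charts_at M p = {i \<in> index M. p \<in> cdom M i}"

text \<open>An arbitrary chart around the point, for notions that do not depend on the chart.\<close>

definition chart_at :: "('p, 'i, 'e) atlas \<Rightarrow> 'p \<Rightarrow> 'i"
  where "chart_at M p = (SOME i. i \<in> charts_at M p)"

definition param :: "('p, 'i, 'e) atlas \<Rightarrow> 'i \<Rightarrow> 'e \<Rightarrow> 'p"
  where "param M i = inv_into (cdom M i) (chart M i)"

definition transition :: "('p, 'i, 'e) atlas \<Rightarrow> 'i \<Rightarrow> 'i \<Rightarrow> 'e \<Rightarrow> 'e"
  where "transition M i j = chart M j \<circ> param M i"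

definition mtop :: "('p, 'i, 'e::euclidean_space) atlas \<Rightarrow> 'p topology"
  where "mtop M = topology (\<lambda>A. A \<subseteq> points M \<and> (\<forall>i\<in>index M. open (chart M i ` (A \<inter> cdom M i))))"

definition smooth_manifold :: "('p, 'i, 'e::euclidean_space) atlas \<Rightarrow> bool"
  where "smooth_manifold M \<longleftrightarrow>
    (\<forall>i\<in>index M. cdom M i \<subseteq> points M \<and> inj_on (chart M i) (cdom M i) \<and>
       open (chart M i ` cdom M i)) \<and>
    (\<Union>i\<in>index M. cdom M i) = points M \<and>
    (\<forall>i\<in>index M. \<forall>j\<in>index M. open (chart M i ` (cdom M i \<inter> cdom M j)) \<and>
       smooth_on (chart M i ` (cdom M i \<inter> cdom M j)) (transition M i j)) \<and>
    Hausdorff_space (mtop M) \<and> second_countable (mtop M)"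

definition smooth_fun ::
  "('p, 'i, 'e::euclidean_space) atlas \<Rightarrow> 'p set \<Rightarrow> ('p \<Rightarrow> real) \<Rightarrow> bool"
  where "smooth_fun M A f \<longleftrightarrow> openin (mtop M) A \<and>
    (\<forall>i\<in>index M. smooth_on (chart M i ` (A \<inter> cdom M i)) (f \<circ> param M i))"

definition tangent_space :: "('p, 'i, 'e::euclidean_space) atlas \<Rightarrow> 'p \<Rightarrow> ('i \<Rightarrow> 'e) set"
  where "tangent_space M p = {\<xi>.
    (\<forall>i. i \<notin> charts_at M p \<longrightarrow> \<xi> i = 0) \<and>
    (\<forall>i\<in>charts_at M p. \<forall>j\<in>charts_at M p.
       \<xi> j = frechet_derivative (transition M i j) (at (chart M i p)) (\<xi> i))}"

text \<open>The tangent vector at \<open>p\<close> whose component in the chart \<open>i\<close> is \<open>e\<close>; for \<open>e\<close> in the standard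
  basis these are the coordinate vectors of the chart.\<close>

definition coord_vec :: "('p, 'i, 'e::euclidean_space) atlas \<Rightarrow> 'i \<Rightarrow> 'p \<Rightarrow> 'e \<Rightarrow> 'i \<Rightarrow> 'e"
  where "coord_vec M i p e =
    (\<lambda>j. if j \<in> charts_at M p then frechet_derivative (transition M i j) (at (chart M i p)) e else 0)"

definition vector_field ::
  "('p, 'i, 'e::euclidean_space) atlas \<Rightarrow> 'p set \<Rightarrow> ('p \<Rightarrow> 'i \<Rightarrow> 'e) \<Rightarrow> bool"
  where "vector_field M A X \<longleftrightarrow> openin (mtop M) A \<and> (\<forall>p\<in>A. X p \<in> tangent_space M p) \<and>
    (\<forall>i\<in>index M. smooth_on (chart M i ` (A \<inter> cdom M i)) (\<lambda>x. X (param M i x) i))"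

text \<open>The derivative \<open>df\<^sub>p(\<xi>)\<close> of a real function.\<close>

definition tderiv ::
  "('p, 'i, 'e::euclidean_space) atlas \<Rightarrow> ('p \<Rightarrow> real) \<Rightarrow> 'p \<Rightarrow> ('i \<Rightarrow> 'e) \<Rightarrow> real"
  where "tderiv M f p \<xi> = (let i = chart_at M p in
    frechet_derivative (f \<circ> param M i) (at (chart M i p)) (\<xi> i))"

definition tangent_map ::
  "('p, 'i, 'e::euclidean_space) atlas \<Rightarrow> ('q, 'j, 'f::euclidean_space) atlas \<Rightarrow> ('p \<Rightarrow> 'q) \<Rightarrow>
    'p \<Rightarrow> ('i \<Rightarrow> 'e) \<Rightarrow> 'j \<Rightarrow> 'f"
  where "tangent_map M N f p \<xi> = (let i = chart_at M p in
    (\<lambda>j. if j \<in> charts_at N (f p)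
         then frechet_derivative (chart N j \<circ> f \<circ> param M i) (at (chart M i p)) (\<xi> i) else 0))"

definition lie_bracket ::
  "('p, 'i, 'e::euclidean_space) atlas \<Rightarrow> ('p \<Rightarrow> 'i \<Rightarrow> 'e) \<Rightarrow> ('p \<Rightarrow> 'i \<Rightarrow> 'e) \<Rightarrow> 'p \<Rightarrow> 'i \<Rightarrow> 'e"
  where "lie_bracket M X Y p = (\<lambda>i. if i \<in> charts_at M p
    then frechet_derivative (\<lambda>x. Y (param M i x) i) (at (chart M i p)) (X p i)
       - frechet_derivative (\<lambda>x. X (param M i x) i) (at (chart M i p)) (Y p i)
    else 0)"

definition velocity :: "('p, 'i, 'e::euclidean_space) atlas \<Rightarrow> (real \<Rightarrow> 'p) \<Rightarrow> real \<Rightarrow> 'i \<Rightarrow> 'e"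
  where "velocity M \<gamma> t =
    (\<lambda>i. if i \<in> charts_at M (\<gamma> t) then vector_derivative (chart M i \<circ> \<gamma>) (at t) else 0)"

definition smooth_curve :: "('p, 'i, 'e::euclidean_space) atlas \<Rightarrow> real set \<Rightarrow> (real \<Rightarrow> 'p) \<Rightarrow> bool"
  where "smooth_curve M J \<gamma> \<longleftrightarrow> (\<forall>t\<in>J. \<gamma> t \<in> points M) \<and>
    (\<forall>i\<in>index M. open {t \<in> J. \<gamma> t \<in> cdom M i} \<and> smooth_on {t \<in> J. \<gamma> t \<in> cdom M i} (chart M i \<circ> \<gamma>))"

definition integral_curve ::
  "('p, 'i, 'e::euclidean_space) atlas \<Rightarrow> ('p \<Rightarrow> 'i \<Rightarrow> 'e) \<Rightarrow> real set \<Rightarrow> (real \<Rightarrow> 'p) \<Rightarrow> bool"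
  where "integral_curve M X J \<gamma> \<longleftrightarrow>
    smooth_curve M J \<gamma> \<and> (\<forall>t\<in>J. velocity M \<gamma> t = X (\<gamma> t))"


section \<open>The slit tangent bundle and the cotangent bundle\<close>

type_synonym ('p, 'i, 'e) tpoint = "'p \<times> ('i \<Rightarrow> 'e)"
type_synonym ('i, 'e) tvec2 = "'i \<Rightarrow> 'e \<times> 'e"

text \<open>The charts are those of \<open>M\<close>, extended by \<open>(p, u) \<mapsto> (chart i p, u i)\<close>; so \<open>slit M\<close> is again
  an atlas, and tangent vectors to the slit tangent bundle have type \<^typ>\<open>('i, 'e) tvec2\<close>.\<close>

definition slit :: "('p, 'i, 'e::euclidean_space) atlas \<Rightarrow>
    (('p, 'i, 'e) tpoint, 'i, 'e \<times> 'e) atlas"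
  where "slit M = \<lparr>
    points = {(p, u). p \<in> points M \<and> u \<in> tangent_space M p \<and> u \<noteq> 0},
    index = index M,
    cdom = (\<lambda>i. {(p, u). p \<in> cdom M i \<and> u \<in> tangent_space M p \<and> u \<noteq> 0}),
    chart = (\<lambda>i (p, u). (chart M i p, u i))\<rparr>"

text \<open>Covectors at \<open>p\<close> are linear functionals on the tangent space at \<open>p\<close>, extended by \<open>0\<close>.\<close>

definition cotangent_space ::
  "('p, 'i, 'e::euclidean_space) atlas \<Rightarrow> 'p \<Rightarrow> (('i \<Rightarrow> 'e) \<Rightarrow> real) set"
  where "cotangent_space M p = {\<alpha>. (\<forall>u. u \<notin> tangent_space M p \<longrightarrow> \<alpha> u = 0) \<and>
    (\<forall>u\<in>tangent_space M p. \<forall>v\<in>tangent_space M p. \<forall>a b.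
       \<alpha> (a *\<^sub>R u + b *\<^sub>R v) = a * \<alpha> u + b * \<alpha> v)}"

text \<open>The second component of a chart collects the momenta \<open>p\<^sub>b = \<alpha>(\<partial>\<^sub>b)\<close>.\<close>

definition cotangent :: "('p, 'i, 'e::euclidean_space) atlas \<Rightarrow>
    ('p \<times> (('i \<Rightarrow> 'e) \<Rightarrow> real), 'i, 'e \<times> 'e) atlas"
  where "cotangent M = \<lparr>
    points = {(p, \<alpha>). p \<in> points M \<and> \<alpha> \<in> cotangent_space M p},
    index = index M,
    cdom = (\<lambda>i. {(p, \<alpha>). p \<in> cdom M i \<and> \<alpha> \<in> cotangent_space M p}),
    chart = (\<lambda>i (p, \<alpha>). (chart M i p, \<Sum>b\<in>Basis. \<alpha> (coord_vec M i p b) *\<^sub>R b))\<rparr>"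

text \<open>The canonical form \<open>\<Sum>dx\<^sup>b \<and> dp\<^sub>b\<close>, with \<open>(\<alpha> \<and> \<beta>)(\<xi>, \<eta>) = \<alpha>(\<xi>) \<beta>(\<eta>) - \<alpha>(\<eta>) \<beta>(\<xi>)\<close>.\<close>

definition canonical_form :: "('p, 'i, 'e::euclidean_space) atlas \<Rightarrow>
    'p \<times> (('i \<Rightarrow> 'e) \<Rightarrow> real) \<Rightarrow> ('i, 'e) tvec2 \<Rightarrow> ('i, 'e) tvec2 \<Rightarrow> real"
  where "canonical_form M a \<xi> \<eta> = (let i = chart_at (cotangent M) a in
    \<Sum>b\<in>Basis. (fst (\<xi> i) \<bullet> b) * (snd (\<eta> i) \<bullet> b) - (fst (\<eta> i) \<bullet> b) * (snd (\<xi> i) \<bullet> b))"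

definition dproj :: "('p, 'i, 'e::euclidean_space) atlas \<Rightarrow>
    ('p, 'i, 'e) tpoint \<Rightarrow> ('i, 'e) tvec2 \<Rightarrow> 'i \<Rightarrow> 'e"
  where "dproj M w \<xi> = tangent_map (slit M) M fst w \<xi>"

definition vertical :: "('p, 'i, 'e::euclidean_space) atlas \<Rightarrow>
    ('p, 'i, 'e) tpoint \<Rightarrow> ('i, 'e) tvec2 set"
  where "vertical M w = {\<xi> \<in> tangent_space (slit M) w. dproj M w \<xi> = 0}"

definition imap :: "('p, 'i, 'e::euclidean_space) atlas \<Rightarrow>
    ('p, 'i, 'e) tpoint \<Rightarrow> ('i \<Rightarrow> 'e) \<Rightarrow> ('i, 'e) tvec2"
  where "imap M w u = velocity (slit M) (\<lambda>t. (fst w, snd w + t *\<^sub>R u)) 0"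

definition imap_inv :: "('p, 'i, 'e::euclidean_space) atlas \<Rightarrow>
    ('p, 'i, 'e) tpoint \<Rightarrow> ('i, 'e) tvec2 \<Rightarrow> 'i \<Rightarrow> 'e"
  where "imap_inv M w = inv_into (tangent_space M (fst w)) (imap M w)"

definition canonical_field :: "('p, 'i, 'e::euclidean_space) atlas \<Rightarrow>
    ('p, 'i, 'e) tpoint \<Rightarrow> ('i, 'e) tvec2"
  where "canonical_field M w = imap M w (snd w)"

definition vert_endo :: "('p, 'i, 'e::euclidean_space) atlas \<Rightarrow>
    ('p, 'i, 'e) tpoint \<Rightarrow> ('i, 'e) tvec2 \<Rightarrow> ('i, 'e) tvec2"
  where "vert_endo M w \<xi> = imap M w (dproj M w \<xi>)"

definition vert_lift :: "('p, 'i, 'e::euclidean_space) atlas \<Rightarrow>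
    ('p \<Rightarrow> 'i \<Rightarrow> 'e) \<Rightarrow> ('p, 'i, 'e) tpoint \<Rightarrow> ('i, 'e) tvec2"
  where "vert_lift M V z = imap M z (V (fst z))"

definition vertical_section :: "('p, 'i, 'e::euclidean_space) atlas \<Rightarrow>
    ('p, 'i, 'e) tpoint set \<Rightarrow> (('p, 'i, 'e) tpoint \<Rightarrow> ('i, 'e) tvec2) \<Rightarrow> bool"
  where "vertical_section M A Y \<longleftrightarrow> vector_field (slit M) A Y \<and> (\<forall>w\<in>A. Y w \<in> vertical M w)"


section \<open>Finsler metrics and their geodesic spray\<close>

definition fund_tensor :: "(('p, 'i, 'e::euclidean_space) tpoint \<Rightarrow> real) \<Rightarrow>
    ('p, 'i, 'e) tpoint \<Rightarrow> ('i \<Rightarrow> 'e) \<Rightarrow> ('i \<Rightarrow> 'e) \<Rightarrow> real"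
  where "fund_tensor F w u v =
    1/2 * deriv (\<lambda>t. deriv (\<lambda>s. (F (fst w, snd w + s *\<^sub>R u + t *\<^sub>R v))\<^sup>2) 0) 0"

definition cartan_tensor :: "(('p, 'i, 'e::euclidean_space) tpoint \<Rightarrow> real) \<Rightarrow>
    ('p, 'i, 'e) tpoint \<Rightarrow> ('i \<Rightarrow> 'e) \<Rightarrow> ('i \<Rightarrow> 'e) \<Rightarrow> ('i \<Rightarrow> 'e) \<Rightarrow> real"
  where "cartan_tensor F w u v z =
    1/4 * deriv (\<lambda>r. deriv (\<lambda>s. deriv (\<lambda>t.
      (F (fst w, snd w + r *\<^sub>R u + s *\<^sub>R v + t *\<^sub>R z))\<^sup>2) 0) 0) 0"

definition finsler_metric :: "('p, 'i, 'e::euclidean_space) atlas \<Rightarrow>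
    (('p, 'i, 'e) tpoint \<Rightarrow> real) \<Rightarrow> bool"
  where "finsler_metric M F \<longleftrightarrow>
    smooth_fun (slit M) (points (slit M)) F \<and>
    (\<forall>p\<in>points M. \<forall>u\<in>tangent_space M p.
       F (p, u) \<ge> 0 \<and> (F (p, u) = 0 \<longleftrightarrow> u = 0) \<and> (\<forall>c>0. F (p, c *\<^sub>R u) = c * F (p, u))) \<and>
    (\<forall>w\<in>points (slit M). \<forall>u\<in>tangent_space M (fst w). u \<noteq> 0 \<longrightarrow> fund_tensor F w u u > 0)"

definition legendre :: "('p, 'i, 'e::euclidean_space) atlas \<Rightarrow>
    (('p, 'i, 'e) tpoint \<Rightarrow> real) \<Rightarrow> ('p, 'i, 'e) tpoint \<Rightarrow> 'p \<times> (('i \<Rightarrow> 'e) \<Rightarrow> real)"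
  where "legendre M F w =
    (fst w, \<lambda>u. if u \<in> tangent_space M (fst w) then fund_tensor F w (snd w) u else 0)"

definition finsler_form :: "('p, 'i, 'e::euclidean_space) atlas \<Rightarrow>
    (('p, 'i, 'e) tpoint \<Rightarrow> real) \<Rightarrow> ('p, 'i, 'e) tpoint \<Rightarrow> ('i, 'e) tvec2 \<Rightarrow> ('i, 'e) tvec2 \<Rightarrow> real"
  where "finsler_form M F w \<xi> \<eta> = (let d = tangent_map (slit M) (cotangent M) (legendre M F) w in
    canonical_form M (legendre M F w) (d \<xi>) (d \<eta>))"

definition geodesic_spray :: "('p, 'i, 'e::euclidean_space) atlas \<Rightarrow>
    (('p, 'i, 'e) tpoint \<Rightarrow> real) \<Rightarrow> (('p, 'i, 'e) tpoint \<Rightarrow> ('i, 'e) tvec2) \<Rightarrow> bool"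
  where "geodesic_spray M F S \<longleftrightarrow> vector_field (slit M) (points (slit M)) S \<and>
    (\<forall>w\<in>points (slit M). \<forall>\<eta>\<in>tangent_space (slit M) w.
       tderiv (slit M) (\<lambda>z. 1/2 * (F z)\<^sup>2) w \<eta> = finsler_form M F w (S w) \<eta>)"

definition geodesic :: "('p, 'i, 'e::euclidean_space) atlas \<Rightarrow>
    (('p, 'i, 'e) tpoint \<Rightarrow> ('i, 'e) tvec2) \<Rightarrow> real set \<Rightarrow> (real \<Rightarrow> 'p) \<Rightarrow> bool"
  where "geodesic M S J \<gamma> \<longleftrightarrow> integral_curve (slit M) S J (\<lambda>t. (\<gamma> t, velocity M \<gamma> t))"


section \<open>The canonical connection of the spray\<close>

text \<open>The bracket expression is tensorial in \<open>Y\<close>, so its value at \<open>w\<close> depends on \<open>Y w\<close> only.\<close>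

definition canon_conn :: "('p, 'i, 'e::euclidean_space) atlas \<Rightarrow>
    (('p, 'i, 'e) tpoint \<Rightarrow> ('i, 'e) tvec2) \<Rightarrow> ('p, 'i, 'e) tpoint \<Rightarrow> ('i, 'e) tvec2 \<Rightarrow> ('i, 'e) tvec2"
  where "canon_conn M S w \<xi> = (THE \<eta>. \<forall>A Y. vector_field (slit M) A Y \<and> w \<in> A \<and> Y w = \<xi> \<longrightarrow>
    \<eta> = vert_endo M w (lie_bracket (slit M) S Y w)
        - lie_bracket (slit M) S (\<lambda>z. vert_endo M z (Y z)) w)"

definition horizontal :: "('p, 'i, 'e::euclidean_space) atlas \<Rightarrow>
    (('p, 'i, 'e) tpoint \<Rightarrow> ('i, 'e) tvec2) \<Rightarrow> ('p, 'i, 'e) tpoint \<Rightarrow> ('i, 'e) tvec2 set"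
  where "horizontal M S w = {\<xi> \<in> tangent_space (slit M) w. canon_conn M S w \<xi> = \<xi>}"

definition hor_proj :: "('p, 'i, 'e::euclidean_space) atlas \<Rightarrow>
    (('p, 'i, 'e) tpoint \<Rightarrow> ('i, 'e) tvec2) \<Rightarrow> ('p, 'i, 'e) tpoint \<Rightarrow> ('i, 'e) tvec2 \<Rightarrow> ('i, 'e) tvec2"
  where "hor_proj M S w \<xi> = (THE \<eta>. \<eta> \<in> horizontal M S w \<and> \<xi> - \<eta> \<in> vertical M w)"

definition ver_proj :: "('p, 'i, 'e::euclidean_space) atlas \<Rightarrow>
    (('p, 'i, 'e) tpoint \<Rightarrow> ('i, 'e) tvec2) \<Rightarrow> ('p, 'i, 'e) tpoint \<Rightarrow> ('i, 'e) tvec2 \<Rightarrow> ('i, 'e) tvec2"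
  where "ver_proj M S w \<xi> = \<xi> - hor_proj M S w \<xi>"

definition hor_lift :: "('p, 'i, 'e::euclidean_space) atlas \<Rightarrow>
    (('p, 'i, 'e) tpoint \<Rightarrow> ('i, 'e) tvec2) \<Rightarrow> ('p, 'i, 'e) tpoint \<Rightarrow> ('i \<Rightarrow> 'e) \<Rightarrow> ('i, 'e) tvec2"
  where "hor_lift M S w u = (THE \<xi>. \<xi> \<in> horizontal M S w \<and> dproj M w \<xi> = u)"


section \<open>Linear connections on the vertical bundle\<close>

text \<open>\<open>nabla w \<xi> Y\<close> is the covariant derivative at \<open>w\<close> of the local section \<open>Y\<close> in the direction
  \<open>\<xi>\<close>. As sections are total functions, of which only the values on an open set are relevant,
  dependence on the germ of \<open>Y\<close> at \<open>w\<close> alone is one of the axioms.\<close>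

type_synonym ('p, 'i, 'e) vconn = "('p, 'i, 'e) tpoint \<Rightarrow> ('i, 'e) tvec2 \<Rightarrow>
    (('p, 'i, 'e) tpoint \<Rightarrow> ('i, 'e) tvec2) \<Rightarrow> ('i, 'e) tvec2"

definition linear_connection ::
  "('p, 'i, 'e::euclidean_space) atlas \<Rightarrow> ('p, 'i, 'e) vconn \<Rightarrow> bool"
  where "linear_connection M nabla \<longleftrightarrow>
    (\<forall>A Y Z. vertical_section M A Y \<and> vertical_section M A Z \<longrightarrow>
      (\<forall>w\<in>A. \<forall>\<xi>\<in>tangent_space (slit M) w.
        nabla w \<xi> Y \<in> vertical M w \<and>
        (\<forall>\<eta>\<in>tangent_space (slit M) w. \<forall>a b.
           nabla w (a *\<^sub>R \<xi> + b *\<^sub>R \<eta>) Y = a *\<^sub>R nabla w \<xi> Y + b *\<^sub>R nabla w \<eta> Y) \<and>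
        nabla w \<xi> (\<lambda>z. Y z + Z z) = nabla w \<xi> Y + nabla w \<xi> Z \<and>
        (\<forall>f. smooth_fun (slit M) A f \<longrightarrow>
           nabla w \<xi> (\<lambda>z. f z *\<^sub>R Y z) = tderiv (slit M) f w \<xi> *\<^sub>R Y w + f w *\<^sub>R nabla w \<xi> Y) \<and>
        ((\<forall>z\<in>A. Y z = Z z) \<longrightarrow> nabla w \<xi> Y = nabla w \<xi> Z)) \<and>
      (\<forall>X. vector_field (slit M) A X \<longrightarrow> vertical_section M A (\<lambda>w. nabla w (X w) Y)))"

definition is_lift :: "('p, 'i, 'e::euclidean_space) atlas \<Rightarrow>
    (('p, 'i, 'e) tpoint \<Rightarrow> ('i, 'e) tvec2) \<Rightarrow> ('p, 'i, 'e) vconn \<Rightarrow> bool"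
  where "is_lift M S nabla \<longleftrightarrow> linear_connection M nabla \<and>
    (\<forall>w\<in>points (slit M). \<forall>\<xi>\<in>tangent_space (slit M) w.
       nabla w \<xi> (canonical_field M) = ver_proj M S w \<xi>)"

definition torsion :: "('p, 'i, 'e::euclidean_space) atlas \<Rightarrow> ('p, 'i, 'e) vconn \<Rightarrow>
    (('p, 'i, 'e) tpoint \<Rightarrow> ('i, 'e) tvec2) \<Rightarrow> (('p, 'i, 'e) tpoint \<Rightarrow> ('i, 'e) tvec2) \<Rightarrow>
    ('p, 'i, 'e) tpoint \<Rightarrow> ('i, 'e) tvec2"
  where "torsion M nabla X Y w =
    nabla w (X w) (\<lambda>z. vert_endo M z (Y z)) - nabla w (Y w) (\<lambda>z. vert_endo M z (X z))
    - vert_endo M w (lie_bracket (slit M) X Y w)"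

definition fund_vert :: "('p, 'i, 'e::euclidean_space) atlas \<Rightarrow>
    (('p, 'i, 'e) tpoint \<Rightarrow> real) \<Rightarrow> ('p, 'i, 'e) tpoint \<Rightarrow>
    ('i, 'e) tvec2 \<Rightarrow> ('i, 'e) tvec2 \<Rightarrow> real"
  where "fund_vert M F w \<xi> \<eta> = fund_tensor F w (imap_inv M w \<xi>) (imap_inv M w \<eta>)"

definition C_flat :: "('p, 'i, 'e::euclidean_space) atlas \<Rightarrow>
    (('p, 'i, 'e) tpoint \<Rightarrow> real) \<Rightarrow> ('p, 'i, 'e) vconn \<Rightarrow>
    (('p, 'i, 'e) tpoint \<Rightarrow> ('i, 'e) tvec2) \<Rightarrow> (('p, 'i, 'e) tpoint \<Rightarrow> ('i, 'e) tvec2) \<Rightarrow>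
    (('p, 'i, 'e) tpoint \<Rightarrow> ('i, 'e) tvec2) \<Rightarrow> ('p, 'i, 'e) tpoint \<Rightarrow> real"
  where "C_flat M F nabla X Y Z w =
    fund_vert M F w (torsion M nabla (\<lambda>z. vert_endo M z (X z)) Y w) (vert_endo M w (Z w))"

text \<open>\<open>(\<nabla>\<^sub>X g)(Y, Z)\<close> for vertical \<open>Y\<close> and \<open>Z\<close>.\<close>

definition nabla_metric :: "('p, 'i, 'e::euclidean_space) atlas \<Rightarrow>
    (('p, 'i, 'e) tpoint \<Rightarrow> real) \<Rightarrow> ('p, 'i, 'e) vconn \<Rightarrow>
    (('p, 'i, 'e) tpoint \<Rightarrow> ('i, 'e) tvec2) \<Rightarrow> (('p, 'i, 'e) tpoint \<Rightarrow> ('i, 'e) tvec2) \<Rightarrow>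
    (('p, 'i, 'e) tpoint \<Rightarrow> ('i, 'e) tvec2) \<Rightarrow> ('p, 'i, 'e) tpoint \<Rightarrow> real"
  where "nabla_metric M F nabla X Y Z w =
    tderiv (slit M) (\<lambda>z. fund_vert M F z (Y z) (Z z)) w (X w)
    - fund_vert M F w (nabla w (X w) Y) (Z w) - fund_vert M F w (Y w) (nabla w (X w) Z)"


section \<open>The family of affine connections\<close>

text \<open>\<open>aff_vec\<close> is \<open>D\<^sup>w\<^sub>u V\<close>, and \<open>aff\<close> is the vector field \<open>D\<^sup>W\<^sub>U V\<close>.\<close>

definition aff_vec :: "('p, 'i, 'e::euclidean_space) atlas \<Rightarrow>
    (('p, 'i, 'e) tpoint \<Rightarrow> ('i, 'e) tvec2) \<Rightarrow> ('p, 'i, 'e) vconn \<Rightarrow>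
    ('p, 'i, 'e) tpoint \<Rightarrow> ('i \<Rightarrow> 'e) \<Rightarrow> ('p \<Rightarrow> 'i \<Rightarrow> 'e) \<Rightarrow> 'i \<Rightarrow> 'e"
  where "aff_vec M S nabla w u V = imap_inv M w (nabla w (hor_lift M S w u) (vert_lift M V))"

definition aff :: "('p, 'i, 'e::euclidean_space) atlas \<Rightarrow>
    (('p, 'i, 'e) tpoint \<Rightarrow> ('i, 'e) tvec2) \<Rightarrow> ('p, 'i, 'e) vconn \<Rightarrow>
    ('p \<Rightarrow> 'i \<Rightarrow> 'e) \<Rightarrow> ('p \<Rightarrow> 'i \<Rightarrow> 'e) \<Rightarrow> ('p \<Rightarrow> 'i \<Rightarrow> 'e) \<Rightarrow> 'p \<Rightarrow> 'i \<Rightarrow> 'e"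
  where "aff M S nabla W U V p = aff_vec M S nabla (p, W p) (U p) V"

text \<open>\<open>(D\<^sup>W\<^sub>U g\<^sub>W)(T, V)\<close> and \<open>(D\<^sup>W\<^sub>U C\<^sub>W)(X, Y, Z)\<close>.\<close>

definition aff_metric :: "('p, 'i, 'e::euclidean_space) atlas \<Rightarrow>
    (('p, 'i, 'e) tpoint \<Rightarrow> real) \<Rightarrow> (('p, 'i, 'e) tpoint \<Rightarrow> ('i, 'e) tvec2) \<Rightarrow>
    ('p, 'i, 'e) vconn \<Rightarrow> ('p \<Rightarrow> 'i \<Rightarrow> 'e) \<Rightarrow> ('p \<Rightarrow> 'i \<Rightarrow> 'e) \<Rightarrow>
    ('p \<Rightarrow> 'i \<Rightarrow> 'e) \<Rightarrow> ('p \<Rightarrow> 'i \<Rightarrow> 'e) \<Rightarrow> 'p \<Rightarrow> real"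
  where "aff_metric M F S nabla W U T V p =
    tderiv M (\<lambda>q. fund_tensor F (q, W q) (T q) (V q)) p (U p)
    - fund_tensor F (p, W p) (aff M S nabla W U T p) (V p)
    - fund_tensor F (p, W p) (T p) (aff M S nabla W U V p)"

definition aff_cartan :: "('p, 'i, 'e::euclidean_space) atlas \<Rightarrow>
    (('p, 'i, 'e) tpoint \<Rightarrow> real) \<Rightarrow> (('p, 'i, 'e) tpoint \<Rightarrow> ('i, 'e) tvec2) \<Rightarrow>
    ('p, 'i, 'e) vconn \<Rightarrow> ('p \<Rightarrow> 'i \<Rightarrow> 'e) \<Rightarrow> ('p \<Rightarrow> 'i \<Rightarrow> 'e) \<Rightarrow>
    ('p \<Rightarrow> 'i \<Rightarrow> 'e) \<Rightarrow> ('p \<Rightarrow> 'i \<Rightarrow> 'e) \<Rightarrow> ('p \<Rightarrow> 'i \<Rightarrow> 'e) \<Rightarrow> 'p \<Rightarrow> real"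
  where "aff_cartan M F S nabla W U X Y Z p =
    tderiv M (\<lambda>q. cartan_tensor F (q, W q) (X q) (Y q) (Z q)) p (U p)
    - cartan_tensor F (p, W p) (aff M S nabla W U X p) (Y p) (Z p)
    - cartan_tensor F (p, W p) (X p) (aff M S nabla W U Y p) (Z p)
    - cartan_tensor F (p, W p) (X p) (Y p) (aff M S nabla W U Z p)"

text \<open>\<open>W\<close> is a nowhere null field on the neighbourhood \<open>Q\<close> of \<open>\<pi>(w)\<close>, has the value \<open>w\<close> there, and its
  integral curve through \<open>\<pi>(w)\<close> is a geodesic.\<close>

definition geodesic_extension :: "('p, 'i, 'e::euclidean_space) atlas \<Rightarrow>
    (('p, 'i, 'e) tpoint \<Rightarrow> ('i, 'e) tvec2) \<Rightarrow> ('p, 'i, 'e) tpoint \<Rightarrow> 'p set \<Rightarrow>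
    ('p \<Rightarrow> 'i \<Rightarrow> 'e) \<Rightarrow> bool"
  where "geodesic_extension M S w Q W \<longleftrightarrow>
    vector_field M Q W \<and> (\<forall>q\<in>Q. W q \<noteq> 0) \<and> fst w \<in> Q \<and> W (fst w) = snd w \<and>
    (\<forall>J \<gamma>. open J \<and> is_interval J \<and> 0 \<in> J \<and> \<gamma> 0 = fst w \<and> \<gamma> ` J \<subseteq> Q \<and> integral_curve M W J \<gamma> \<longrightarrow>
       geodesic M S J \<gamma>)"

text \<open>The tensor \<open>C'\<close>. Its value does not depend on the extension \<open>W\<close>, on the lift, nor on the
  vector fields that extend the arguments.\<close>

definition cartan_deriv :: "('p, 'i, 'e::euclidean_space) atlas \<Rightarrow>
    (('p, 'i, 'e) tpoint \<Rightarrow> real) \<Rightarrow> (('p, 'i, 'e) tpoint \<Rightarrow> ('i, 'e) tvec2) \<Rightarrow>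
    ('p, 'i, 'e) tpoint \<Rightarrow> ('i \<Rightarrow> 'e) \<Rightarrow> ('i \<Rightarrow> 'e) \<Rightarrow> ('i \<Rightarrow> 'e) \<Rightarrow> real"
  where "cartan_deriv M F S w u v z = (THE c. \<forall>nabla Q W X Y Z.
    is_lift M S nabla \<and>
    (\<forall>A V. vector_field (slit M) A V \<longrightarrow> (\<forall>a\<in>A. torsion M nabla S V a = 0)) \<and>
    geodesic_extension M S w Q W \<and>
    vector_field M Q X \<and> vector_field M Q Y \<and> vector_field M Q Z \<and>
    X (fst w) = u \<and> Y (fst w) = v \<and> Z (fst w) = z \<longrightarrow>
    c = aff_cartan M F S nabla W W X Y Z (fst w))"

definition cartan_vert :: "('p, 'i, 'e::euclidean_space) atlas \<Rightarrow>
    (('p, 'i, 'e) tpoint \<Rightarrow> real) \<Rightarrow> ('p, 'i, 'e) tpoint \<Rightarrow>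
    ('i, 'e) tvec2 \<Rightarrow> ('i, 'e) tvec2 \<Rightarrow> ('i, 'e) tvec2 \<Rightarrow> real"
  where "cartan_vert M F w \<xi> \<eta> \<zeta> =
    cartan_tensor F w (imap_inv M w \<xi>) (imap_inv M w \<eta>) (imap_inv M w \<zeta>)"

definition cartan_deriv_vert :: "('p, 'i, 'e::euclidean_space) atlas \<Rightarrow>
    (('p, 'i, 'e) tpoint \<Rightarrow> real) \<Rightarrow> (('p, 'i, 'e) tpoint \<Rightarrow> ('i, 'e) tvec2) \<Rightarrow>
    ('p, 'i, 'e) tpoint \<Rightarrow> ('i, 'e) tvec2 \<Rightarrow> ('i, 'e) tvec2 \<Rightarrow> ('i, 'e) tvec2 \<Rightarrow> real"
  where "cartan_deriv_vert M F S w \<xi> \<eta> \<zeta> =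
    cartan_deriv M F S w (imap_inv M w \<xi>) (imap_inv M w \<eta>) (imap_inv M w \<zeta>)"


section \<open>The four connections\<close>

definition T2 :: "('p, 'i, 'e::euclidean_space) atlas \<Rightarrow>
    (('p, 'i, 'e) tpoint \<Rightarrow> ('i, 'e) tvec2) \<Rightarrow> ('p, 'i, 'e) vconn \<Rightarrow> bool"
  where "T2 M S nabla \<longleftrightarrow> (\<forall>A X Y. vector_field (slit M) A X \<and> vector_field (slit M) A Y \<longrightarrow>
    (\<forall>w\<in>A. torsion M nabla (\<lambda>z. hor_proj M S z (X z)) (\<lambda>z. hor_proj M S z (Y z)) w = 0))"

definition T3 :: "('p, 'i, 'e::euclidean_space) atlas \<Rightarrow> ('p, 'i, 'e) vconn \<Rightarrow> bool"
  where "T3 M nabla \<longleftrightarrow> (\<forall>A X Y. vector_field (slit M) A X \<and> vector_field (slit M) A Y \<longrightarrow>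
    (\<forall>w\<in>A. torsion M nabla X Y w = 0))"

definition M3 :: "('p, 'i, 'e::euclidean_space) atlas \<Rightarrow> (('p, 'i, 'e) tpoint \<Rightarrow> real) \<Rightarrow>
    (('p, 'i, 'e) tpoint \<Rightarrow> ('i, 'e) tvec2) \<Rightarrow> ('p, 'i, 'e) vconn \<Rightarrow> bool"
  where "M3 M F S nabla \<longleftrightarrow> (\<forall>A X Y Z.
    vector_field (slit M) A X \<and> vertical_section M A Y \<and> vertical_section M A Z \<longrightarrow>
    (\<forall>w\<in>A. nabla_metric M F nabla X Y Z w =
       2 * cartan_vert M F w (ver_proj M S w (X w)) (Y w) (Z w)))"

definition M4 :: "('p, 'i, 'e::euclidean_space) atlas \<Rightarrow> (('p, 'i, 'e) tpoint \<Rightarrow> real) \<Rightarrow>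
    (('p, 'i, 'e) tpoint \<Rightarrow> ('i, 'e) tvec2) \<Rightarrow> ('p, 'i, 'e) vconn \<Rightarrow> bool"
  where "M4 M F S nabla \<longleftrightarrow> (\<forall>A X Y Z.
    vector_field (slit M) A X \<and> vertical_section M A Y \<and> vertical_section M A Z \<longrightarrow>
    (\<forall>w\<in>A. nabla_metric M F nabla X Y Z w =
       2 * cartan_deriv_vert M F S w (vert_endo M w (X w)) (Y w) (Z w)))"

definition M5 :: "('p, 'i, 'e::euclidean_space) atlas \<Rightarrow> (('p, 'i, 'e) tpoint \<Rightarrow> real) \<Rightarrow>
    (('p, 'i, 'e) tpoint \<Rightarrow> ('i, 'e) tvec2) \<Rightarrow> ('p, 'i, 'e) vconn \<Rightarrow> bool"
  where "M5 M F S nabla \<longleftrightarrow> (\<forall>A X Y Z.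
    vector_field (slit M) A X \<and> vertical_section M A Y \<and> vertical_section M A Z \<longrightarrow>
    (\<forall>w\<in>A. nabla_metric M F nabla X Y Z w =
       2 * cartan_vert M F w (ver_proj M S w (X w)) (Y w) (Z w)
       + 2 * cartan_deriv_vert M F S w (vert_endo M w (X w)) (Y w) (Z w)))"

definition M6 :: "('p, 'i, 'e::euclidean_space) atlas \<Rightarrow> (('p, 'i, 'e) tpoint \<Rightarrow> real) \<Rightarrow>
    ('p, 'i, 'e) vconn \<Rightarrow> bool"
  where "M6 M F nabla \<longleftrightarrow> (\<forall>A X Y Z.
    vector_field (slit M) A X \<and> vertical_section M A Y \<and> vertical_section M A Z \<longrightarrow>
    (\<forall>w\<in>A. nabla_metric M F nabla X Y Z w = 0))"

definition M7 :: "('p, 'i, 'e::euclidean_space) atlas \<Rightarrow> (('p, 'i, 'e) tpoint \<Rightarrow> real) \<Rightarrow>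
    ('p, 'i, 'e) vconn \<Rightarrow> bool"
  where "M7 M F nabla \<longleftrightarrow> (\<forall>A X Y Z.
    vector_field (slit M) A X \<and> vector_field (slit M) A Y \<and> vector_field (slit M) A Z \<longrightarrow>
    (\<forall>w\<in>A. C_flat M F nabla X Y Z w = C_flat M F nabla X Z Y w))"

definition berwald_connection :: "('p, 'i, 'e::euclidean_space) atlas \<Rightarrow>
    (('p, 'i, 'e) tpoint \<Rightarrow> real) \<Rightarrow> (('p, 'i, 'e) tpoint \<Rightarrow> ('i, 'e) tvec2) \<Rightarrow>
    ('p, 'i, 'e) vconn \<Rightarrow> bool"
  where "berwald_connection M F S nabla \<longleftrightarrow> is_lift M S nabla \<and> T3 M nabla \<and> M5 M F S nabla"

definition cartan_connection :: "('p, 'i, 'e::euclidean_space) atlas \<Rightarrow>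
    (('p, 'i, 'e) tpoint \<Rightarrow> real) \<Rightarrow> (('p, 'i, 'e) tpoint \<Rightarrow> ('i, 'e) tvec2) \<Rightarrow>
    ('p, 'i, 'e) vconn \<Rightarrow> bool"
  where "cartan_connection M F S nabla \<longleftrightarrow>
    is_lift M S nabla \<and> T2 M S nabla \<and> M6 M F nabla \<and> M7 M F nabla"

definition chern_rund_connection :: "('p, 'i, 'e::euclidean_space) atlas \<Rightarrow>
    (('p, 'i, 'e) tpoint \<Rightarrow> real) \<Rightarrow> (('p, 'i, 'e) tpoint \<Rightarrow> ('i, 'e) tvec2) \<Rightarrow>
    ('p, 'i, 'e) vconn \<Rightarrow> bool"
  where "chern_rund_connection M F S nabla \<longleftrightarrow> is_lift M S nabla \<and> T3 M nabla \<and> M3 M F S nabla"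

definition hashiguchi_connection :: "('p, 'i, 'e::euclidean_space) atlas \<Rightarrow>
    (('p, 'i, 'e) tpoint \<Rightarrow> real) \<Rightarrow> (('p, 'i, 'e) tpoint \<Rightarrow> ('i, 'e) tvec2) \<Rightarrow>
    ('p, 'i, 'e) vconn \<Rightarrow> bool"
  where "hashiguchi_connection M F S nabla \<longleftrightarrow>
    is_lift M S nabla \<and> T2 M S nabla \<and> M4 M F S nabla \<and> M7 M F nabla"

end

theory Submission
  imports Defs
begin

text \<open>Write \<open>w = W(p)\<close> and split \<open>dW(U)\<close> at \<open>w\<close> into the horizontal lift of \<open>U\<close> and a vertical vector
  \<open>i\<^sub>w(n)\<close>. A lift \<open>\<nabla>\<close> differentiates the canonical field along \<open>dW(U)\<close> to \<open>i\<^sub>w(n)\<close>, and the canonical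
  field agrees with the vertical lift of \<open>W\<close> along the image of \<open>W\<close>. Hence \<open>n = D\<^sup>W\<^sub>U W\<close> as soon as the
  derivative of the vertical lift of \<open>W\<close> in the direction \<open>i\<^sub>w(n)\<close> vanishes. Under (T3) the derivatives of
  all vertical lifts in vertical directions vanish. Under (M7) together with (M6) or (M4), symmetry and
  compatibility with \<open>g\<close> in vertical directions give \<open>g(\<nabla>\<^sub>n T, V) = C(n, T, V)\<close>, which is \<open>0\<close> for
  \<open>T = W\<close> by homogeneity. Then \<open>D\<^sup>W\<^sub>U g\<^sub>W\<close> is the covariant derivative of \<open>g\<close> along \<open>dW(U)\<close>, corrected by
  these vertical derivatives, and the symmetry of \<open>D\<^sup>W\<close> is the vanishing of the torsion on horizontal lifts.\<close>

section \<open>Smooth functions on open sets\<close>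

text \<open>The summand with \<open>cartan_tensor\<close> has two different origins. For Chern-Rund
  and Berwald it is part of (M3) and (M5), evaluated on the vertical part of dW(U), and all
  corrections vanish. For Cartan and Hashiguchi, (M6) and (M4) contain no such summand; it is the
  sum of the two corrections, each of which equals C(n, T, V). The summand with C' is always the
  value of (M4) or (M5) on dW(U), because the vertical endomorphism sends dW(U) to the vertical lift
  of U; \<open>cartan_deriv\<close> itself stays an opaque value throughout. Two obstacles shape the
  proof. The canonical field and the vertical lift of \<open>W\<close> agree only on the image of
  \<open>W\<close>, which is not open, whereas the axioms of a connection compare sections on open
  sets; this is bridged by a first order statement, \<open>conn_jet\<close>. And the spray is given
  only through the symplectic form, while horizontal vectors are given by definite descriptions:
  that the spray is of second order, that these descriptions are well defined and that horizontal
  lifts are smooth all have to be extracted from computations in charts.\<close>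

lemma frechet_derivativeI:
  "(f has_derivative f') (at x) \<Longrightarrow> frechet_derivative f (at x) = f'"
  using frechet_derivative_at by metis

lemma has_derivative_frechet:
  "f differentiable (at x) \<Longrightarrow> (f has_derivative frechet_derivative f (at x)) (at x)"
  by (simp add: frechet_derivative_works)

lemma has_derivative_cong_open:
  assumes "open A" "x \<in> A" "\<And>z. z \<in> A \<Longrightarrow> f z = g z"
  shows "(f has_derivative f') (at x) \<longleftrightarrow> (g has_derivative f') (at x)"
  using assms by (metis has_derivative_transform_within_open)

lemma differentiable_cong_open:
  assumes "open A" "x \<in> A" "\<And>z. z \<in> A \<Longrightarrow> f z = g z"
  shows "f differentiable (at x) \<longleftrightarrow> g differentiable (at x)"
  unfolding differentiable_def using has_derivative_cong_open[OF assms] by simp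

lemma frechet_derivative_cong_open:
  assumes "open A" "x \<in> A" "\<And>z. z \<in> A \<Longrightarrow> f z = g z"
  shows "frechet_derivative f (at x) = frechet_derivative g (at x)"
  unfolding frechet_derivative_def using has_derivative_cong_open[OF assms] by simp

lemma Ck_on_cong:
  assumes "open A" "\<And>z. z \<in> A \<Longrightarrow> f z = g z"
  shows "Ck_on k A f \<longleftrightarrow> Ck_on k A g"
  using assms(2)
proof (induction k arbitrary: f g)
  case 0
  then show ?case using continuous_on_cong by auto
next
  case (Suc k)
  have "f differentiable (at x) \<longleftrightarrow> g differentiable (at x)" if "x \<in> A" for x
    using differentiable_cong_open[OF assms(1) that Suc.prems] .
  moreover have "Ck_on k A (\<lambda>x. frechet_derivative f (at x) v) \<longleftrightarrow>
      Ck_on k A (\<lambda>x. frechet_derivative g (at x) v)" for v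
    by (rule Suc.IH) (simp add: frechet_derivative_cong_open[OF assms(1) _ Suc.prems])
  ultimately show ?case by auto
qed

lemma Ck_on_Suc_imp: "Ck_on (Suc k) A f \<Longrightarrow> Ck_on k A f"
proof (induction k arbitrary: f)
  case 0
  then show ?case
    by (auto intro!: continuous_at_imp_continuous_on differentiable_imp_continuous_within)
next
  case (Suc k)
  then show ?case by (metis Ck_on.simps(2))
qed

lemma Ck_on_subset: "Ck_on k A f \<Longrightarrow> B \<subseteq> A \<Longrightarrow> Ck_on k B f"
  by (induction k arbitrary: f) (auto intro: continuous_on_subset)

lemma Ck_on_const: "Ck_on k A (\<lambda>x. c)"
  by (induction k arbitrary: c) auto

lemma Ck_on_bounded_linear:
  assumes "open A" "bounded_linear L" "Ck_on k A f"
  shows "Ck_on k A (\<lambda>x. L (f x))"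
  using assms(3)
proof (induction k arbitrary: f)
  case 0
  then show ?case using bounded_linear.continuous_on[OF assms(2)] by auto
next
  case (Suc k)
  have d: "((\<lambda>x. L (f x)) has_derivative (\<lambda>v. L (frechet_derivative f (at x) v))) (at x)" if "x \<in> A" for x
    using bounded_linear.has_derivative[OF assms(2) has_derivative_frechet] Suc.prems that by auto
  have "Ck_on k A (\<lambda>x. frechet_derivative (\<lambda>x. L (f x)) (at x) v)" for v
    using Suc.IH[of "\<lambda>x. frechet_derivative f (at x) v"] Suc.prems
    by (subst Ck_on_cong[OF assms(1), where g = "\<lambda>x. L (frechet_derivative f (at x) v)"])
      (auto simp: frechet_derivativeI[OF d])
  moreover have "(\<lambda>x. L (f x)) differentiable (at x)" if "x \<in> A" for x
    using d[OF that] by (auto simp: differentiable_def)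
  ultimately show ?case by simp
qed

lemma Ck_on_add:
  assumes "open A" "Ck_on k A f" "Ck_on k A g"
  shows "Ck_on k A (\<lambda>x. f x + g x)"
  using assms(2,3)
proof (induction k arbitrary: f g)
  case 0
  then show ?case by (auto intro: continuous_on_add)
next
  case (Suc k)
  have d: "((\<lambda>x. f x + g x) has_derivative
      (\<lambda>v. frechet_derivative f (at x) v + frechet_derivative g (at x) v)) (at x)" if "x \<in> A" for x
    using Suc.prems that by (intro has_derivative_add has_derivative_frechet) auto
  have "Ck_on k A (\<lambda>x. frechet_derivative (\<lambda>x. f x + g x) (at x) v)" for v
    using Suc.IH[of "\<lambda>x. frechet_derivative f (at x) v" "\<lambda>x. frechet_derivative g (at x) v"] Suc.prems
    by (subst Ck_on_cong[OF assms(1),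
          where g = "\<lambda>x. frechet_derivative f (at x) v + frechet_derivative g (at x) v"])
      (auto simp: frechet_derivativeI[OF d])
  moreover have "(\<lambda>x. f x + g x) differentiable (at x)" if "x \<in> A" for x
    using d[OF that] by (auto simp: differentiable_def)
  ultimately show ?case by simp
qed

lemma Ck_on_scaleR:
  fixes f :: "'a::real_normed_vector \<Rightarrow> real" and g :: "'a \<Rightarrow> 'b::real_normed_vector"
  assumes "open A" "Ck_on k A f" "Ck_on k A g"
  shows "Ck_on k A (\<lambda>x. f x *\<^sub>R g x)"
  using assms(2,3)
proof (induction k arbitrary: f g)
  case 0
  then show ?case by (auto intro: continuous_on_scaleR)
next
  case (Suc k)
  have d: "((\<lambda>x. f x *\<^sub>R g x) has_derivative (\<lambda>v. f x *\<^sub>R frechet_derivative g (at x) v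
      + frechet_derivative f (at x) v *\<^sub>R g x)) (at x)" if "x \<in> A" for x
    using Suc.prems that by (intro has_derivative_scaleR has_derivative_frechet) auto
  have "Ck_on k A (\<lambda>x. frechet_derivative (\<lambda>x. f x *\<^sub>R g x) (at x) v)" for v
    using Suc.IH[of f "\<lambda>x. frechet_derivative g (at x) v"]
      Suc.IH[of "\<lambda>x. frechet_derivative f (at x) v" g] Suc.prems Ck_on_Suc_imp[of k A f]
      Ck_on_Suc_imp[of k A g]
    by (subst Ck_on_cong[OF assms(1), where g = "\<lambda>x. f x *\<^sub>R frechet_derivative g (at x) v
          + frechet_derivative f (at x) v *\<^sub>R g x"])
      (auto simp: frechet_derivativeI[OF d] intro!: Ck_on_add[OF assms(1)])
  moreover have "(\<lambda>x. f x *\<^sub>R g x) differentiable (at x)" if "x \<in> A" for x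
    using d[OF that] by (auto simp: differentiable_def)
  ultimately show ?case by simp
qed

lemma Ck_on_sum:
  assumes "open A" "\<And>i. i \<in> I \<Longrightarrow> Ck_on k A (f i)"
  shows "Ck_on k A (\<lambda>x. \<Sum>i\<in>I. f i x)"
proof (cases "finite I")
  case True
  then show ?thesis using assms(2)
    by (induction I) (auto intro!: Ck_on_const Ck_on_add[OF assms(1)])
qed (simp add: Ck_on_const)

lemma linear_sum_Basis:
  fixes L :: "'a::euclidean_space \<Rightarrow> 'b::real_vector"
  assumes "linear L"
  shows "L v = (\<Sum>b\<in>Basis. (v \<bullet> b) *\<^sub>R L b)"
proof -
  have "L v = L (\<Sum>b\<in>Basis. (v \<bullet> b) *\<^sub>R b)" by (simp add: euclidean_representation)
  also have "\<dots> = (\<Sum>b\<in>Basis. (v \<bullet> b) *\<^sub>R L b)"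
    by (simp add: linear_sum[OF assms] linear_scale[OF assms] o_def)
  finally show ?thesis .
qed

text \<open>\<open>Ck_on\<close> controls derivatives in fixed directions, whereas the chain rule
  differentiates \<open>g\<close> in a direction that moves with \<open>x\<close>. Expanding this
  direction in the basis of the Euclidean middle space gives a finite sum of products, to which the
  closure properties above apply.\<close>

lemma Ck_on_compose:
  fixes f :: "'a::real_normed_vector \<Rightarrow> 'b::euclidean_space"
  assumes "open A" "open B" "f ` A \<subseteq> B" "Ck_on k A f" "Ck_on k B g"
  shows "Ck_on k A (\<lambda>x. g (f x))"
  using assms(4,5)
proof (induction k arbitrary: g)
  case 0
  then show ?case using continuous_on_compose2[OF _ _ assms(3)] by auto
next
  case (Suc k)
  have B: "f x \<in> B" if "x \<in> A" for x using assms(3) that by auto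
  have dg: "(g has_derivative frechet_derivative g (at y)) (at y)" if "y \<in> B" for y
    using Suc.prems that by (auto intro: has_derivative_frechet)
  have df: "(f has_derivative frechet_derivative f (at x)) (at x)" if "x \<in> A" for x
    using Suc.prems that by (auto intro: has_derivative_frechet)
  have d: "((\<lambda>x. g (f x)) has_derivative (\<lambda>v. frechet_derivative g (at (f x)) (frechet_derivative f (at x) v))) (at x)"
    if "x \<in> A" for x
    using has_derivative_compose[OF df[OF that] dg[OF B[OF that]]] .
  have e: "frechet_derivative g (at (f x)) (frechet_derivative f (at x) v) =
      (\<Sum>b\<in>Basis. (frechet_derivative f (at x) v \<bullet> b) *\<^sub>R frechet_derivative g (at (f x)) b)"
    if "x \<in> A" for x v
    using linear_sum_Basis[OF has_derivative_linear[OF dg[OF B[OF that]]]] .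
  have "Ck_on k A (\<lambda>x. frechet_derivative (\<lambda>x. g (f x)) (at x) v)" for v
  proof -
    have "Ck_on k A (\<lambda>x. \<Sum>b\<in>Basis. (frechet_derivative f (at x) v \<bullet> b) *\<^sub>R frechet_derivative g (at (f x)) b)"
    proof (intro Ck_on_sum Ck_on_scaleR assms(1))
      fix b :: 'b
      show "Ck_on k A (\<lambda>x. frechet_derivative f (at x) v \<bullet> b)"
        using Suc.prems by (intro Ck_on_bounded_linear[OF assms(1) bounded_linear_inner_left]) simp
      show "Ck_on k A (\<lambda>x. frechet_derivative g (at (f x)) b)"
        using Suc.IH[of "\<lambda>y. frechet_derivative g (at y) b"] Suc.prems Ck_on_Suc_imp by auto
    qed
    then show ?thesis
      by (subst Ck_on_cong[OF assms(1)]) (auto simp: frechet_derivativeI[OF d] e)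
  qed
  moreover have "(\<lambda>x. g (f x)) differentiable (at x)" if "x \<in> A" for x
    using d[OF that] by (auto simp: differentiable_def)
  ultimately show ?case by simp
qed

lemma smooth_on_cong:
  "open A \<Longrightarrow> (\<And>z. z \<in> A \<Longrightarrow> f z = g z) \<Longrightarrow> smooth_on A f \<longleftrightarrow> smooth_on A g"
  unfolding smooth_on_def using Ck_on_cong by metis

lemma smooth_on_subset: "smooth_on A f \<Longrightarrow> B \<subseteq> A \<Longrightarrow> smooth_on B f"
  unfolding smooth_on_def using Ck_on_subset by metis

lemma smooth_on_differentiable: "smooth_on A f \<Longrightarrow> x \<in> A \<Longrightarrow> f differentiable (at x)"
  unfolding smooth_on_def by (metis Ck_on.simps(2))

lemma smooth_on_has_derivative:
  "smooth_on A f \<Longrightarrow> x \<in> A \<Longrightarrow> (f has_derivative frechet_derivative f (at x)) (at x)"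
  by (intro has_derivative_frechet smooth_on_differentiable)

lemma smooth_on_linear: "smooth_on A f \<Longrightarrow> x \<in> A \<Longrightarrow> linear (frechet_derivative f (at x))"
  using smooth_on_has_derivative has_derivative_linear by blast

lemma smooth_on_continuous: "smooth_on A f \<Longrightarrow> continuous_on A f"
  unfolding smooth_on_def using Ck_on.simps(1) by blast

lemma smooth_on_derivative: "smooth_on A f \<Longrightarrow> smooth_on A (\<lambda>x. frechet_derivative f (at x) v)"
  unfolding smooth_on_def by (metis Ck_on.simps(2))

lemma smooth_on_const: "smooth_on A (\<lambda>x. c)"
  unfolding smooth_on_def using Ck_on_const by blast

lemma smooth_on_bounded_linear: "open A \<Longrightarrow> bounded_linear L \<Longrightarrow> smooth_on A f \<Longrightarrow> smooth_on A (\<lambda>x. L (f x))"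
  unfolding smooth_on_def using Ck_on_bounded_linear by blast

lemma smooth_on_ident: "smooth_on A (\<lambda>x. x)"
proof -
  have "Ck_on k A (\<lambda>x. x)" for k by (cases k) (auto simp: Ck_on_const)
  then show ?thesis by (simp add: smooth_on_def)
qed

lemmas smooth_on_linear_map = smooth_on_bounded_linear[OF _ _ smooth_on_ident]

lemma smooth_on_add: "open A \<Longrightarrow> smooth_on A f \<Longrightarrow> smooth_on A g \<Longrightarrow> smooth_on A (\<lambda>x. f x + g x)"
  unfolding smooth_on_def using Ck_on_add by blast

lemma smooth_on_scaleR: "open A \<Longrightarrow> smooth_on A f \<Longrightarrow> smooth_on A g \<Longrightarrow> smooth_on A (\<lambda>x. f x *\<^sub>R g x)"
  unfolding smooth_on_def using Ck_on_scaleR by blast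

lemma smooth_on_sum: "open A \<Longrightarrow> (\<And>i. i \<in> I \<Longrightarrow> smooth_on A (f i)) \<Longrightarrow> smooth_on A (\<lambda>x. \<Sum>i\<in>I. f i x)"
  unfolding smooth_on_def using Ck_on_sum by metis

lemma smooth_on_compose:
  fixes f :: "'a::real_normed_vector \<Rightarrow> 'b::euclidean_space"
  shows "open A \<Longrightarrow> open B \<Longrightarrow> f ` A \<subseteq> B \<Longrightarrow> smooth_on A f \<Longrightarrow> smooth_on B g \<Longrightarrow> smooth_on A (\<lambda>x. g (f x))"
  unfolding smooth_on_def using Ck_on_compose by blast

lemma smooth_on_fst: "open A \<Longrightarrow> smooth_on A f \<Longrightarrow> smooth_on A (\<lambda>x. fst (f x))"
  using smooth_on_bounded_linear[OF _ bounded_linear_fst] .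

lemma smooth_on_snd: "open A \<Longrightarrow> smooth_on A f \<Longrightarrow> smooth_on A (\<lambda>x. snd (f x))"
  using smooth_on_bounded_linear[OF _ bounded_linear_snd] .

lemma smooth_on_inner: "open A \<Longrightarrow> smooth_on A f \<Longrightarrow> smooth_on A (\<lambda>x. f x \<bullet> b)"
  using smooth_on_bounded_linear[OF _ bounded_linear_inner_left] .

lemma smooth_on_Pair:
  assumes "open A" "smooth_on A f" "smooth_on A g"
  shows "smooth_on A (\<lambda>x. (f x, g x))"
proof -
  have "bounded_linear (\<lambda>x::'b. (x, 0::'c))" "bounded_linear (\<lambda>x::'c. (0::'b, x))"
    by (auto intro!: bounded_linear_Pair bounded_linear_ident bounded_linear_zero)
  from this[THEN smooth_on_bounded_linear[OF assms(1)]] assms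
  have "smooth_on A (\<lambda>x. (f x, 0) + (0, g x))" by (intro smooth_on_add) auto
  then show ?thesis by simp
qed

text \<open>Base point and direction vary together, which is the form taken by the components of a
  vector field after a change of charts. The direction is again expanded in the basis.\<close>

lemma smooth_on_frechet_compose:
  fixes g :: "'a::real_normed_vector \<Rightarrow> 'b::euclidean_space"
  assumes "open A" "open B" "g ` A \<subseteq> B" "smooth_on A g" "smooth_on A h" "smooth_on B f"
  shows "smooth_on A (\<lambda>x. frechet_derivative f (at (g x)) (h x))"
proof -
  have "frechet_derivative f (at (g x)) (h x) =
      (\<Sum>b\<in>Basis. (h x \<bullet> b) *\<^sub>R frechet_derivative f (at (g x)) b)" if "x \<in> A" for x
    using linear_sum_Basis smooth_on_linear[OF assms(6)] assms(3) that by blast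
  moreover have "smooth_on A (\<lambda>x. \<Sum>b\<in>Basis. (h x \<bullet> b) *\<^sub>R frechet_derivative f (at (g x)) b)"
    using assms by (intro smooth_on_sum smooth_on_scaleR smooth_on_inner)
      (auto intro!: smooth_on_compose[OF _ assms(2,3) _ smooth_on_derivative])
  ultimately show ?thesis by (subst smooth_on_cong[OF assms(1)]) auto
qed

section \<open>Symmetry of second derivatives\<close>

lemma second_difference:
  fixes f :: "'a::real_normed_vector \<Rightarrow> real"
  assumes f: "smooth_on A f" and h: "0 < h"
    and A: "\<And>s t. 0 \<le> s \<Longrightarrow> s \<le> h \<Longrightarrow> 0 \<le> t \<Longrightarrow> t \<le> h \<Longrightarrow> x + s *\<^sub>R u + t *\<^sub>R v \<in> A"
  obtains s t where "0 < s" "s < h" "0 < t" "t < h"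
    "f (x + h *\<^sub>R u + h *\<^sub>R v) - f (x + h *\<^sub>R u) - f (x + h *\<^sub>R v) + f x =
     h\<^sup>2 * frechet_derivative (\<lambda>y. frechet_derivative f (at y) u) (at (x + s *\<^sub>R u + t *\<^sub>R v)) v"
proof -
  let ?\<phi> = "\<lambda>s. f (x + s *\<^sub>R u + h *\<^sub>R v) - f (x + s *\<^sub>R u)"
  let ?fu = "\<lambda>y. frechet_derivative f (at y) u"
  have d: "((\<lambda>s. g (y + s *\<^sub>R z)) has_derivative (\<lambda>r. r * frechet_derivative g (at (y + s *\<^sub>R z)) z)) (at s)"
    if "smooth_on A g" "y + s *\<^sub>R z \<in> A" for g :: "'a \<Rightarrow> real" and y z s
  proof -
    have "((\<lambda>s. y + s *\<^sub>R z) has_derivative (\<lambda>r. r *\<^sub>R z)) (at s)"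
      by (auto intro!: derivative_eq_intros)
    from has_derivative_compose[OF this smooth_on_has_derivative[OF that]]
    show ?thesis by (simp add: linear_scale[OF smooth_on_linear[OF that]])
  qed
  have d1: "(?\<phi> has_derivative (\<lambda>r. r * (?fu (x + s *\<^sub>R u + h *\<^sub>R v) - ?fu (x + s *\<^sub>R u)))) (at s)"
    if "0 \<le> s" "s \<le> h" for s
  proof -
    have "x + h *\<^sub>R v + s *\<^sub>R u \<in> A" using A[of s h] that h by (simp add: add_ac)
    moreover have "x + s *\<^sub>R u \<in> A" using A[of s 0] that h by simp
    ultimately have "((\<lambda>s. f (x + h *\<^sub>R v + s *\<^sub>R u) - f (x + s *\<^sub>R u)) has_derivative
       (\<lambda>r. r * ?fu (x + h *\<^sub>R v + s *\<^sub>R u) - r * ?fu (x + s *\<^sub>R u))) (at s)"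
      by (intro has_derivative_diff d f)
    then show ?thesis by (simp add: algebra_simps)
  qed
  \<comment> \<open>The second difference is the increment of \<open>?\<phi>\<close> over
    \<open>[0, h]\<close>. The mean value theorem is applied to it in the direction
    \<open>u\<close>, and below to the resulting difference of derivatives in the direction
    \<open>v\<close>.\<close>
  obtain s where s: "0 < s" "s < h"
    "?\<phi> h - ?\<phi> 0 = (h - 0) * (?fu (x + s *\<^sub>R u + h *\<^sub>R v) - ?fu (x + s *\<^sub>R u))"
    by (rule mvt[OF h, of ?\<phi> "\<lambda>s r. r * (?fu (x + s *\<^sub>R u + h *\<^sub>R v) - ?fu (x + s *\<^sub>R u))"])
      (auto intro!: d1 continuous_at_imp_continuous_on has_derivative_continuous[OF d1])
  have d2: "((\<lambda>t. ?fu (x + s *\<^sub>R u + t *\<^sub>R v)) has_derivative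
      (\<lambda>r. r * frechet_derivative ?fu (at (x + s *\<^sub>R u + t *\<^sub>R v)) v)) (at t)" if "0 \<le> t" "t \<le> h" for t
    using that s A[of s t] by (intro d smooth_on_derivative f) auto
  obtain t where t: "0 < t" "t < h"
    "?fu (x + s *\<^sub>R u + h *\<^sub>R v) - ?fu (x + s *\<^sub>R u + 0 *\<^sub>R v) =
      (h - 0) * frechet_derivative ?fu (at (x + s *\<^sub>R u + t *\<^sub>R v)) v"
    by (rule mvt[OF h, of "\<lambda>t. ?fu (x + s *\<^sub>R u + t *\<^sub>R v)"
          "\<lambda>t r. r * frechet_derivative ?fu (at (x + s *\<^sub>R u + t *\<^sub>R v)) v"])
      (auto intro!: d2 continuous_at_imp_continuous_on has_derivative_continuous[OF d2])
  show thesis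
    by (rule that[OF s(1,2) t(1,2)]) (use s(3) t(3) in \<open>simp add: power2_eq_square\<close>)
qed

text \<open>The second difference is symmetric in \<open>u\<close> and \<open>v\<close>. Expressed
  in both orders it equals \<open>h\<^sup>2\<close> times each of the two mixed derivatives, taken
  at points near \<open>x\<close>, and both are continuous at \<open>x\<close>.\<close>

lemma frechet_derivative_swap_real:
  fixes f :: "'a::real_normed_vector \<Rightarrow> real"
  assumes A: "open A" and x: "x \<in> A" and f: "smooth_on A f"
  shows "frechet_derivative (\<lambda>y. frechet_derivative f (at y) u) (at x) v =
    frechet_derivative (\<lambda>y. frechet_derivative f (at y) v) (at x) u"
proof (rule ccontr)
  define p q where "p = (\<lambda>y. frechet_derivative (\<lambda>y. frechet_derivative f (at y) u) (at y) v)"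
    and "q = (\<lambda>y. frechet_derivative (\<lambda>y. frechet_derivative f (at y) v) (at y) u)"
  assume "\<not> ?thesis"
  then have ne: "p x \<noteq> q x" by (simp add: p_def q_def)
  \<comment> \<open>Half the gap: no number is closer than \<open>e\<close> to both
    \<open>p x\<close> and \<open>q x\<close>.\<close>
  define e where "e = \<bar>p x - q x\<bar> / 2"
  have e: "e > 0" using ne by (simp add: e_def)
  have "continuous_on A p" "continuous_on A q"
    unfolding p_def q_def by (intro smooth_on_continuous smooth_on_derivative f)+
  then have "isCont p x" "isCont q x" using A x continuous_on_eq_continuous_at by blast+
  then obtain d1 d2 where d1: "d1 > 0" "\<And>y. dist y x < d1 \<Longrightarrow> dist (p y) (p x) < e"
    and d2: "d2 > 0" "\<And>y. dist y x < d2 \<Longrightarrow> dist (q y) (q x) < e"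
    using e unfolding continuous_at_eps_delta by blast
  obtain d3 where d3: "d3 > 0" "ball x d3 \<subseteq> A" using A x open_contains_ball by blast
  define d where "d = min d1 (min d2 d3)"
  \<comment> \<open>This keeps the whole parallelogram spanned by \<open>h *\<^sub>R u\<close> and
    \<open>h *\<^sub>R v\<close> within \<open>d / 2\<close> of \<open>x\<close>; the summand 1
    keeps the denominator positive when both vectors are zero.\<close>
  define h where "h = d / (2 * (norm u + norm v + 1))"
  have d: "d > 0" using d1 d2 d3 by (simp add: d_def)
  have n: "norm u + norm v + 1 > 0" by (simp add: add_nonneg_pos)
  have h: "h > 0" using d n by (simp add: h_def)
  have close: "dist (x + s *\<^sub>R u + t *\<^sub>R v) x < d" if "0 \<le> s" "s \<le> h" "0 \<le> t" "t \<le> h" for s t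
  proof -
    have "dist (x + s *\<^sub>R u + t *\<^sub>R v) x = norm (s *\<^sub>R u + t *\<^sub>R v)" by (simp add: dist_norm algebra_simps)
    also have "\<dots> \<le> s * norm u + t * norm v" using that by (metis abs_of_nonneg norm_scaleR norm_triangle_ineq)
    also have "\<dots> \<le> h * norm u + h * norm v" using that by (intro add_mono mult_right_mono) auto
    also have "\<dots> \<le> h * (norm u + norm v + 1)" using h by (simp add: algebra_simps)
    also have "\<dots> = d / 2"
      unfolding h_def times_divide_eq_left using n by (subst mult_divide_mult_cancel_right) auto
    finally show ?thesis using d by simp
  qed
  have inA: "x + s *\<^sub>R u + t *\<^sub>R v \<in> A" if "0 \<le> s" "s \<le> h" "0 \<le> t" "t \<le> h" for s t
    using close[OF that] d3(2) by (auto simp: d_def mem_ball dist_commute)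
  then have inA': "x + s *\<^sub>R v + t *\<^sub>R u \<in> A" if "0 \<le> s" "s \<le> h" "0 \<le> t" "t \<le> h" for s t
    using inA[of t s] that by (simp add: add_ac)
  obtain s t where st: "0 < s" "s < h" "0 < t" "t < h"
    "f (x + h *\<^sub>R u + h *\<^sub>R v) - f (x + h *\<^sub>R u) - f (x + h *\<^sub>R v) + f x = h\<^sup>2 * p (x + s *\<^sub>R u + t *\<^sub>R v)"
    unfolding p_def using second_difference[OF f h inA] by blast
  obtain s' t' where st': "0 < s'" "s' < h" "0 < t'" "t' < h"
    "f (x + h *\<^sub>R v + h *\<^sub>R u) - f (x + h *\<^sub>R v) - f (x + h *\<^sub>R u) + f x = h\<^sup>2 * q (x + s' *\<^sub>R v + t' *\<^sub>R u)"
    unfolding q_def using second_difference[OF f h inA'] by blast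
  have "h\<^sup>2 * p (x + s *\<^sub>R u + t *\<^sub>R v) = h\<^sup>2 * q (x + s' *\<^sub>R v + t' *\<^sub>R u)"
    using st(5) st'(5) by (simp only: add.assoc add.commute[of "h *\<^sub>R v"])
  then have "p (x + s *\<^sub>R u + t *\<^sub>R v) = q (x + s' *\<^sub>R v + t' *\<^sub>R u)" using h by simp
  moreover have "dist (p (x + s *\<^sub>R u + t *\<^sub>R v)) (p x) < e"
    using close[of s t] st by (intro d1(2)) (auto simp: d_def)
  moreover have "dist (q (x + s' *\<^sub>R v + t' *\<^sub>R u)) (q x) < e"
    using close[of t' s'] st' by (intro d2(2)) (auto simp: d_def add_ac)
  ultimately show False unfolding e_def dist_real_def by argo
qed

lemma frechet_derivative_bounded_linear:
  assumes "bounded_linear L" "f differentiable (at x)"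
  shows "frechet_derivative (\<lambda>y. L (f y)) (at x) v = L (frechet_derivative f (at x) v)"
  using frechet_derivativeI[OF bounded_linear.has_derivative[OF assms(1) has_derivative_frechet[OF assms(2)]]]
  by simp

lemma frechet_derivative_swap:
  fixes f :: "'a::real_normed_vector \<Rightarrow> 'b::euclidean_space"
  assumes A: "open A" and x: "x \<in> A" and f: "smooth_on A f"
  shows "frechet_derivative (\<lambda>y. frechet_derivative f (at y) u) (at x) v =
    frechet_derivative (\<lambda>y. frechet_derivative f (at y) v) (at x) u"
proof (rule euclidean_eqI)
  fix b :: 'b
  note L = bounded_linear_inner_left[of b]
  have *: "frechet_derivative (\<lambda>y. frechet_derivative (\<lambda>z. f z \<bullet> b) (at y) u) (at x) v =
      frechet_derivative (\<lambda>y. frechet_derivative f (at y) u) (at x) v \<bullet> b" for u v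
  proof -
    have "frechet_derivative (\<lambda>y. frechet_derivative (\<lambda>z. f z \<bullet> b) (at y) u) (at x) =
        frechet_derivative (\<lambda>y. frechet_derivative f (at y) u \<bullet> b) (at x)"
      using frechet_derivative_bounded_linear[OF L smooth_on_differentiable[OF f]]
      by (intro frechet_derivative_cong_open[OF A x]) auto
    then show ?thesis
      using frechet_derivative_bounded_linear[OF L smooth_on_differentiable[OF smooth_on_derivative[OF f] x]]
      by simp
  qed
  show "frechet_derivative (\<lambda>y. frechet_derivative f (at y) u) (at x) v \<bullet> b =
    frechet_derivative (\<lambda>y. frechet_derivative f (at y) v) (at x) u \<bullet> b"
    using frechet_derivative_swap_real[OF A x smooth_on_inner[OF A f], of b u v] by (simp add: *)
qed

text \<open>A product rule in which the first summand is a second derivative of \<open>f\<close>. It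
  serves to differentiate the transformation law of vector components and the transition maps of the
  tangent bundle.\<close>

lemma frechet_derivative_frechet_compose:
  fixes g :: "'a::real_normed_vector \<Rightarrow> 'b::euclidean_space"
    and f :: "'b \<Rightarrow> 'c::real_normed_vector"
  assumes B: "open B" "smooth_on B f" "g x \<in> B"
    and g: "(g has_derivative g') (at x)" and h: "(h has_derivative h') (at x)"
  shows "((\<lambda>y. frechet_derivative f (at (g y)) (h y)) has_derivative
    (\<lambda>v. frechet_derivative (\<lambda>z. frechet_derivative f (at z) (h x)) (at (g x)) (g' v) +
         frechet_derivative f (at (g x)) (h' v))) (at x)"
proof -
  let ?D = "\<lambda>b z. frechet_derivative f (at z) b"
  have lin: "frechet_derivative f (at z) w = (\<Sum>b\<in>Basis. (w \<bullet> b) *\<^sub>R ?D b z)" if "z \<in> B" for z w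
    by (rule linear_sum_Basis[OF smooth_on_linear[OF B(2) that]])
  have dD: "(?D b has_derivative frechet_derivative (?D b) (at (g x))) (at (g x))" for b
    using smooth_on_has_derivative[OF smooth_on_derivative[OF B(2)] B(3)] .
  obtain A where A: "open A" "x \<in> A" "g ` A \<subseteq> B"
  proof -
    have "continuous (at x) g" using g has_derivative_continuous by blast
    then have "\<exists>A. open A \<and> x \<in> A \<and> (\<forall>y\<in>A. g y \<in> B)"
      using B(1,3) unfolding continuous_at_open by blast
    then show thesis using that by blast
  qed
  have 1: "((\<lambda>y. \<Sum>b\<in>Basis. (h y \<bullet> b) *\<^sub>R ?D b (g y)) has_derivative
     (\<lambda>v. \<Sum>b\<in>Basis. (h x \<bullet> b) *\<^sub>R frechet_derivative (?D b) (at (g x)) (g' v) + (h' v \<bullet> b) *\<^sub>R ?D b (g x))) (at x)"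
    by (intro has_derivative_sum has_derivative_scaleR has_derivative_compose[OF g dD]
        has_derivative_inner_left h)
  have 2: "frechet_derivative (?D w) (at (g x)) u = (\<Sum>b\<in>Basis. (w \<bullet> b) *\<^sub>R frechet_derivative (?D b) (at (g x)) u)" for w u
  proof -
    have "((\<lambda>z. \<Sum>b\<in>Basis. (w \<bullet> b) *\<^sub>R ?D b z) has_derivative
       (\<lambda>u. \<Sum>b\<in>Basis. (w \<bullet> b) *\<^sub>R frechet_derivative (?D b) (at (g x)) u)) (at (g x))"
      by (intro has_derivative_sum has_derivative_scaleR_right dD)
    then have "(?D w has_derivative
       (\<lambda>u. \<Sum>b\<in>Basis. (w \<bullet> b) *\<^sub>R frechet_derivative (?D b) (at (g x)) u)) (at (g x))"
      by (subst has_derivative_cong_open[OF B(1,3), OF lin])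
    from frechet_derivativeI[OF this] show ?thesis by simp
  qed
  have "((\<lambda>y. \<Sum>b\<in>Basis. (h y \<bullet> b) *\<^sub>R ?D b (g y)) has_derivative
    (\<lambda>v. frechet_derivative (?D (h x)) (at (g x)) (g' v) + frechet_derivative f (at (g x)) (h' v))) (at x)"
    using 1 by (simp add: sum.distrib 2[of "h x"] lin[OF B(3), symmetric])
  then show ?thesis
    using lin A(3) by (subst has_derivative_cong_open[OF A(1,2)]) auto
qed

section \<open>Atlases\<close>

text \<open>The local part of \<open>smooth_manifold\<close>. It passes directly from
  \<open>M\<close> to \<open>slit M\<close>, so that one set of lemmas serves both atlases.\<close>

definition smooth_atlas :: "('p, 'i, 'e::euclidean_space) atlas \<Rightarrow> bool"
  where "smooth_atlas M \<longleftrightarrow>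
    (\<forall>i\<in>index M. cdom M i \<subseteq> points M \<and> inj_on (chart M i) (cdom M i) \<and>
       open (chart M i ` cdom M i)) \<and>
    (\<Union>i\<in>index M. cdom M i) = points M \<and>
    (\<forall>i\<in>index M. \<forall>j\<in>index M. open (chart M i ` (cdom M i \<inter> cdom M j)) \<and>
       smooth_on (chart M i ` (cdom M i \<inter> cdom M j)) (transition M i j))"

lemma smooth_manifold_atlas: "smooth_manifold M \<Longrightarrow> smooth_atlas M"
  by (simp add: smooth_manifold_def smooth_atlas_def)

context
  fixes M :: "('p, 'i, 'e::euclidean_space) atlas"
  assumes M: "smooth_atlas M"
begin

lemma cdom_points: "i \<in> index M \<Longrightarrow> cdom M i \<subseteq> points M"
  using M by (auto simp: smooth_atlas_def)

lemma inj_chart: "i \<in> index M \<Longrightarrow> inj_on (chart M i) (cdom M i)"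
  using M by (auto simp: smooth_atlas_def)

lemma open_chart_dom: "i \<in> index M \<Longrightarrow> open (chart M i ` cdom M i)"
  using M by (auto simp: smooth_atlas_def)

lemma open_overlap: "i \<in> index M \<Longrightarrow> j \<in> index M \<Longrightarrow> open (chart M i ` (cdom M i \<inter> cdom M j))"
  using M by (auto simp: smooth_atlas_def)

lemma smooth_transition: "i \<in> index M \<Longrightarrow> j \<in> index M \<Longrightarrow>
    smooth_on (chart M i ` (cdom M i \<inter> cdom M j)) (transition M i j)"
  using M by (auto simp: smooth_atlas_def)

lemma chart_at_in: "p \<in> points M \<Longrightarrow> chart_at M p \<in> charts_at M p"
proof -
  assume "p \<in> points M"
  then have "p \<in> (\<Union>i\<in>index M. cdom M i)" using M by (simp add: smooth_atlas_def)
  then obtain i where "i \<in> charts_at M p" by (auto simp: charts_at_def)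
  then show ?thesis unfolding chart_at_def by (rule someI)
qed

lemma param_chart [simp]: "i \<in> index M \<Longrightarrow> p \<in> cdom M i \<Longrightarrow> param M i (chart M i p) = p"
  using inj_chart by (simp add: param_def)

lemma transition_chart: "i \<in> index M \<Longrightarrow> p \<in> cdom M i \<Longrightarrow> transition M i j (chart M i p) = chart M j p"
  by (simp add: transition_def)

lemma transition_derivative:
  assumes "i \<in> charts_at M p" "j \<in> charts_at M p"
  shows "(transition M i j has_derivative frechet_derivative (transition M i j) (at (chart M i p))) (at (chart M i p))"
  using assms by (intro smooth_on_has_derivative[OF smooth_transition]) (auto simp: charts_at_def)

lemma transition_linear:
  assumes "i \<in> charts_at M p" "j \<in> charts_at M p"
  shows "linear (frechet_derivative (transition M i j) (at (chart M i p)))"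
  using transition_derivative[OF assms] has_derivative_linear by blast

lemma transition_derivative_self:
  assumes "i \<in> charts_at M p"
  shows "frechet_derivative (transition M i i) (at (chart M i p)) e = e"
proof -
  have i: "i \<in> index M" "p \<in> cdom M i" using assms by (auto simp: charts_at_def)
  have "frechet_derivative (transition M i i) (at (chart M i p)) = frechet_derivative (\<lambda>x. x) (at (chart M i p))"
    using i by (intro frechet_derivative_cong_open[OF open_chart_dom[OF i(1)]]) (auto simp: transition_chart)
  then show ?thesis by simp
qed

lemma transition_derivative_compose:
  assumes "i \<in> charts_at M p" "j \<in> charts_at M p" "k \<in> charts_at M p"
  shows "frechet_derivative (transition M j k) (at (chart M j p)) (frechet_derivative (transition M i j) (at (chart M i p)) e)
    = frechet_derivative (transition M i k) (at (chart M i p)) e"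
proof -
  have i: "i \<in> index M" "p \<in> cdom M i" and j: "j \<in> index M" "p \<in> cdom M j"
    using assms by (auto simp: charts_at_def)
  have "(transition M j k has_derivative frechet_derivative (transition M j k) (at (chart M j p)))
      (at (transition M i j (chart M i p)))"
    using transition_derivative[OF assms(2,3)] transition_chart[OF i] by simp
  from has_derivative_compose[OF transition_derivative[OF assms(1,2)] this]
  have "((\<lambda>x. transition M j k (transition M i j x)) has_derivative
    (\<lambda>e. frechet_derivative (transition M j k) (at (chart M j p)) (frechet_derivative (transition M i j) (at (chart M i p)) e)))
    (at (chart M i p))" .
  then have "(transition M i k has_derivative
    (\<lambda>e. frechet_derivative (transition M j k) (at (chart M j p)) (frechet_derivative (transition M i j) (at (chart M i p)) e)))
    (at (chart M i p))"
    using i j by (subst (asm) has_derivative_cong_open[OF open_overlap[OF i(1) j(1)]])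
      (auto simp: transition_chart)
  from frechet_derivativeI[OF this] show ?thesis by simp
qed

lemma tangent_transition:
  assumes "\<xi> \<in> tangent_space M p" "i \<in> charts_at M p" "j \<in> charts_at M p"
  shows "\<xi> j = frechet_derivative (transition M i j) (at (chart M i p)) (\<xi> i)"
  using assms unfolding tangent_space_def by blast

lemma tangent_outside: "\<xi> \<in> tangent_space M p \<Longrightarrow> i \<notin> charts_at M p \<Longrightarrow> \<xi> i = 0"
  by (auto simp: tangent_space_def)

text \<open>One component determines the others through the transition maps, so an identity of
  tangent vectors may be checked in a single chart. Most coordinate computations below end in this
  way.\<close>

lemma tangent_eqI:
  assumes "\<xi> \<in> tangent_space M p" "\<eta> \<in> tangent_space M p" "i \<in> charts_at M p" "\<xi> i = \<eta> i"
  shows "\<xi> = \<eta>"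
proof
  fix j show "\<xi> j = \<eta> j"
    using assms tangent_transition[of \<xi> p i j] tangent_transition[of \<eta> p i j] tangent_outside[of _ p j]
    by (cases "j \<in> charts_at M p") metis+
qed

lemma coord_vec_same [simp]: "i \<in> charts_at M p \<Longrightarrow> coord_vec M i p e i = e"
  by (simp add: coord_vec_def transition_derivative_self)

lemma coord_vec_tangent: "i \<in> charts_at M p \<Longrightarrow> coord_vec M i p e \<in> tangent_space M p"
  by (auto simp: tangent_space_def coord_vec_def transition_derivative_compose)

lemma coord_vec_component:
  "\<xi> \<in> tangent_space M p \<Longrightarrow> i \<in> charts_at M p \<Longrightarrow> coord_vec M i p (\<xi> i) = \<xi>"
  by (auto intro: tangent_eqI coord_vec_tangent)

lemma subspace_tangent: "subspace (tangent_space M p)"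
  unfolding subspace_def
proof (intro conjI allI ballI)
  show "0 \<in> tangent_space M p"
    unfolding tangent_space_def by (simp add: linear_0[OF transition_linear])
next
  fix \<xi> \<eta> assume "\<xi> \<in> tangent_space M p" "\<eta> \<in> tangent_space M p"
  then have "(\<xi> + \<eta>) j = frechet_derivative (transition M i j) (at (chart M i p)) ((\<xi> + \<eta>) i)"
    if "i \<in> charts_at M p" "j \<in> charts_at M p" for i j
    using that tangent_transition[of \<xi> p i j] tangent_transition[of \<eta> p i j]
    by (simp add: linear_add[OF transition_linear])
  moreover have "(\<xi> + \<eta>) j = 0" if "j \<notin> charts_at M p" for j
    using that \<open>\<xi> \<in> _\<close> \<open>\<eta> \<in> _\<close> by (simp add: tangent_outside)
  ultimately show "\<xi> + \<eta> \<in> tangent_space M p" unfolding tangent_space_def by blast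
next
  fix c \<xi> assume "\<xi> \<in> tangent_space M p"
  then have "(c *\<^sub>R \<xi>) j = frechet_derivative (transition M i j) (at (chart M i p)) ((c *\<^sub>R \<xi>) i)"
    if "i \<in> charts_at M p" "j \<in> charts_at M p" for i j
    using that tangent_transition[of \<xi> p i j] by (simp add: scaleR_fun_def linear_scale[OF transition_linear])
  moreover have "(c *\<^sub>R \<xi>) j = 0" if "j \<notin> charts_at M p" for j
    using that \<open>\<xi> \<in> _\<close> by (simp add: tangent_outside scaleR_fun_def)
  ultimately show "c *\<^sub>R \<xi> \<in> tangent_space M p" unfolding tangent_space_def by blast
qed

lemmas tangent_add = subspace_add[OF subspace_tangent]
lemmas tangent_diff = subspace_diff[OF subspace_tangent]
lemmas tangent_scale = subspace_scale[OF subspace_tangent]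
lemmas tangent_0 = subspace_0[OF subspace_tangent]
lemmas tangent_sum = subspace_sum[OF subspace_tangent]

section \<open>The manifold topology, and fields and functions in charts\<close>

lemma openin_mtop: "openin (mtop M) A \<longleftrightarrow> A \<subseteq> points M \<and> (\<forall>i\<in>index M. open (chart M i ` (A \<inter> cdom M i)))"
proof -
  have "istopology (\<lambda>A. A \<subseteq> points M \<and> (\<forall>i\<in>index M. open (chart M i ` (A \<inter> cdom M i))))"
    unfolding istopology_def
  proof (intro conjI allI impI)
    fix A B assume A: "A \<subseteq> points M \<and> (\<forall>i\<in>index M. open (chart M i ` (A \<inter> cdom M i)))"
      and B: "B \<subseteq> points M \<and> (\<forall>i\<in>index M. open (chart M i ` (B \<inter> cdom M i)))"
    \<comment> \<open>Injectivity of the chart makes the image commute with the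
      intersection.\<close>
    have "chart M i ` (A \<inter> B \<inter> cdom M i) = chart M i ` (A \<inter> cdom M i) \<inter> chart M i ` (B \<inter> cdom M i)"
      if "i \<in> index M" for i
      using inj_on_image_Int[OF inj_chart[OF that], of "A \<inter> cdom M i" "B \<inter> cdom M i"]
      by (simp add: Int_ac)
    then show "A \<inter> B \<subseteq> points M" "\<forall>i\<in>index M. open (chart M i ` (A \<inter> B \<inter> cdom M i))"
      using A B by (auto intro!: open_Int)
  next
    fix K assume K: "\<forall>A\<in>K. A \<subseteq> points M \<and> (\<forall>i\<in>index M. open (chart M i ` (A \<inter> cdom M i)))"
    have "chart M i ` (\<Union> K \<inter> cdom M i) = (\<Union>A\<in>K. chart M i ` (A \<inter> cdom M i))" for i by auto
    then show "\<Union> K \<subseteq> points M" "\<forall>i\<in>index M. open (chart M i ` (\<Union> K \<inter> cdom M i))"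
      using K by (auto intro!: open_UN)
  qed
  then show ?thesis unfolding mtop_def by (simp add: topology_inverse')
qed

lemma openin_mtop_chart: "openin (mtop M) A \<Longrightarrow> i \<in> index M \<Longrightarrow> open (chart M i ` (A \<inter> cdom M i))"
  by (simp add: openin_mtop)

lemma openin_cdom: "i \<in> index M \<Longrightarrow> openin (mtop M) (cdom M i)"
  using cdom_points open_overlap by (auto simp: openin_mtop Int_commute)

lemma openin_mtop_points: "openin (mtop M) (points M)"
  using cdom_points open_chart_dom by (auto simp: openin_mtop Int_absorb1)

lemma vector_field_subset:
  "vector_field M A X \<Longrightarrow> openin (mtop M) B \<Longrightarrow> B \<subseteq> A \<Longrightarrow> vector_field M B X"
  unfolding vector_field_def by (meson smooth_on_subset image_mono Int_mono order_refl subsetD)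

lemma vector_field_cong:
  assumes "vector_field M A X" "\<And>p. p \<in> A \<Longrightarrow> Y p = X p"
  shows "vector_field M A Y"
proof -
  have "smooth_on (chart M i ` (A \<inter> cdom M i)) (\<lambda>x. Y (param M i x) i)" if "i \<in> index M" for i
  proof -
    have "smooth_on (chart M i ` (A \<inter> cdom M i)) (\<lambda>x. X (param M i x) i)" "open (chart M i ` (A \<inter> cdom M i))"
      using assms that openin_mtop by (auto simp: vector_field_def)
    then show ?thesis using assms(2) that by (subst smooth_on_cong[where g = "\<lambda>x. X (param M i x) i"]) auto
  qed
  then show ?thesis using assms by (auto simp: vector_field_def)
qed

lemma vector_field_tangent: "vector_field M A X \<Longrightarrow> p \<in> A \<Longrightarrow> X p \<in> tangent_space M p"
  by (simp add: vector_field_def)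

lemma vector_field_openin: "vector_field M A X \<Longrightarrow> openin (mtop M) A"
  by (simp add: vector_field_def)

lemma vector_field_smooth:
  "vector_field M A X \<Longrightarrow> i \<in> index M \<Longrightarrow> smooth_on (chart M i ` (A \<inter> cdom M i)) (\<lambda>x. X (param M i x) i)"
  by (simp add: vector_field_def)

lemma chart_overlap_image:
  assumes "openin (mtop M) A" "i \<in> index M" "j \<in> index M" "A \<subseteq> cdom M i"
  shows "open (chart M j ` (A \<inter> cdom M j))"
    "transition M j i ` chart M j ` (A \<inter> cdom M j) \<subseteq> chart M i ` A"
    "smooth_on (chart M j ` (A \<inter> cdom M j)) (transition M j i)"
proof -
  show "open (chart M j ` (A \<inter> cdom M j))" using assms openin_mtop by auto
  show "transition M j i ` chart M j ` (A \<inter> cdom M j) \<subseteq> chart M i ` A"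
    using assms by (auto simp: transition_chart)
  show "smooth_on (chart M j ` (A \<inter> cdom M j)) (transition M j i)"
    using assms by (intro smooth_on_subset[OF smooth_transition]) auto
qed

text \<open>In another chart \<open>j\<close> the component is the derivative of
  \<open>transition M i j\<close> applied to the component in \<open>i\<close>, all composed with
  \<open>transition M j i\<close>; hence smoothness in one chart that covers \<open>A\<close> is
  enough.\<close>

lemma vector_field_chartI:
  assumes A: "openin (mtop M) A" and i: "i \<in> index M" "A \<subseteq> cdom M i"
    and X: "\<And>p. p \<in> A \<Longrightarrow> X p \<in> tangent_space M p"
    and s: "smooth_on (chart M i ` A) (\<lambda>x. X (param M i x) i)"
  shows "vector_field M A X"
proof -
  have "smooth_on (chart M j ` (A \<inter> cdom M j)) (\<lambda>x. X (param M j x) j)" if j: "j \<in> index M" for j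
  proof -
    let ?B = "chart M j ` (A \<inter> cdom M j)"
    note o = chart_overlap_image[OF A i(1) j i(2)]
    have oA: "open (chart M i ` A)" using A i by (metis Int_absorb2 openin_mtop)
    have c: "smooth_on ?B (\<lambda>x. X (param M i (transition M j i x)) i)"
      using smooth_on_compose[OF o(1) oA o(2,3) s] by simp
    have "smooth_on ?B (\<lambda>x. frechet_derivative (transition M i j) (at (transition M j i x)) (X (param M i (transition M j i x)) i))"
    proof (rule smooth_on_frechet_compose[OF o(1) open_overlap[OF i(1) j] _ o(3) c smooth_transition[OF i(1) j]])
      show "transition M j i ` chart M j ` (A \<inter> cdom M j) \<subseteq> chart M i ` (cdom M i \<inter> cdom M j)"
        using i j by (auto simp: transition_chart)
    qed
    then show ?thesis
    proof (subst smooth_on_cong[OF o(1)])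
      fix z assume "z \<in> ?B"
      then obtain p where p: "p \<in> A" "p \<in> cdom M j" "z = chart M j p" by auto
      then have "i \<in> charts_at M p" "j \<in> charts_at M p" using i j by (auto simp: charts_at_def)
      then show "X (param M j z) j = frechet_derivative (transition M i j) (at (transition M j i z)) (X (param M i (transition M j i z)) i)"
        using p i j subsetD[OF i(2) p(1)] tangent_transition[OF X[OF p(1)], of i j] by (simp add: transition_chart)
    qed
  qed
  then show ?thesis using A X by (auto simp: vector_field_def)
qed

text \<open>With constant \<open>h\<close> this extends a single tangent vector to a field, which is
  how statements about fields are applied to vectors at a point.\<close>

lemma coord_vec_field:
  assumes A: "openin (mtop M) A" and i: "i \<in> index M" "A \<subseteq> cdom M i"
    and s: "smooth_on (chart M i ` A) h"
  shows "vector_field M A (\<lambda>p. coord_vec M i p (h (chart M i p)))"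
proof (rule vector_field_chartI[OF A i])
  fix p assume "p \<in> A"
  then show "coord_vec M i p (h (chart M i p)) \<in> tangent_space M p"
    using i by (intro coord_vec_tangent) (auto simp: charts_at_def)
next
  have "open (chart M i ` A)" using A i by (metis Int_absorb2 openin_mtop)
  then show "smooth_on (chart M i ` A) (\<lambda>x. coord_vec M i (param M i x) (h (chart M i (param M i x))) i)"
    using s i by (subst smooth_on_cong[where g = h]) (auto simp: charts_at_def subset_iff)
qed

lemma smooth_fun_chartI:
  assumes A: "openin (mtop M) A" and i: "i \<in> index M" "A \<subseteq> cdom M i"
    and s: "smooth_on (chart M i ` A) (f \<circ> param M i)"
  shows "smooth_fun M A f"
  unfolding smooth_fun_def
proof (intro conjI ballI A)
  fix j assume j: "j \<in> index M"
  note o = chart_overlap_image[OF A i(1) j i(2)]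
  have oA: "open (chart M i ` A)" using A i by (metis Int_absorb2 openin_mtop)
  have "smooth_on (chart M j ` (A \<inter> cdom M j)) (\<lambda>x. (f \<circ> param M i) (transition M j i x))"
    using smooth_on_compose[OF o(1) oA o(2,3) s] .
  then show "smooth_on (chart M j ` (A \<inter> cdom M j)) (f \<circ> param M j)"
    using i j by (subst smooth_on_cong[OF o(1)]) (auto simp: transition_chart subset_iff)
qed

lemma vector_field_component_derivative:
  assumes X: "vector_field M A X" and p: "p \<in> A" "i \<in> charts_at M p"
  shows "((\<lambda>x. X (param M i x) i) has_derivative frechet_derivative (\<lambda>x. X (param M i x) i) (at (chart M i p))) (at (chart M i p))"
  using p by (intro smooth_on_has_derivative[OF vector_field_smooth[OF X]]) (auto simp: charts_at_def)

text \<open>The second derivatives of the transition maps cancel in the bracket by symmetry.\<close>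

lemma lie_bracket_tangent:
  assumes X: "vector_field M A X" and Y: "vector_field M A Y" and p: "p \<in> A"
  shows "lie_bracket M X Y p \<in> tangent_space M p"
proof -
  have "lie_bracket M X Y p j = frechet_derivative (transition M i j) (at (chart M i p)) (lie_bracket M X Y p i)"
    if ij: "i \<in> charts_at M p" "j \<in> charts_at M p" for i j
  proof -
    let ?\<tau> = "transition M i j" and ?x = "chart M i p"
    have i: "i \<in> index M" "p \<in> cdom M i" and j: "j \<in> index M" "p \<in> cdom M j"
      using ij by (auto simp: charts_at_def)
    let ?O = "chart M i ` (cdom M i \<inter> cdom M j)"
    have O: "open ?O" "?x \<in> ?O" "smooth_on ?O ?\<tau>" using open_overlap smooth_transition i j by auto
    \<comment> \<open>Obtained by differentiating the transformation law of the components of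
      \<open>Z\<close> in the chart \<open>i\<close>: the chain rule on the left, the product rule
      on the right.\<close>
    have key: "frechet_derivative (\<lambda>x. Z (param M j x) j) (at (chart M j p)) (frechet_derivative ?\<tau> (at ?x) v) =
       frechet_derivative (\<lambda>z. frechet_derivative ?\<tau> (at z) (Z p i)) (at ?x) v +
       frechet_derivative ?\<tau> (at ?x) (frechet_derivative (\<lambda>x. Z (param M i x) i) (at ?x) v)"
      if Z: "vector_field M A Z" for Z v
    proof -
      let ?B = "chart M i ` (A \<inter> cdom M i) \<inter> chart M i ` (cdom M i \<inter> cdom M j)"
      have B: "open ?B" "?x \<in> ?B"
        using openin_mtop_chart[OF vector_field_openin[OF Z] i(1)] O i j p by (auto intro!: open_Int)
      have eq: "Z (param M j (?\<tau> x)) j = frechet_derivative ?\<tau> (at x) (Z (param M i x) i)" if x: "x \<in> ?B" for x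
      proof -
        obtain q where q: "q \<in> cdom M i" "q \<in> cdom M j" "x = chart M i q" "q \<in> A"
          using x inj_chart[OF i(1)] by (auto simp: inj_on_def)
        then show ?thesis using i j tangent_transition[OF vector_field_tangent[OF Z q(4)], of i j]
          by (auto simp: transition_chart charts_at_def)
      qed
      have 1: "((\<lambda>x. Z (param M j x) j) has_derivative frechet_derivative (\<lambda>x. Z (param M j x) j) (at (chart M j p)))
          (at (?\<tau> ?x))"
        using vector_field_component_derivative[OF Z p ij(2)] i by (simp add: transition_chart)
      have 2: "((\<lambda>x. frechet_derivative ?\<tau> (at x) (Z (param M i x) i)) has_derivative
         (\<lambda>v. frechet_derivative (\<lambda>z. frechet_derivative ?\<tau> (at z) (Z (param M i ?x) i)) (at ?x) v +
         frechet_derivative ?\<tau> (at ?x) (frechet_derivative (\<lambda>x. Z (param M i x) i) (at ?x) v))) (at ?x)"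
        using frechet_derivative_frechet_compose[OF O(1,3,2) has_derivative_ident vector_field_component_derivative[OF Z p ij(1)]] .
      have "((\<lambda>x. Z (param M j (?\<tau> x)) j) has_derivative
         (\<lambda>v. frechet_derivative (\<lambda>z. frechet_derivative ?\<tau> (at z) (Z (param M i ?x) i)) (at ?x) v +
         frechet_derivative ?\<tau> (at ?x) (frechet_derivative (\<lambda>x. Z (param M i x) i) (at ?x) v))) (at ?x)"
        using 2 by (subst has_derivative_cong_open[OF B eq])
      from fun_cong[OF has_derivative_unique[OF has_derivative_compose[OF transition_derivative[OF ij] 1] this], of v]
      show ?thesis using i by simp
    qed
    have X': "X p j = frechet_derivative ?\<tau> (at ?x) (X p i)" "Y p j = frechet_derivative ?\<tau> (at ?x) (Y p i)"
      using tangent_transition[OF vector_field_tangent[OF X p] ij] tangent_transition[OF vector_field_tangent[OF Y p] ij]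
      by auto
    show ?thesis
      using ij frechet_derivative_swap[OF O(1,2,3), of "X p i" "Y p i"]
      by (simp add: lie_bracket_def X' key[OF X] key[OF Y] linear_diff[OF transition_linear[OF ij]])
  qed
  moreover have "lie_bracket M X Y p i = 0" if "i \<notin> charts_at M p" for i
    using that by (simp add: lie_bracket_def)
  ultimately show ?thesis unfolding tangent_space_def by blast
qed

end

section \<open>The slit tangent bundle\<close>

definition over :: "('p, 'i, 'e::euclidean_space) atlas \<Rightarrow> 'p set \<Rightarrow> ('p, 'i, 'e) tpoint set"
  where "over M B = {w \<in> points (slit M). fst w \<in> B}"

lemma points_slit: "w \<in> points (slit M) \<longleftrightarrow> fst w \<in> points M \<and> snd w \<in> tangent_space M (fst w) \<and> snd w \<noteq> 0"
  by (auto simp: slit_def)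

lemma index_slit [simp]: "index (slit M) = index M"
  by (simp add: slit_def)

lemma cdom_slit: "w \<in> cdom (slit M) i \<longleftrightarrow> fst w \<in> cdom M i \<and> snd w \<in> tangent_space M (fst w) \<and> snd w \<noteq> 0"
  by (auto simp: slit_def)

lemma chart_slit: "chart (slit M) i w = (chart M i (fst w), snd w i)"
  by (simp add: slit_def case_prod_unfold)

lemma fst_chart_slit: "fst (chart (slit M) i w) = chart M i (fst w)"
  and snd_chart_slit: "snd (chart (slit M) i w) = snd w i"
  by (simp_all add: chart_slit)

lemma charts_at_slit: "w \<in> points (slit M) \<Longrightarrow> charts_at (slit M) w = charts_at M (fst w)"
  by (auto simp: charts_at_def cdom_slit points_slit)

lemma chart_at_slit: "w \<in> points (slit M) \<Longrightarrow> chart_at (slit M) w = chart_at M (fst w)"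
  by (simp add: chart_at_def charts_at_slit)

lemma over_points: "w \<in> over M B \<Longrightarrow> w \<in> points (slit M)"
  by (simp add: over_def)

context
  fixes M :: "('p, 'i, 'e::euclidean_space) atlas"
  assumes M: "smooth_atlas M"
begin

lemma cdom_slit_over: "i \<in> index M \<Longrightarrow> cdom (slit M) i = over M (cdom M i)"
  using subsetD[OF cdom_points[OF M]] by (auto simp: over_def points_slit cdom_slit)

lemma tangent_component_nonzero:
  "u \<in> tangent_space M p \<Longrightarrow> u \<noteq> 0 \<Longrightarrow> i \<in> charts_at M p \<Longrightarrow> u i \<noteq> 0"
  using tangent_eqI[OF M _ tangent_0[OF M]] by (metis zero_fun_apply)

text \<open>A nonzero tangent vector has a nonzero component in every chart around its base point,
  so each fibre is mapped onto the punctured model space. Openness in \<open>slit M\<close> thereby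
  reduces to openness in \<open>M\<close>.\<close>

lemma slit_image:
  assumes i: "i \<in> index M"
  shows "chart (slit M) i ` (over M B \<inter> cdom (slit M) i) = chart M i ` (B \<inter> cdom M i) \<times> {y. y \<noteq> 0}"
proof (intro subset_antisym subsetI)
  fix z assume "z \<in> chart (slit M) i ` (over M B \<inter> cdom (slit M) i)"
  then show "z \<in> chart M i ` (B \<inter> cdom M i) \<times> {y. y \<noteq> 0}"
    using i tangent_component_nonzero[of _ _ i] by (auto simp: over_def chart_slit cdom_slit charts_at_def)
next
  fix z :: "'e \<times> 'e" assume "z \<in> chart M i ` (B \<inter> cdom M i) \<times> {y. y \<noteq> 0}"
  then obtain p y where z: "z = (chart M i p, y)" and p: "p \<in> B" "p \<in> cdom M i" and y: "y \<noteq> 0" by auto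
  have ip: "i \<in> charts_at M p" using p i by (simp add: charts_at_def)
  have "coord_vec M i p y \<noteq> 0" using coord_vec_same[OF M ip, of y] y by (metis zero_fun_apply)
  then have "(p, coord_vec M i p y) \<in> over M B \<inter> cdom (slit M) i"
    using p cdom_points[OF M i] coord_vec_tangent[OF M ip] by (auto simp: over_def points_slit cdom_slit)
  moreover have "chart (slit M) i (p, coord_vec M i p y) = (chart M i p, y)"
    using coord_vec_same[OF M ip] by (simp add: chart_slit)
  ultimately show "z \<in> chart (slit M) i ` (over M B \<inter> cdom (slit M) i)"
    unfolding z by (metis image_eqI)
qed

lemma slit_image_cdom: "i \<in> index M \<Longrightarrow> chart (slit M) i ` cdom (slit M) i = chart M i ` cdom M i \<times> {y. y \<noteq> 0}"
  using slit_image[of i "cdom M i"] cdom_slit_over[of i] by simp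

lemma inj_chart_slit: "i \<in> index M \<Longrightarrow> inj_on (chart (slit M) i) (cdom (slit M) i)"
  unfolding inj_on_def using inj_chart[OF M] tangent_eqI[OF M]
  by (auto simp: chart_slit cdom_slit charts_at_def inj_on_def) metis

lemma param_slit:
  assumes i: "i \<in> index M" and p: "p \<in> cdom M i" and y: "y \<noteq> 0"
  shows "param (slit M) i (chart M i p, y) = (p, coord_vec M i p y)"
proof -
  have ip: "i \<in> charts_at M p" using p i by (simp add: charts_at_def)
  have "coord_vec M i p y \<noteq> 0" using coord_vec_same[OF M ip, of y] y by (metis zero_fun_apply)
  then have "(p, coord_vec M i p y) \<in> cdom (slit M) i"
    using p coord_vec_tangent[OF M ip] by (auto simp: cdom_slit)
  moreover have "chart (slit M) i (p, coord_vec M i p y) = (chart M i p, y)"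
    using coord_vec_same[OF M ip] by (simp add: chart_slit)
  ultimately show ?thesis unfolding param_def using inv_into_f_f[OF inj_chart_slit[OF i]] by metis
qed

lemma transition_slit:
  assumes i: "i \<in> index M" "j \<in> index M" and p: "p \<in> cdom M i" "p \<in> cdom M j" and y: "y \<noteq> 0"
  shows "transition (slit M) i j (chart M i p, y) =
    (transition M i j (chart M i p), frechet_derivative (transition M i j) (at (chart M i p)) y)"
  using assms by (simp add: transition_def param_slit param_chart[OF M] chart_slit)
    (simp add: coord_vec_def charts_at_def transition_def)

lemma open_slit_image: "open A \<Longrightarrow> open (A \<times> {y::'e. y \<noteq> 0})"
  by (intro open_Times open_Collect_neq continuous_intros)

lemma slit_overlap:
  assumes "i \<in> index M" "j \<in> index M"
  shows "chart (slit M) i ` (cdom (slit M) i \<inter> cdom (slit M) j) = chart M i ` (cdom M i \<inter> cdom M j) \<times> {y. y \<noteq> 0}"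
  using slit_image[of i "cdom M j"] cdom_slit_over assms by (simp add: Int_commute)

lemma smooth_transition_slit:
  assumes i: "i \<in> index M" "j \<in> index M"
  shows "smooth_on (chart M i ` (cdom M i \<inter> cdom M j) \<times> {y. y \<noteq> 0}) (transition (slit M) i j)"
proof -
  let ?O = "chart M i ` (cdom M i \<inter> cdom M j)"
  have O: "open ?O" "open (?O \<times> {y::'e. y \<noteq> 0})" using open_overlap[OF M i] open_slit_image by auto
  have s: "smooth_on (?O \<times> {y::'e. y \<noteq> 0}) fst" "smooth_on (?O \<times> {y::'e. y \<noteq> 0}) snd"
    using O(2) bounded_linear_fst bounded_linear_snd smooth_on_linear_map by blast+
  have "smooth_on (?O \<times> {y. y \<noteq> 0}) (\<lambda>z. (transition M i j (fst z), frechet_derivative (transition M i j) (at (fst z)) (snd z)))"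
    by (intro smooth_on_Pair O(2) smooth_on_compose[OF O(2,1) _ s(1) smooth_transition[OF M i]]
        smooth_on_frechet_compose[OF O(2,1) _ s smooth_transition[OF M i]]) auto
  then show ?thesis using i by (subst smooth_on_cong[OF O(2)]) (auto simp: transition_slit)
qed

lemma slit_atlas: "smooth_atlas (slit M)"
  unfolding smooth_atlas_def
proof (intro conjI ballI)
  fix i assume i: "i \<in> index (slit M)"
  then show "cdom (slit M) i \<subseteq> points (slit M)" using subsetD[OF cdom_points[OF M]] by (auto simp: cdom_slit points_slit)
  show "inj_on (chart (slit M) i) (cdom (slit M) i)" using i inj_chart_slit by simp
  show "open (chart (slit M) i ` cdom (slit M) i)"
    using i open_chart_dom[OF M] by (auto simp: slit_image_cdom open_slit_image)
  fix j assume j: "j \<in> index (slit M)"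
  then show "open (chart (slit M) i ` (cdom (slit M) i \<inter> cdom (slit M) j))"
    using i open_overlap[OF M] by (simp add: slit_overlap open_slit_image)
  show "smooth_on (chart (slit M) i ` (cdom (slit M) i \<inter> cdom (slit M) j)) (transition (slit M) i j)"
    using i j smooth_transition_slit by (simp add: slit_overlap)
next
  have "\<exists>i\<in>index M. w \<in> cdom (slit M) i" if "w \<in> points (slit M)" for w
    using chart_at_in[OF M, of "fst w"] that by (auto simp: points_slit cdom_slit charts_at_def)
  then show "(\<Union>i\<in>index (slit M). cdom (slit M) i) = points (slit M)"
    using subsetD[OF cdom_points[OF M]] by (auto simp: cdom_slit points_slit)
qed

lemma openin_over: "openin (mtop M) B \<Longrightarrow> openin (mtop (slit M)) (over M B)"
  by (auto simp: openin_mtop[OF slit_atlas] openin_mtop[OF M] slit_image open_slit_image over_points)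

lemma over_cdom: "i \<in> index M \<Longrightarrow> B \<subseteq> cdom M i \<Longrightarrow> over M B \<subseteq> cdom (slit M) i"
  by (auto simp: cdom_slit_over over_def)

section \<open>The projection, vertical vectors and the vertical endomorphism\<close>

lemma transition_slit_derivative:
  assumes w: "w \<in> points (slit M)" and ij: "i \<in> charts_at M (fst w)" "j \<in> charts_at M (fst w)"
  shows "fst (frechet_derivative (transition (slit M) i j) (at (chart (slit M) i w)) \<zeta>) =
      frechet_derivative (transition M i j) (at (chart M i (fst w))) (fst \<zeta>)"
    and "frechet_derivative (transition (slit M) i j) (at (chart (slit M) i w)) (0, b) =
      (0, frechet_derivative (transition M i j) (at (chart M i (fst w))) b)"
proof -
  let ?\<tau> = "transition M i j" and ?x = "chart M i (fst w)" and ?y = "snd w i"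
  have i: "i \<in> index M" "j \<in> index M" "fst w \<in> cdom M i" "fst w \<in> cdom M j"
    using ij by (auto simp: charts_at_def)
  let ?O = "chart M i ` (cdom M i \<inter> cdom M j)"
  have O: "open ?O" "?x \<in> ?O" "smooth_on ?O ?\<tau>" using open_overlap[OF M] smooth_transition[OF M] i by auto
  have y: "?y \<noteq> 0" using w ij tangent_component_nonzero by (auto simp: points_slit)
  have "((\<lambda>z. frechet_derivative ?\<tau> (at (fst z)) (snd z)) has_derivative
      (\<lambda>v. frechet_derivative (\<lambda>z. frechet_derivative ?\<tau> (at z) (snd (?x, ?y))) (at (fst (?x, ?y))) (fst v)
        + frechet_derivative ?\<tau> (at (fst (?x, ?y))) (snd v))) (at (?x, ?y))"
    using O by (intro frechet_derivative_frechet_compose[OF O(1,3)]) (auto intro!: derivative_eq_intros)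
  moreover have "((\<lambda>z. ?\<tau> (fst z)) has_derivative (\<lambda>v. frechet_derivative ?\<tau> (at ?x) (fst v))) (at (?x, ?y))"
    using smooth_on_has_derivative[OF O(3,2)]
    by (intro has_derivative_compose[of fst _ _ _ ?\<tau>]) (auto intro!: derivative_eq_intros)
  ultimately have "((\<lambda>z. (?\<tau> (fst z), frechet_derivative ?\<tau> (at (fst z)) (snd z))) has_derivative
     (\<lambda>v. (frechet_derivative ?\<tau> (at ?x) (fst v), frechet_derivative (\<lambda>z. frechet_derivative ?\<tau> (at z) ?y) (at ?x) (fst v)
        + frechet_derivative ?\<tau> (at ?x) (snd v)))) (at (?x, ?y))"
    by (intro has_derivative_Pair) auto
  \<comment> \<open>The derivative is block triangular. The base part of the image depends on the
    base part only, and a vertical vector is transformed like a tangent vector of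
    \<open>M\<close>.\<close>
  then have "(transition (slit M) i j has_derivative
     (\<lambda>v. (frechet_derivative ?\<tau> (at ?x) (fst v), frechet_derivative (\<lambda>z. frechet_derivative ?\<tau> (at z) ?y) (at ?x) (fst v)
        + frechet_derivative ?\<tau> (at ?x) (snd v)))) (at (?x, ?y))"
    using y O(2) i by (subst has_derivative_cong_open[OF open_slit_image[OF O(1)]]) (auto simp: transition_slit)
  note * = frechet_derivativeI[OF this]
  note lin = smooth_on_linear[OF O(3,2)] smooth_on_linear[OF smooth_on_derivative[OF O(3)] O(2)]
  show "fst (frechet_derivative (transition (slit M) i j) (at (chart (slit M) i w)) \<zeta>) =
      frechet_derivative ?\<tau> (at ?x) (fst \<zeta>)"
    by (simp add: chart_slit *)
  show "frechet_derivative (transition (slit M) i j) (at (chart (slit M) i w)) (0, b) =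
      (0, frechet_derivative ?\<tau> (at ?x) b)"
    using lin by (simp add: chart_slit * linear_0)
qed

text \<open>In slit charts the projection is \<open>fst\<close> followed by a transition map of
  \<open>M\<close>. Tangency of \<open>\<xi>\<close> makes the outcome agree in all charts, although
  \<open>tangent_map\<close> computes from the single chart \<open>chart_at\<close>.\<close>

lemma dproj_eq:
  assumes w: "w \<in> points (slit M)" and \<xi>: "\<xi> \<in> tangent_space (slit M) w"
  shows "dproj M w \<xi> = (\<lambda>j. fst (\<xi> j))"
proof
  fix j
  define i where "i = chart_at M (fst w)"
  have i: "i \<in> charts_at M (fst w)" "chart_at (slit M) w = i"
    using w chart_at_in[OF M] by (auto simp: i_def points_slit chart_at_slit)
  show "dproj M w \<xi> j = fst (\<xi> j)"
  proof (cases "j \<in> charts_at M (fst w)")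
    case False
    then show ?thesis using \<xi> w tangent_outside[OF slit_atlas \<xi>, of j]
      by (simp add: dproj_def tangent_map_def Let_def charts_at_slit)
  next
    case True
    have ii: "i \<in> index M" "fst w \<in> cdom M i" "j \<in> index M" "fst w \<in> cdom M j"
      using i True by (auto simp: charts_at_def)
    let ?O = "chart M i ` (cdom M i \<inter> cdom M j)"
    have O: "open ?O" "chart M i (fst w) \<in> ?O" "smooth_on ?O (transition M i j)"
      using open_overlap[OF M] smooth_transition[OF M] ii by auto
    have y: "snd w i \<noteq> 0" using w i tangent_component_nonzero by (auto simp: points_slit)
    have "((\<lambda>z. transition M i j (fst z)) has_derivative
        (\<lambda>v. frechet_derivative (transition M i j) (at (chart M i (fst w))) (fst v))) (at (chart M i (fst w), snd w i))"
      using smooth_on_has_derivative[OF O(3,2)]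
      by (intro has_derivative_compose[of fst _ _ _ "transition M i j"]) (auto intro!: derivative_eq_intros)
    then have "(chart M j \<circ> fst \<circ> param (slit M) i has_derivative
        (\<lambda>v. frechet_derivative (transition M i j) (at (chart M i (fst w))) (fst v))) (at (chart M i (fst w), snd w i))"
      using y O(2) ii by (subst has_derivative_cong_open[OF open_slit_image[OF O(1)], where g = "\<lambda>z. transition M i j (fst z)"])
        (auto simp: param_slit transition_chart[OF M])
    from frechet_derivativeI[OF this]
    have "dproj M w \<xi> j = frechet_derivative (transition M i j) (at (chart M i (fst w))) (fst (\<xi> i))"
      using True i by (simp add: dproj_def tangent_map_def Let_def chart_slit)
    also have "\<dots> = fst (\<xi> j)"
      using tangent_transition[OF slit_atlas \<xi>, of i j] transition_slit_derivative(1)[OF w i(1) True] True i w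
      by (simp add: charts_at_slit)
    finally show ?thesis .
  qed
qed

lemma tangent_fst:
  assumes w: "w \<in> points (slit M)" and \<xi>: "\<xi> \<in> tangent_space (slit M) w"
  shows "(\<lambda>j. fst (\<xi> j)) \<in> tangent_space M (fst w)"
proof -
  have "fst (\<xi> j) = frechet_derivative (transition M i j) (at (chart M i (fst w))) (fst (\<xi> i))"
    if "i \<in> charts_at M (fst w)" "j \<in> charts_at M (fst w)" for i j
    using tangent_transition[OF slit_atlas \<xi>, of i j] transition_slit_derivative(1)[OF w that] that w
    by (simp add: charts_at_slit)
  moreover have "fst (\<xi> i) = 0" if "i \<notin> charts_at M (fst w)" for i
    using tangent_outside[OF slit_atlas \<xi>, of i] that w by (simp add: charts_at_slit)
  ultimately show ?thesis unfolding tangent_space_def by blast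
qed

lemma vertical_vector:
  assumes w: "w \<in> points (slit M)" and u: "u \<in> tangent_space M (fst w)"
  shows "(\<lambda>j. (0, u j)) \<in> tangent_space (slit M) w"
proof -
  have "(0, u j) = frechet_derivative (transition (slit M) i j) (at (chart (slit M) i w)) (0, u i)"
    if "i \<in> charts_at M (fst w)" "j \<in> charts_at M (fst w)" for i j
    unfolding transition_slit_derivative(2)[OF w that] using tangent_transition[OF M u that] by simp
  moreover have "(0, u i) = 0" if "i \<notin> charts_at M (fst w)" for i
    using tangent_outside[OF M u that] by (simp add: zero_prod_def)
  ultimately show ?thesis unfolding tangent_space_def charts_at_slit[OF w] by blast
qed

lemma vertical_iff:
  assumes w: "w \<in> points (slit M)"
  shows "\<xi> \<in> vertical M w \<longleftrightarrow> \<xi> \<in> tangent_space (slit M) w \<and> (\<forall>j. fst (\<xi> j) = 0)"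
  using dproj_eq[OF w] by (auto simp: vertical_def fun_eq_iff)

lemma vertical_iff_chart:
  assumes w: "w \<in> points (slit M)" and i: "i \<in> charts_at M (fst w)"
  shows "\<xi> \<in> vertical M w \<longleftrightarrow> \<xi> \<in> tangent_space (slit M) w \<and> fst (\<xi> i) = 0"
  using vertical_iff[OF w] tangent_eqI[OF M tangent_fst[OF w] tangent_0[OF M] i]
  by (auto simp: fun_eq_iff)

lemma imap_eq:
  assumes w: "w \<in> points (slit M)" and u: "u \<in> tangent_space M (fst w)"
  shows "imap M w u = (\<lambda>j. (0, u j))"
proof
  fix j
  have "((\<lambda>t. (chart M j (fst w), snd w j + t *\<^sub>R u j)) has_vector_derivative (0, u j)) (at 0)"
    by (auto intro!: derivative_eq_intros has_vector_derivative_Pair)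
  then have "vector_derivative (chart (slit M) j \<circ> (\<lambda>t. (fst w, snd w + t *\<^sub>R u))) (at 0) = (0, u j)"
    by (intro vector_derivative_at) (simp add: o_def chart_slit scaleR_fun_def)
  then show "imap M w u j = (0, u j)"
    using tangent_outside[OF M u, of j] charts_at_slit[OF w]
    by (auto simp: imap_def velocity_def zero_prod_def scaleR_fun_def zero_fun_def[symmetric])
qed

lemma imap_vertical:
  "w \<in> points (slit M) \<Longrightarrow> u \<in> tangent_space M (fst w) \<Longrightarrow> imap M w u \<in> vertical M w"
  by (simp add: vertical_iff imap_eq vertical_vector)

lemma imap_inv_imap:
  assumes w: "w \<in> points (slit M)" and u: "u \<in> tangent_space M (fst w)"
  shows "imap_inv M w (imap M w u) = u"
proof -
  have "inj_on (imap M w) (tangent_space M (fst w))"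
    using imap_eq[OF w] by (auto simp: inj_on_def fun_eq_iff)
  then show ?thesis using u by (simp add: imap_inv_def)
qed

lemma vertical_imap:
  assumes w: "w \<in> points (slit M)" and \<xi>: "\<xi> \<in> vertical M w"
  obtains u where "u \<in> tangent_space M (fst w)" "\<xi> = imap M w u"
proof -
  define i where "i = chart_at M (fst w)"
  have i: "i \<in> charts_at M (fst w)" using w chart_at_in[OF M] by (auto simp: i_def points_slit)
  define u where "u = coord_vec M i (fst w) (snd (\<xi> i))"
  have u: "u \<in> tangent_space M (fst w)" using coord_vec_tangent[OF M i] by (simp add: u_def)
  have "\<xi> i = (\<lambda>j. (0, u j)) i"
    using \<xi> vertical_iff[OF w] coord_vec_same[OF M i] by (simp add: u_def prod_eq_iff)
  then have "\<xi> = imap M w u"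
    using tangent_eqI[OF slit_atlas _ vertical_vector[OF w u], of \<xi> i] \<xi> i w
    by (simp add: imap_eq[OF w u] charts_at_slit vertical_iff)
  then show thesis using that u by blast
qed

lemma imap_inv_vertical:
  assumes "w \<in> points (slit M)" and "\<xi> \<in> vertical M w"
  shows "imap_inv M w \<xi> \<in> tangent_space M (fst w)" "imap M w (imap_inv M w \<xi>) = \<xi>"
  using assms vertical_imap by (metis imap_inv_imap)+

lemma imap_inv_component:
  assumes "w \<in> points (slit M)" and "\<xi> \<in> vertical M w"
  shows "imap_inv M w \<xi> i = snd (\<xi> i)"
  using imap_inv_vertical[OF assms] imap_eq[OF assms(1)] by (metis snd_conv)

lemma imap_inv_add:
  assumes "w \<in> points (slit M)" "\<xi> \<in> vertical M w" "\<eta> \<in> vertical M w"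
  shows "imap_inv M w (\<xi> + \<eta>) = imap_inv M w \<xi> + imap_inv M w \<eta>"
proof -
  have "\<xi> + \<eta> \<in> vertical M w" using assms by (auto simp: vertical_iff tangent_add[OF slit_atlas])
  then show ?thesis using assms by (intro ext) (simp add: imap_inv_component)
qed

lemma imap_inv_diff:
  assumes "w \<in> points (slit M)" "\<xi> \<in> vertical M w" "\<eta> \<in> vertical M w"
  shows "imap_inv M w (\<xi> - \<eta>) = imap_inv M w \<xi> - imap_inv M w \<eta>"
proof -
  have "\<xi> - \<eta> \<in> vertical M w" using assms by (auto simp: vertical_iff tangent_diff[OF slit_atlas])
  then show ?thesis using assms by (intro ext) (simp add: imap_inv_component)
qed

lemma vert_endo_eq:
  assumes "w \<in> points (slit M)" "\<xi> \<in> tangent_space (slit M) w"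
  shows "vert_endo M w \<xi> = (\<lambda>j. (0, fst (\<xi> j)))"
  unfolding vert_endo_def dproj_eq[OF assms] using imap_eq[OF assms(1) tangent_fst[OF assms]] .

lemma vert_endo_imap:
  assumes "w \<in> points (slit M)" "\<xi> \<in> tangent_space (slit M) w"
  shows "vert_endo M w \<xi> = imap M w (\<lambda>j. fst (\<xi> j))"
  unfolding vert_endo_def dproj_eq[OF assms] ..

lemma vert_endo_vertical:
  "w \<in> points (slit M) \<Longrightarrow> \<xi> \<in> tangent_space (slit M) w \<Longrightarrow> vert_endo M w \<xi> \<in> vertical M w"
  by (simp add: vert_endo_imap imap_vertical tangent_fst)

section \<open>Smooth sections of the vertical bundle\<close>

lemma slit_field_points: "vector_field (slit M) A X \<Longrightarrow> w \<in> A \<Longrightarrow> w \<in> points (slit M)"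
  using openin_mtop[OF slit_atlas] by (auto simp: vector_field_def)

lemma smooth_on_slit_chart:
  assumes A: "openin (mtop (slit M)) A" and i: "i \<in> index M"
  shows "open (chart (slit M) i ` (A \<inter> cdom (slit M) i))"
    "smooth_on (chart (slit M) i ` (A \<inter> cdom (slit M) i)) fst"
    "smooth_on (chart (slit M) i ` (A \<inter> cdom (slit M) i)) snd"
proof -
  show o: "open (chart (slit M) i ` (A \<inter> cdom (slit M) i))"
    using A i openin_mtop[OF slit_atlas] by auto
  show "smooth_on (chart (slit M) i ` (A \<inter> cdom (slit M) i)) fst"
    "smooth_on (chart (slit M) i ` (A \<inter> cdom (slit M) i)) snd"
    using o bounded_linear_fst bounded_linear_snd smooth_on_linear_map by blast+
qed

lemma vertical_section_vert_endo:
  assumes X: "vector_field (slit M) A X"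
  shows "vertical_section M A (\<lambda>z. vert_endo M z (X z))"
  unfolding vertical_section_def vector_field_def
proof (intro conjI ballI)
  show A: "openin (mtop (slit M)) A" using X by (simp add: vector_field_def)
  fix w assume w: "w \<in> A"
  show v: "vert_endo M w (X w) \<in> vertical M w"
    using w X by (intro vert_endo_vertical slit_field_points vector_field_tangent[OF slit_atlas]) auto
  then show "vert_endo M w (X w) \<in> tangent_space (slit M) w" by (simp add: vertical_def)
next
  fix i assume i: "i \<in> index (slit M)"
  let ?B = "chart (slit M) i ` (A \<inter> cdom (slit M) i)"
  have A: "openin (mtop (slit M)) A" using X by (simp add: vector_field_def)
  have o: "open ?B" using smooth_on_slit_chart[OF A] i by simp
  have "smooth_on ?B (\<lambda>x. (0, fst (X (param (slit M) i x) i)))"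
    using X i by (intro smooth_on_Pair smooth_on_const smooth_on_fst o) (auto simp: vector_field_def)
  then show "smooth_on ?B (\<lambda>x. vert_endo M (param (slit M) i x) (X (param (slit M) i x)) i)"
  proof (subst smooth_on_cong[OF o])
    fix z assume "z \<in> ?B"
    then obtain w where w: "w \<in> A" "z = chart (slit M) i w" "w \<in> cdom (slit M) i" by auto
    then show "vert_endo M (param (slit M) i z) (X (param (slit M) i z)) i = (0, fst (X (param (slit M) i z) i))"
      using i slit_field_points[OF X] vector_field_tangent[OF slit_atlas X]
      by (simp add: param_chart[OF slit_atlas] vert_endo_eq)
  qed
qed

lemma vert_lift_eq:
  "w \<in> points (slit M) \<Longrightarrow> V (fst w) \<in> tangent_space M (fst w) \<Longrightarrow> vert_lift M V w = (\<lambda>j. (0, V (fst w) j))"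
  unfolding vert_lift_def by (rule imap_eq)

lemma vertical_section_vert_lift:
  assumes V: "vector_field M B V"
  shows "vertical_section M (over M B) (vert_lift M V)"
  unfolding vertical_section_def vector_field_def
proof (intro conjI ballI)
  show A: "openin (mtop (slit M)) (over M B)" using V openin_over by (auto simp: vector_field_def)
  fix w assume w: "w \<in> over M B"
  show v: "vert_lift M V w \<in> vertical M w"
    unfolding vert_lift_def using w V by (intro imap_vertical) (auto simp: over_def vector_field_def)
  then show "vert_lift M V w \<in> tangent_space (slit M) w" by (simp add: vertical_def)
next
  fix i assume "i \<in> index (slit M)"
  then have i: "i \<in> index M" by simp
  let ?B = "chart (slit M) i ` (over M B \<inter> cdom (slit M) i)"
  have A: "openin (mtop (slit M)) (over M B)" using V openin_over by (auto simp: vector_field_def)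
  note s = smooth_on_slit_chart[OF A i]
  have B: "open (chart M i ` (B \<inter> cdom M i))" using V i openin_mtop[OF M] by (auto simp: vector_field_def)
  have "smooth_on ?B (\<lambda>x. (0, V (param M i (fst x)) i))"
    using i by (intro smooth_on_Pair smooth_on_const s(1) smooth_on_compose[OF s(1) B _ s(2) vector_field_smooth[OF M V i]])
      (auto simp: slit_image)
  then show "smooth_on ?B (\<lambda>x. vert_lift M V (param (slit M) i x) i)"
  proof (subst smooth_on_cong[OF s(1)])
    fix z assume "z \<in> ?B"
    then obtain w where w: "w \<in> over M B" "z = chart (slit M) i w" "w \<in> cdom (slit M) i" by auto
    then show "vert_lift M V (param (slit M) i z) i = (0, V (param M i (fst z)) i)"
      using i V by (simp add: param_chart[OF slit_atlas] vert_lift_eq over_def vector_field_def fst_chart_slit cdom_slit param_chart[OF M])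
  qed
qed

lemma canonical_field_eq: "w \<in> points (slit M) \<Longrightarrow> canonical_field M w = (\<lambda>j. (0, snd w j))"
  unfolding canonical_field_def by (rule imap_eq) (auto simp: points_slit)

lemma vertical_section_canonical: "vertical_section M (points (slit M)) (canonical_field M)"
  unfolding vertical_section_def vector_field_def
proof (intro conjI ballI)
  show A: "openin (mtop (slit M)) (points (slit M))" using openin_mtop_points[OF slit_atlas] .
  fix w assume w: "w \<in> points (slit M)"
  show v: "canonical_field M w \<in> vertical M w"
    unfolding canonical_field_def using w by (intro imap_vertical) (auto simp: points_slit)
  then show "canonical_field M w \<in> tangent_space (slit M) w" by (simp add: vertical_def)
next
  fix i assume "i \<in> index (slit M)"
  then have i: "i \<in> index M" by simp
  let ?B = "chart (slit M) i ` (points (slit M) \<inter> cdom (slit M) i)"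
  note s = smooth_on_slit_chart[OF openin_mtop_points[OF slit_atlas] i]
  have "smooth_on ?B (\<lambda>x. (0, snd x))" by (intro smooth_on_Pair smooth_on_const s)
  then show "smooth_on ?B (\<lambda>x. canonical_field M (param (slit M) i x) i)"
    using i by (subst smooth_on_cong[OF s(1)])
      (auto simp: param_chart[OF slit_atlas] canonical_field_eq snd_chart_slit)
qed

lemma vertical_section_subset:
  "vertical_section M A Y \<Longrightarrow> openin (mtop (slit M)) B \<Longrightarrow> B \<subseteq> A \<Longrightarrow> vertical_section M B Y"
  unfolding vertical_section_def using vector_field_subset[OF slit_atlas] by blast

end

section \<open>Vertical derivatives\<close>

text \<open>The derivative along the fibre, written as a function on the chart image so that it can
  be iterated. The fundamental and the Cartan tensor become second and third iterates applied to the
  square of the metric.\<close>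

definition vdiff :: "'e \<Rightarrow> ('e::euclidean_space \<times> 'e \<Rightarrow> real) \<Rightarrow> 'e \<times> 'e \<Rightarrow> real"
  where "vdiff c g = (\<lambda>z. frechet_derivative g (at z) (0, c))"

lemma smooth_on_vdiff: "smooth_on A g \<Longrightarrow> smooth_on A (vdiff c g)"
  unfolding vdiff_def by (rule smooth_on_derivative)

lemma vdiff_cong: "open A \<Longrightarrow> z \<in> A \<Longrightarrow> (\<And>x. x \<in> A \<Longrightarrow> f x = g x) \<Longrightarrow> vdiff c f z = vdiff c g z"
  unfolding vdiff_def using frechet_derivative_cong_open by metis

lemma vdiff_swap: "open A \<Longrightarrow> smooth_on A g \<Longrightarrow> z \<in> A \<Longrightarrow> vdiff a (vdiff b g) z = vdiff b (vdiff a g) z"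
  unfolding vdiff_def by (intro frechet_derivative_swap)

lemma linear_vdiff: "smooth_on A g \<Longrightarrow> z \<in> A \<Longrightarrow> linear (\<lambda>c. vdiff c g z)"
proof -
  assume "smooth_on A g" "z \<in> A"
  from linear_compose[OF _ smooth_on_linear[OF this], of "\<lambda>c. (0, c)"]
  show ?thesis unfolding vdiff_def o_def by (simp add: linear_iff)
qed

text \<open>Linearity in the inner direction, carried through the outer derivative. It is what
  allows the directions to depend on the point later on.\<close>

lemma vdiff_vdiff_sum:
  assumes A: "open A" "z \<in> A" and g: "smooth_on A g"
  shows "vdiff a (vdiff b g) z = (\<Sum>e\<in>Basis. (b \<bullet> e) * vdiff a (vdiff e g) z)"
proof -
  have eq: "vdiff b g x = (\<Sum>e\<in>Basis. (b \<bullet> e) * vdiff e g x)" if "x \<in> A" for x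
    using linear_sum_Basis[OF linear_vdiff[OF g that], of b] by simp
  have "((\<lambda>x. \<Sum>e\<in>Basis. (b \<bullet> e) * vdiff e g x) has_derivative
      (\<lambda>v. \<Sum>e\<in>Basis. (b \<bullet> e) * frechet_derivative (vdiff e g) (at z) v)) (at z)"
    by (intro has_derivative_sum has_derivative_mult_right
        smooth_on_has_derivative[OF smooth_on_vdiff[OF g] A(2)])
  then have "vdiff a (\<lambda>x. \<Sum>e\<in>Basis. (b \<bullet> e) * vdiff e g x) z =
      (\<Sum>e\<in>Basis. (b \<bullet> e) * vdiff a (vdiff e g) z)"
    unfolding vdiff_def[of a] by (simp add: frechet_derivativeI)
  then show ?thesis using vdiff_cong[OF A eq] by simp
qed

text \<open>The link between the iterated \<open>deriv\<close> in the definitions of the tensors and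
  Frechet derivatives. The agreement of \<open>h\<close> with \<open>g\<close> is asked for only
  while the line stays in \<open>A\<close>, because a line in a fibre may run through the zero
  vector.\<close>

lemma deriv_line:
  fixes g :: "'a::real_normed_vector \<Rightarrow> real"
  assumes A: "open A" "z \<in> A" and g: "g differentiable (at z)"
    and h: "\<And>t. z + t *\<^sub>R c \<in> A \<Longrightarrow> h t = g (z + t *\<^sub>R c)"
  shows "deriv h 0 = frechet_derivative g (at z) c"
proof -
  let ?U = "(\<lambda>t::real. z + t *\<^sub>R c) -` A"
  have U: "open ?U" "0 \<in> ?U" using A by (auto intro!: open_vimage continuous_intros)
  have "((\<lambda>t. z + t *\<^sub>R c) has_derivative (\<lambda>t. t *\<^sub>R c)) (at 0)" by (auto intro!: derivative_eq_intros)
  moreover have "(g has_derivative frechet_derivative g (at z)) (at (z + 0 *\<^sub>R c))"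
    using has_derivative_frechet[OF g] by simp
  ultimately have "((\<lambda>t. g (z + t *\<^sub>R c)) has_derivative (\<lambda>t. frechet_derivative g (at z) (t *\<^sub>R c))) (at 0)"
    by (rule has_derivative_compose)
  then have "(h has_derivative (\<lambda>t. t * frechet_derivative g (at z) c)) (at 0)"
    using h linear_scale[OF has_derivative_linear[OF has_derivative_frechet[OF g]]]
    by (subst has_derivative_cong_open[OF U]) auto
  then have "(h has_field_derivative frechet_derivative g (at z) c) (at 0)"
    by (simp add: has_field_derivative_def mult_commute_abs)
  then show ?thesis by (rule DERIV_imp_deriv)
qed

text \<open>A vertical derivative sees the values on one fibre only. Hence fields pulled back from
  the base may be frozen at the base point before differentiating.\<close>

lemma vdiff_cong_fiber:
  assumes A: "open A" "z \<in> A" and fg: "f differentiable (at z)" "g differentiable (at z)"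
    and eq: "\<And>y. (fst z, y) \<in> A \<Longrightarrow> f (fst z, y) = g (fst z, y)"
  shows "vdiff c f z = vdiff c g z"
proof -
  have "deriv (\<lambda>t. f (z + t *\<^sub>R (0, c))) 0 = vdiff c f z" unfolding vdiff_def
    by (rule deriv_line[OF A fg(1)]) simp
  moreover have "deriv (\<lambda>t. f (z + t *\<^sub>R (0, c))) 0 = vdiff c g z" unfolding vdiff_def
    by (rule deriv_line[OF A fg(2)]) (use eq in \<open>auto simp: plus_prod_def\<close>)
  ultimately show ?thesis by simp
qed

text \<open>Differentiate the homogeneity relation along \<open>(0, c)\<close>; the chain rule
  contributes the factor \<open>l\<close>. As \<open>l\<close> is fixed, \<open>k\<close> may be any
  power of it: \<open>l\<^sup>2\<close> for the square of the metric and \<open>l\<close> for its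
  first fibre derivatives.\<close>

lemma vdiff_homogeneous:
  assumes A: "open A" "\<And>x y. (x, y) \<in> A \<Longrightarrow> (x, l *\<^sub>R y) \<in> A" and g: "smooth_on A g"
    and hom: "\<And>x y. (x, y) \<in> A \<Longrightarrow> g (x, l *\<^sub>R y) = k * g (x, y)" and z: "(x, y) \<in> A"
  shows "l * vdiff c g (x, l *\<^sub>R y) = k * vdiff c g (x, y)"
proof -
  have "((\<lambda>z. (fst z, l *\<^sub>R snd z)) has_derivative (\<lambda>v. (fst v, l *\<^sub>R snd v))) (at (x, y))"
    by (auto intro!: derivative_eq_intros)
  moreover have "(g has_derivative frechet_derivative g (at (x, l *\<^sub>R y))) (at (fst (x, y), l *\<^sub>R snd (x, y)))"
    using smooth_on_has_derivative[OF g A(2)[OF z]] by simp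
  ultimately have 1: "((\<lambda>z. g (fst z, l *\<^sub>R snd z)) has_derivative
      (\<lambda>v. frechet_derivative g (at (x, l *\<^sub>R y)) (fst v, l *\<^sub>R snd v))) (at (x, y))"
    by (rule has_derivative_compose)
  have 2: "((\<lambda>z. k * g z) has_derivative (\<lambda>v. k * frechet_derivative g (at (x, y)) v)) (at (x, y))"
    by (intro has_derivative_mult_right smooth_on_has_derivative[OF g z])
  have "((\<lambda>z. g (fst z, l *\<^sub>R snd z)) has_derivative (\<lambda>v. k * frechet_derivative g (at (x, y)) v)) (at (x, y))"
    using hom 2 by (subst has_derivative_cong_open[OF A(1) z]) auto
  from fun_cong[OF has_derivative_unique[OF 1 this], of "(0, c)"]
  have "frechet_derivative g (at (x, l *\<^sub>R y)) (l *\<^sub>R (0, c)) = k * vdiff c g (x, y)"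
    by (simp add: vdiff_def scaleR_prod_def)
  then show ?thesis
    unfolding vdiff_def linear_scale[OF smooth_on_linear[OF g A(2)[OF z]]] by simp
qed

text \<open>Euler's relation, from differentiating in \<open>l\<close> at 1. It is applied with
  \<open>\<phi> l = l\<close> to first and with \<open>\<phi> l = 1\<close> to second fibre
  derivatives.\<close>

lemma vdiff_euler:
  assumes g: "smooth_on A g" and z: "(x, y) \<in> A"
    and hom: "\<And>l. 0 < l \<Longrightarrow> g (x, l *\<^sub>R y) = \<phi> l * g (x, y)" and \<phi>: "(\<phi> has_real_derivative d) (at 1)"
  shows "vdiff y g (x, y) = d * g (x, y)"
proof -
  have "((\<lambda>l::real. (x, l *\<^sub>R y)) has_derivative (\<lambda>l. l *\<^sub>R (0, y))) (at 1)"
    by (auto intro!: derivative_eq_intros)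
  moreover have "(g has_derivative frechet_derivative g (at (x, y))) (at (x, 1 *\<^sub>R y))"
    using smooth_on_has_derivative[OF g z] by simp
  ultimately have 1: "((\<lambda>l. g (x, l *\<^sub>R y)) has_derivative (\<lambda>l. frechet_derivative g (at (x, y)) (l *\<^sub>R (0, y)))) (at 1)"
    by (rule has_derivative_compose)
  have "((\<lambda>l. \<phi> l * g (x, y)) has_derivative (\<lambda>l. l * d * g (x, y))) (at 1)"
    using \<phi> unfolding has_field_derivative_def by (auto intro!: derivative_eq_intros simp: mult_ac)
  then have "((\<lambda>l. g (x, l *\<^sub>R y)) has_derivative (\<lambda>l. l * d * g (x, y))) (at 1)"
    using hom by (subst has_derivative_cong_open[of "{0<..}"]) auto
  from fun_cong[OF has_derivative_unique[OF 1 this], of 1] show ?thesis by (simp add: vdiff_def)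
qed


section \<open>The fundamental and the Cartan tensor in coordinates\<close>

text \<open>The full square of \<open>F\<close>, without the customary factor 1/2. This matches the
  factors 1/2 and 1/4 in the definitions of \<open>fund_tensor\<close> and
  \<open>cartan_tensor\<close>.\<close>

definition energy :: "('p, 'i, 'e::euclidean_space) atlas \<Rightarrow> (('p, 'i, 'e) tpoint \<Rightarrow> real) \<Rightarrow> 'i \<Rightarrow> 'e \<times> 'e \<Rightarrow> real"
  where "energy M F i z = (F (param (slit M) i z))\<^sup>2"

definition slit_dom :: "('p, 'i, 'e::euclidean_space) atlas \<Rightarrow> 'i \<Rightarrow> ('e \<times> 'e) set"
  where "slit_dom M i = chart M i ` cdom M i \<times> {y. y \<noteq> 0}"

context
  fixes M :: "('p, 'i, 'e::euclidean_space) atlas" and F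
  assumes M: "smooth_atlas M" and F: "finsler_metric M F"
begin

section \<open>Homogeneity of the square of the metric\<close>

lemma open_slit_dom: "i \<in> index M \<Longrightarrow> open (slit_dom M i)"
  unfolding slit_dom_def by (intro open_slit_image[OF M] open_chart_dom[OF M])

lemma chart_slit_dom:
  "w \<in> points (slit M) \<Longrightarrow> i \<in> charts_at M (fst w) \<Longrightarrow> chart (slit M) i w \<in> slit_dom M i"
  using tangent_component_nonzero[OF M] by (auto simp: slit_dom_def chart_slit points_slit charts_at_def)

lemma slit_dom_scale: "(x, y) \<in> slit_dom M i \<Longrightarrow> l > 0 \<Longrightarrow> (x, l *\<^sub>R y) \<in> slit_dom M i"
  by (simp add: slit_dom_def)

lemma smooth_energy:
  assumes i: "i \<in> index M" shows "smooth_on (slit_dom M i) (energy M F i)"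
proof -
  have "smooth_on (chart (slit M) i ` (points (slit M) \<inter> cdom (slit M) i)) (F \<circ> param (slit M) i)"
    using F i by (auto simp: finsler_metric_def smooth_fun_def)
  then have "smooth_on (slit_dom M i) (F \<circ> param (slit M) i)"
    using i slit_image_cdom[OF M i] Int_absorb1[OF cdom_points[OF slit_atlas[OF M], of i]]
    by (simp add: slit_dom_def)
  from smooth_on_scaleR[OF open_slit_dom[OF i] this this]
  show ?thesis by (simp add: energy_def[abs_def] power2_eq_square)
qed

lemma energy_eq:
  assumes i: "i \<in> charts_at M p" and u: "u \<in> tangent_space M p" "u i \<noteq> 0"
  shows "energy M F i (chart M i p, u i) = (F (p, u))\<^sup>2"
  using assms coord_vec_component[OF M u(1) i] by (simp add: energy_def param_slit[OF M] charts_at_def)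

lemma energy_homogeneous:
  assumes i: "i \<in> index M" and z: "(x, y) \<in> slit_dom M i" and l: "l > 0"
  shows "energy M F i (x, l *\<^sub>R y) = l\<^sup>2 * energy M F i (x, y)"
proof -
  obtain p where p: "p \<in> cdom M i" "x = chart M i p" "y \<noteq> 0" using z by (auto simp: slit_dom_def)
  have ip: "i \<in> charts_at M p" using i p by (simp add: charts_at_def)
  let ?u = "coord_vec M i p y"
  have u: "?u \<in> tangent_space M p" by (rule coord_vec_tangent[OF M ip])
  have "energy M F i (chart M i p, ?u i) = (F (p, ?u))\<^sup>2"
    using p coord_vec_same[OF M ip] by (intro energy_eq ip u) auto
  moreover have "energy M F i (chart M i p, (l *\<^sub>R ?u) i) = (F (p, l *\<^sub>R ?u))\<^sup>2"
    using p l coord_vec_same[OF M ip] by (intro energy_eq ip tangent_scale[OF M] u) (auto simp: scaleR_fun_def)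
  moreover have "F (p, l *\<^sub>R ?u) = l * F (p, ?u)"
    using F u l cdom_points[OF M i] p by (auto simp: finsler_metric_def)
  ultimately show ?thesis using p coord_vec_same[OF M ip] by (simp add: power_mult_distrib scaleR_fun_def)
qed

lemma vdiff_energy_homogeneous:
  assumes i: "i \<in> index M" and z: "(x, y) \<in> slit_dom M i" and l: "l > 0"
  shows "vdiff a (energy M F i) (x, l *\<^sub>R y) = l * vdiff a (energy M F i) (x, y)"
  using vdiff_homogeneous[OF open_slit_dom[OF i] slit_dom_scale smooth_energy[OF i] energy_homogeneous[OF i], of l x y a]
    l z by (simp add: power2_eq_square)

lemma vdiff2_energy_homogeneous:
  assumes i: "i \<in> index M" and z: "(x, y) \<in> slit_dom M i" and l: "l > 0"
  shows "vdiff b (vdiff a (energy M F i)) (x, l *\<^sub>R y) = vdiff b (vdiff a (energy M F i)) (x, y)"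
proof -
  have "l * vdiff b (vdiff a (energy M F i)) (x, l *\<^sub>R y) = l * vdiff b (vdiff a (energy M F i)) (x, y)"
    using l by (intro vdiff_homogeneous[OF open_slit_dom[OF i] _ smooth_on_vdiff[OF smooth_energy[OF i]] _ z])
      (auto intro: slit_dom_scale vdiff_energy_homogeneous[OF i])
  then show ?thesis using l by simp
qed

lemma vdiff_energy_euler:
  assumes i: "i \<in> index M" and z: "(x, y) \<in> slit_dom M i"
  shows "vdiff y (vdiff a (energy M F i)) (x, y) = vdiff a (energy M F i) (x, y)"
  using vdiff_euler[OF smooth_on_vdiff[OF smooth_energy[OF i]] z, where \<phi> = "\<lambda>l. l" and d = 1]
    vdiff_energy_homogeneous[OF i z] by simp

text \<open>Second fibre derivatives are homogeneous of degree 0. In coordinates this is the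
  vanishing of the Cartan tensor when its first argument is the base direction.\<close>

lemma vdiff2_energy_euler:
  assumes i: "i \<in> index M" and z: "(x, y) \<in> slit_dom M i"
  shows "vdiff y (vdiff b (vdiff a (energy M F i))) (x, y) = 0"
  using vdiff_euler[OF smooth_on_vdiff[OF smooth_on_vdiff[OF smooth_energy[OF i]]] z,
      where \<phi> = "\<lambda>l. 1" and d = 0] vdiff2_energy_homogeneous[OF i z] by simp

section \<open>Coordinate expressions and algebra of the two tensors\<close>

lemma energy_line:
  assumes w: "w \<in> points (slit M)" and i: "i \<in> charts_at M (fst w)" and u: "u \<in> tangent_space M (fst w)"
    and d: "chart (slit M) i w + (0, u i) \<in> slit_dom M i"
  shows "(F (fst w, snd w + u))\<^sup>2 = energy M F i (chart (slit M) i w + (0, u i))"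
  using energy_eq[OF i, of "snd w + u"] w u d tangent_add[OF M] by (simp add: chart_slit points_slit slit_dom_def)

lemma fund_tensor_eq:
  assumes w: "w \<in> points (slit M)" and i: "i \<in> charts_at M (fst w)"
    and u: "u \<in> tangent_space M (fst w)" and v: "v \<in> tangent_space M (fst w)"
  shows "fund_tensor F w u v = 1/2 * vdiff (v i) (vdiff (u i) (energy M F i)) (chart (slit M) i w)"
proof -
  have ii: "i \<in> index M" using i by (simp add: charts_at_def)
  note E = smooth_energy[OF ii] and O = open_slit_dom[OF ii] and z = chart_slit_dom[OF w i]
  have "deriv (\<lambda>t. deriv (\<lambda>s. (F (fst w, snd w + s *\<^sub>R u + t *\<^sub>R v))\<^sup>2) 0) 0 =
     vdiff (v i) (vdiff (u i) (energy M F i)) (chart (slit M) i w)"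
    unfolding vdiff_def[of "v i"]
  proof (rule deriv_line[OF O z smooth_on_differentiable[OF smooth_on_vdiff[OF E] z]])
    fix t assume t: "chart (slit M) i w + t *\<^sub>R (0, v i) \<in> slit_dom M i"
    show "deriv (\<lambda>s. (F (fst w, snd w + s *\<^sub>R u + t *\<^sub>R v))\<^sup>2) 0 = vdiff (u i) (energy M F i) (chart (slit M) i w + t *\<^sub>R (0, v i))"
      unfolding vdiff_def
    proof (rule deriv_line[OF O t smooth_on_differentiable[OF E t]])
      fix s assume s: "chart (slit M) i w + t *\<^sub>R (0, v i) + s *\<^sub>R (0, u i) \<in> slit_dom M i"
      show "(F (fst w, snd w + s *\<^sub>R u + t *\<^sub>R v))\<^sup>2 = energy M F i (chart (slit M) i w + t *\<^sub>R (0, v i) + s *\<^sub>R (0, u i))"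
        using energy_line[OF w i tangent_add[OF M tangent_scale[OF M v, of t] tangent_scale[OF M u, of s]]] s
        by (simp add: scaleR_fun_def plus_prod_def add_ac)
    qed
  qed
  then show ?thesis by (simp add: fund_tensor_def)
qed

lemma cartan_tensor_eq:
  assumes w: "w \<in> points (slit M)" and i: "i \<in> charts_at M (fst w)"
    and u: "u \<in> tangent_space M (fst w)" and v: "v \<in> tangent_space M (fst w)" and x: "x \<in> tangent_space M (fst w)"
  shows "cartan_tensor F w u v x =
    1/4 * vdiff (u i) (vdiff (v i) (vdiff (x i) (energy M F i))) (chart (slit M) i w)"
proof -
  have ii: "i \<in> index M" using i by (simp add: charts_at_def)
  note E = smooth_energy[OF ii] and O = open_slit_dom[OF ii] and z = chart_slit_dom[OF w i]
  let ?z = "chart (slit M) i w"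
  have "deriv (\<lambda>r. deriv (\<lambda>s. deriv (\<lambda>t. (F (fst w, snd w + r *\<^sub>R u + s *\<^sub>R v + t *\<^sub>R x))\<^sup>2) 0) 0) 0 =
     vdiff (u i) (vdiff (v i) (vdiff (x i) (energy M F i))) ?z"
    unfolding vdiff_def[of "u i"]
  proof (rule deriv_line[OF O z smooth_on_differentiable[OF smooth_on_vdiff[OF smooth_on_vdiff[OF E]] z]])
    fix r assume r: "?z + r *\<^sub>R (0, u i) \<in> slit_dom M i"
    show "deriv (\<lambda>s. deriv (\<lambda>t. (F (fst w, snd w + r *\<^sub>R u + s *\<^sub>R v + t *\<^sub>R x))\<^sup>2) 0) 0 =
        vdiff (v i) (vdiff (x i) (energy M F i)) (?z + r *\<^sub>R (0, u i))"
      unfolding vdiff_def[of "v i"]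
    proof (rule deriv_line[OF O r smooth_on_differentiable[OF smooth_on_vdiff[OF E] r]])
      fix s assume s: "?z + r *\<^sub>R (0, u i) + s *\<^sub>R (0, v i) \<in> slit_dom M i"
      show "deriv (\<lambda>t. (F (fst w, snd w + r *\<^sub>R u + s *\<^sub>R v + t *\<^sub>R x))\<^sup>2) 0 =
          vdiff (x i) (energy M F i) (?z + r *\<^sub>R (0, u i) + s *\<^sub>R (0, v i))"
        unfolding vdiff_def
      proof (rule deriv_line[OF O s smooth_on_differentiable[OF E s]])
        fix t assume t: "?z + r *\<^sub>R (0, u i) + s *\<^sub>R (0, v i) + t *\<^sub>R (0, x i) \<in> slit_dom M i"
        show "(F (fst w, snd w + r *\<^sub>R u + s *\<^sub>R v + t *\<^sub>R x))\<^sup>2 =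
            energy M F i (?z + r *\<^sub>R (0, u i) + s *\<^sub>R (0, v i) + t *\<^sub>R (0, x i))"
          using energy_line[OF w i tangent_add[OF M tangent_add[OF M tangent_scale[OF M u, of r] tangent_scale[OF M v, of s]]
              tangent_scale[OF M x, of t]]] t
          by (simp add: scaleR_fun_def plus_prod_def add_ac)
      qed
    qed
  qed
  then show ?thesis by (simp add: cartan_tensor_def)
qed

lemma slit_chart_exists:
  assumes "w \<in> points (slit M)" obtains i where "i \<in> charts_at M (fst w)"
  using assms chart_at_in[OF M] by (auto simp: points_slit)

lemma fund_tensor_sym:
  assumes w: "w \<in> points (slit M)" and u: "u \<in> tangent_space M (fst w)" and v: "v \<in> tangent_space M (fst w)"
  shows "fund_tensor F w u v = fund_tensor F w v u"
proof -
  obtain i where i: "i \<in> charts_at M (fst w)" using slit_chart_exists[OF w] .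
  then have ii: "i \<in> index M" by (simp add: charts_at_def)
  show ?thesis using vdiff_swap[OF open_slit_dom[OF ii] smooth_energy[OF ii] chart_slit_dom[OF w i]]
    by (simp add: fund_tensor_eq[OF w i] u v)
qed

lemma fund_tensor_linear_right:
  assumes w: "w \<in> points (slit M)" and u: "u \<in> tangent_space M (fst w)"
    and v: "v \<in> tangent_space M (fst w)" and x: "x \<in> tangent_space M (fst w)"
  shows "fund_tensor F w u (a *\<^sub>R v + b *\<^sub>R x) = a * fund_tensor F w u v + b * fund_tensor F w u x"
proof -
  obtain i where i: "i \<in> charts_at M (fst w)" using slit_chart_exists[OF w] .
  then have ii: "i \<in> index M" by (simp add: charts_at_def)
  note lin = linear_vdiff[OF smooth_on_vdiff[OF smooth_energy[OF ii]] chart_slit_dom[OF w i], of "u i"]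
  have c: "(a *\<^sub>R v + b *\<^sub>R x) i = a *\<^sub>R v i + b *\<^sub>R x i" by (simp add: scaleR_fun_def)
  show ?thesis using u v x
    by (simp add: fund_tensor_eq[OF w i] tangent_add[OF M] tangent_scale[OF M] c
        linear_add[OF lin] linear_scale[OF lin] algebra_simps del: plus_fun_apply)
qed

lemma fund_tensor_add_right:
  assumes "w \<in> points (slit M)" "u \<in> tangent_space M (fst w)" "v \<in> tangent_space M (fst w)" "x \<in> tangent_space M (fst w)"
  shows "fund_tensor F w u (v + x) = fund_tensor F w u v + fund_tensor F w u x"
  using fund_tensor_linear_right[OF assms, of 1 1] by simp

lemma fund_tensor_add_left:
  assumes "w \<in> points (slit M)" "u \<in> tangent_space M (fst w)" "v \<in> tangent_space M (fst w)" "x \<in> tangent_space M (fst w)"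
  shows "fund_tensor F w (v + x) u = fund_tensor F w v u + fund_tensor F w x u"
  using fund_tensor_add_right[OF assms] assms by (simp add: fund_tensor_sym[of w _ u] tangent_add[OF M])

lemma fund_tensor_nondegenerate:
  assumes w: "w \<in> points (slit M)" and u: "u \<in> tangent_space M (fst w)"
    and 0: "\<And>v. v \<in> tangent_space M (fst w) \<Longrightarrow> fund_tensor F w u v = 0"
  shows "u = 0"
proof (rule ccontr)
  assume "u \<noteq> 0"
  then have "fund_tensor F w u u > 0" using F w u unfolding finsler_metric_def by blast
  then show False using 0[OF u] by simp
qed

lemma cartan_tensor_sym:
  assumes w: "w \<in> points (slit M)"
    and u: "u \<in> tangent_space M (fst w)" and v: "v \<in> tangent_space M (fst w)" and x: "x \<in> tangent_space M (fst w)"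
  shows "cartan_tensor F w u v x = cartan_tensor F w u x v" "cartan_tensor F w u v x = cartan_tensor F w v u x"
proof -
  obtain i where i: "i \<in> charts_at M (fst w)" using slit_chart_exists[OF w] .
  then have ii: "i \<in> index M" by (simp add: charts_at_def)
  note O = open_slit_dom[OF ii] and E = smooth_energy[OF ii] and z = chart_slit_dom[OF w i]
  show "cartan_tensor F w u v x = cartan_tensor F w u x v"
    using vdiff_cong[OF O z vdiff_swap[OF O E]] by (simp add: cartan_tensor_eq[OF w i] u v x)
  show "cartan_tensor F w u v x = cartan_tensor F w v u x"
    using vdiff_swap[OF O smooth_on_vdiff[OF E] z] by (simp add: cartan_tensor_eq[OF w i] u v x)
qed

lemma cartan_tensor_self:
  assumes w: "w \<in> points (slit M)" and u: "u \<in> tangent_space M (fst w)" and v: "v \<in> tangent_space M (fst w)"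
  shows "cartan_tensor F w u (snd w) v = 0"
proof -
  obtain i where i: "i \<in> charts_at M (fst w)" using slit_chart_exists[OF w] .
  then have ii: "i \<in> index M" by (simp add: charts_at_def)
  have sw: "snd w \<in> tangent_space M (fst w)" using w by (simp add: points_slit)
  \<comment> \<open>Euler's relation concerns the outermost fibre derivative, so
    \<open>snd w\<close> is first moved to the first slot.\<close>
  have "cartan_tensor F w u (snd w) v = cartan_tensor F w (snd w) u v"
    using cartan_tensor_sym(2)[OF w u sw v] .
  also have "\<dots> = 0"
    using vdiff2_energy_euler[OF ii, of "fst (chart (slit M) i w)" "snd (chart (slit M) i w)"] chart_slit_dom[OF w i]
    by (simp add: cartan_tensor_eq[OF w i sw u v] chart_slit)
  finally show ?thesis .
qed

section \<open>The fundamental tensor on fields pulled back from the base\<close>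

lemma smooth_vdiff2_energy:
  assumes i: "i \<in> index M" and B: "open B" "B \<subseteq> slit_dom M i" and ab: "smooth_on B a" "smooth_on B b"
  shows "smooth_on B (\<lambda>z. vdiff (a z) (vdiff (b z) (energy M F i)) z)"
proof -
  note O = open_slit_dom[OF i] and E = smooth_energy[OF i]
  have "vdiff (a z) (vdiff (b z) (energy M F i)) z =
    (\<Sum>e\<in>Basis. (b z \<bullet> e) *\<^sub>R (\<Sum>c\<in>Basis. (a z \<bullet> c) *\<^sub>R vdiff c (vdiff e (energy M F i)) z))" if "z \<in> B" for z
  proof -
    have z: "z \<in> slit_dom M i" using that B by auto
    show ?thesis
      unfolding vdiff_vdiff_sum[OF O z E, of "a z" "b z"]
      by (simp add: linear_sum_Basis[OF linear_vdiff[OF smooth_on_vdiff[OF E] z], of "a z"])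
  qed
  moreover have "smooth_on B (\<lambda>z. \<Sum>e\<in>Basis. (b z \<bullet> e) *\<^sub>R (\<Sum>c\<in>Basis. (a z \<bullet> c) *\<^sub>R vdiff c (vdiff e (energy M F i)) z))"
    by (intro smooth_on_sum smooth_on_scaleR smooth_on_inner B ab smooth_on_subset[OF smooth_on_vdiff[OF smooth_on_vdiff[OF E]] B(2)])
  ultimately show ?thesis by (subst smooth_on_cong[OF B(1)]) auto
qed

lemma chart_over_subset: "i \<in> index M \<Longrightarrow> chart (slit M) i ` (over M Q \<inter> cdom (slit M) i) \<subseteq> slit_dom M i"
  by (auto simp: slit_image[OF M] slit_dom_def)

lemma fund_tensor_fields_smooth:
  assumes T: "vector_field M Q T" and V: "vector_field M Q V" and i: "i \<in> index M"
  shows "smooth_on (chart (slit M) i ` (over M Q \<inter> cdom (slit M) i))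
    ((\<lambda>z. fund_tensor F z (T (fst z)) (V (fst z))) \<circ> param (slit M) i)" (is "smooth_on ?B _")
proof -
  have A: "openin (mtop (slit M)) (over M Q)" using openin_over[OF M] T by (auto simp: vector_field_def)
  note s = smooth_on_slit_chart[OF M A i]
  have QB: "open (chart M i ` (Q \<inter> cdom M i))" using T i openin_mtop[OF M] by (auto simp: vector_field_def)
  have c: "smooth_on ?B (\<lambda>z. Z (param M i (fst z)) i)" if "vector_field M Q Z" for Z
    by (rule smooth_on_compose[OF s(1) QB _ s(2) vector_field_smooth[OF M that i]])
      (auto simp: slit_image[OF M i])
  have "smooth_on ?B (\<lambda>z. (1/2) *\<^sub>R vdiff (V (param M i (fst z)) i) (vdiff (T (param M i (fst z)) i) (energy M F i)) z)"
    by (intro smooth_on_scaleR smooth_on_const s(1) smooth_vdiff2_energy i c T V chart_over_subset)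
  then show ?thesis
  proof (subst smooth_on_cong[OF s(1)])
    fix z assume "z \<in> ?B"
    then obtain w where w: "z = chart (slit M) i w" "w \<in> over M Q" "w \<in> cdom (slit M) i" by auto
    then have "i \<in> charts_at M (fst w)" using i by (auto simp: charts_at_def cdom_slit)
    then show "((\<lambda>z. fund_tensor F z (T (fst z)) (V (fst z))) \<circ> param (slit M) i) z =
        (1/2) *\<^sub>R vdiff (V (param M i (fst z)) i) (vdiff (T (param M i (fst z)) i) (energy M F i)) z"
      using w i T V fund_tensor_eq[of w i "T (fst w)" "V (fst w)"]
      by (simp add: param_chart[OF slit_atlas[OF M]] fst_chart_slit cdom_slit param_chart[OF M] over_def vector_field_def)
  qed
qed

text \<open>\<open>T\<close> and \<open>V\<close> are constant along fibres, so only the dependence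
  of the fundamental tensor on the direction is differentiated. This yields half a third fibre
  derivative of the square of the metric, that is, twice the Cartan tensor.\<close>

lemma fund_tensor_fields_vertical_derivative:
  assumes T: "vector_field M Q T" and V: "vector_field M Q V"
    and w: "w \<in> over M Q" and n: "n \<in> tangent_space M (fst w)"
  shows "tderiv (slit M) (\<lambda>z. fund_tensor F z (T (fst z)) (V (fst z))) w (imap M w n) =
    2 * cartan_tensor F w n (T (fst w)) (V (fst w))"
proof -
  define i where "i = chart_at M (fst w)"
  have wp: "w \<in> points (slit M)" using w by (rule over_points)
  have i: "i \<in> charts_at M (fst w)" using chart_at_in[OF M] wp by (simp add: i_def points_slit)
  have ii: "i \<in> index M" "fst w \<in> cdom M i" using i by (auto simp: charts_at_def)
  have A: "openin (mtop (slit M)) (over M Q)" using openin_over[OF M] T by (auto simp: vector_field_def)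
  let ?z = "chart (slit M) i w" and ?B = "chart (slit M) i ` (over M Q \<inter> cdom (slit M) i)"
  let ?h = "(\<lambda>z. fund_tensor F z (T (fst z)) (V (fst z))) \<circ> param (slit M) i"
  let ?G = "\<lambda>z. 1/2 * vdiff (V (fst w) i) (vdiff (T (fst w) i) (energy M F i)) z"
  have B: "open ?B" "?z \<in> ?B"
    using smooth_on_slit_chart(1)[OF M A ii(1)] w wp ii by (auto simp: cdom_slit points_slit)
  have G: "smooth_on (slit_dom M i) (vdiff (V (fst w) i) (vdiff (T (fst w) i) (energy M F i)))"
    by (intro smooth_on_vdiff smooth_energy ii)
  note dG = smooth_on_has_derivative[OF G chart_slit_dom[OF wp i]]
  have "vdiff (n i) ?h ?z = vdiff (n i) ?G ?z"
  proof (rule vdiff_cong_fiber[OF B])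
    show "?h differentiable (at ?z)"
      using smooth_on_differentiable[OF fund_tensor_fields_smooth[OF T V ii(1)] B(2)] .
    show "?G differentiable (at ?z)"
      using has_derivative_mult_right[OF dG, of "1/2"] by (auto simp: differentiable_def)
    fix y assume "(fst ?z, y) \<in> ?B"
    then obtain z where z: "z \<in> over M Q" "z \<in> cdom (slit M) i" "(fst ?z, y) = chart (slit M) i z" by auto
    then have f: "fst z = fst w" "i \<in> charts_at M (fst z)"
      using inj_chart[OF M ii(1)] ii by (auto simp: chart_slit inj_on_def cdom_slit charts_at_def)
    show "?h (fst ?z, y) = ?G (fst ?z, y)"
      using z f T V w fund_tensor_eq[of z i "T (fst z)" "V (fst z)"] ii
      by (simp add: param_chart[OF slit_atlas[OF M]] over_def vector_field_def)
  qed
  also have "\<dots> = 1/2 * vdiff (n i) (vdiff (V (fst w) i) (vdiff (T (fst w) i) (energy M F i))) ?z"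
    unfolding vdiff_def[of "n i"] using frechet_derivativeI[OF has_derivative_mult_right[OF dG, of "1/2"]] by simp
  also have "\<dots> = 2 * cartan_tensor F w n (V (fst w)) (T (fst w))"
    using T V w n by (simp add: over_def vector_field_def cartan_tensor_eq[OF wp i])
  also have "\<dots> = 2 * cartan_tensor F w n (T (fst w)) (V (fst w))"
    using T V w n cartan_tensor_sym(1)[OF wp n] by (simp add: over_def vector_field_def)
  finally show ?thesis
    by (simp add: tderiv_def Let_def chart_at_slit[OF wp] i_def[symmetric] imap_eq[OF M wp n] vdiff_def)
qed

section \<open>The spray is a second order field\<close>

lemma legendre_cotangent: "w \<in> points (slit M) \<Longrightarrow> snd (legendre M F w) \<in> cotangent_space M (fst w)"
  by (auto simp: legendre_def cotangent_space_def fund_tensor_linear_right points_slit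
      tangent_add[OF M] tangent_scale[OF M])

lemma charts_at_legendre:
  "w \<in> points (slit M) \<Longrightarrow> charts_at (cotangent M) (legendre M F w) = charts_at M (fst w)"
  using legendre_cotangent[of w] by (auto simp: charts_at_def cotangent_def legendre_def)

text \<open>By Euler's relation the covector \<open>g\<^sub>w(w, \<cdot>)\<close> is the fibre
  differential of half the square of the metric, which gives the momenta in coordinates.\<close>

lemma legendre_momentum:
  assumes w: "w \<in> points (slit M)" and i: "i \<in> charts_at M (fst w)"
  shows "chart (cotangent M) i (legendre M F w) =
    (chart M i (fst w), \<Sum>b\<in>Basis. (1/2 * vdiff b (energy M F i) (chart (slit M) i w)) *\<^sub>R b)"
proof -
  have ii: "i \<in> index M" using i by (simp add: charts_at_def)
  note O = open_slit_dom[OF ii] and E = smooth_energy[OF ii] and z = chart_slit_dom[OF w i]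
  have sw: "snd w \<in> tangent_space M (fst w)" using w by (simp add: points_slit)
  have m: "fund_tensor F w (snd w) (coord_vec M i (fst w) b) = 1/2 * vdiff b (energy M F i) (chart (slit M) i w)" for b
    using fund_tensor_eq[OF w i sw coord_vec_tangent[OF M i, of b]] vdiff_swap[OF O E z, of b "snd w i"]
      vdiff_energy_euler[OF ii, of "fst (chart (slit M) i w)" "snd w i" b] z
    by (simp add: coord_vec_same[OF M i] chart_slit)
  show ?thesis by (simp add: cotangent_def legendre_def coord_vec_tangent[OF M i] m)
qed

text \<open>The vertical argument has base part 0, so only one of the two terms of the canonical
  form survives. It pairs the base part of \<open>\<xi>\<close> with the fibre derivative of the
  momenta, and the latter is the fundamental tensor.\<close>

lemma finsler_form_vertical:
  assumes w: "w \<in> points (slit M)" and \<xi>: "\<xi> \<in> tangent_space (slit M) w" and v: "v \<in> tangent_space M (fst w)"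
  shows "finsler_form M F w \<xi> (imap M w v) = fund_tensor F w (\<lambda>j. fst (\<xi> j)) v"
proof -
  define i where "i = chart_at M (fst w)"
  have i: "i \<in> charts_at M (fst w)" using chart_at_in[OF M] w by (simp add: i_def points_slit)
  have ii: "i \<in> index M" "fst w \<in> cdom M i" using i by (auto simp: charts_at_def)
  have ci: "chart_at (slit M) w = i" "chart_at (cotangent M) (legendre M F w) = i"
    using w by (simp_all add: chart_at_def charts_at_slit charts_at_legendre i_def)
  note O = open_slit_dom[OF ii(1)] and E = smooth_energy[OF ii(1)] and z = chart_slit_dom[OF w i]
  let ?z = "chart (slit M) i w" and ?E = "energy M F i"
  have 1: "((\<lambda>z. (fst z, \<Sum>b\<in>Basis. (1/2 * vdiff b ?E z) *\<^sub>R b)) has_derivative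
     (\<lambda>u. (fst u, \<Sum>b\<in>Basis. (1/2 * frechet_derivative (vdiff b ?E) (at ?z) u) *\<^sub>R b))) (at ?z)"
    by (intro has_derivative_Pair has_derivative_sum has_derivative_scaleR_left has_derivative_mult_right
        smooth_on_has_derivative[OF smooth_on_vdiff[OF E] z]) (auto intro!: derivative_eq_intros)
  have "(chart (cotangent M) i \<circ> legendre M F \<circ> param (slit M) i has_derivative
     (\<lambda>u. (fst u, \<Sum>b\<in>Basis. (1/2 * frechet_derivative (vdiff b ?E) (at ?z) u) *\<^sub>R b))) (at ?z)"
  proof (subst has_derivative_cong_open[OF O z])
    fix x assume "x \<in> slit_dom M i"
    then obtain p where p: "p \<in> cdom M i" "fst x = chart M i p" "snd x \<noteq> 0" by (auto simp: slit_dom_def)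
    have x: "x = (chart M i p, snd x)" using p by (simp add: prod_eq_iff)
    have ip: "i \<in> charts_at M p" using p ii by (simp add: charts_at_def)
    have pz: "param (slit M) i x = (p, coord_vec M i p (snd x))" using param_slit[OF M ii(1) p(1,3)] x by simp
    have "coord_vec M i p (snd x) \<noteq> 0" using coord_vec_same[OF M ip, of "snd x"] p by (metis zero_fun_apply)
    then have s: "param (slit M) i x \<in> points (slit M)"
      using p cdom_points[OF M ii(1)] coord_vec_tangent[OF M ip] by (auto simp: pz points_slit)
    have c: "chart (slit M) i (param (slit M) i x) = x"
      using p coord_vec_same[OF M ip] by (simp add: pz chart_slit prod_eq_iff)
    show "(chart (cotangent M) i \<circ> legendre M F \<circ> param (slit M) i) x = (fst x, \<Sum>b\<in>Basis. (1/2 * vdiff b ?E x) *\<^sub>R b)"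
      using legendre_momentum[OF s, of i] ip c p by (simp add: pz)
  qed (rule 1)
  note d = frechet_derivativeI[OF this]
  have t: "tangent_map (slit M) (cotangent M) (legendre M F) w \<eta> i =
      (fst (\<eta> i), \<Sum>b\<in>Basis. (1/2 * frechet_derivative (vdiff b ?E) (at ?z) (\<eta> i)) *\<^sub>R b)" for \<eta>
    using i by (simp add: tangent_map_def Let_def ci charts_at_legendre[OF w] d)
  have "finsler_form M F w \<xi> (imap M w v) = (\<Sum>b\<in>Basis. (fst (\<xi> i) \<bullet> b) * (1/2 * vdiff (v i) (vdiff b ?E) ?z))"
    by (simp add: finsler_form_def Let_def canonical_form_def ci t imap_eq[OF M w v] inner_sum_left
        inner_Basis if_distrib vdiff_def[of "v i"] cong: if_cong)
  also have "\<dots> = 1/2 * vdiff (v i) (vdiff (fst (\<xi> i)) ?E) ?z"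
    by (simp add: vdiff_vdiff_sum[OF O z E, of "v i" "fst (\<xi> i)"] sum_distrib_left mult_ac sum_divide_distrib)
  also have "\<dots> = fund_tensor F w (\<lambda>j. fst (\<xi> j)) v"
    using fund_tensor_eq[OF w i tangent_fst[OF M w \<xi>] v] by simp
  finally show ?thesis .
qed

lemma energy_vertical_derivative:
  assumes w: "w \<in> points (slit M)" and v: "v \<in> tangent_space M (fst w)"
  shows "tderiv (slit M) (\<lambda>z. 1/2 * (F z)\<^sup>2) w (imap M w v) = fund_tensor F w (snd w) v"
proof -
  define i where "i = chart_at M (fst w)"
  have i: "i \<in> charts_at M (fst w)" using chart_at_in[OF M] w by (simp add: i_def points_slit)
  have ii: "i \<in> index M" using i by (auto simp: charts_at_def)
  note O = open_slit_dom[OF ii] and E = smooth_energy[OF ii] and z = chart_slit_dom[OF w i]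
  have sw: "snd w \<in> tangent_space M (fst w)" using w by (simp add: points_slit)
  have "(\<lambda>z. 1/2 * (F z)\<^sup>2) \<circ> param (slit M) i = (\<lambda>z. 1/2 * energy M F i z)"
    by (auto simp: energy_def)
  then have "tderiv (slit M) (\<lambda>z. 1/2 * (F z)\<^sup>2) w (imap M w v) = 1/2 * vdiff (v i) (energy M F i) (chart (slit M) i w)"
    using frechet_derivativeI[OF has_derivative_mult_right[OF smooth_on_has_derivative[OF E z], of "1/2"]]
    by (simp add: tderiv_def Let_def chart_at_slit[OF w] i_def[symmetric] imap_eq[OF M w v] vdiff_def)
  also have "\<dots> = fund_tensor F w (snd w) v"
    using fund_tensor_eq[OF w i sw v] vdiff_swap[OF O E z, of "v i" "snd w i"]
      vdiff_energy_euler[OF ii, of "fst (chart (slit M) i w)" "snd w i" "v i"] z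
    by (simp add: chart_slit)
  finally show ?thesis .
qed

text \<open>This is J(S) = C. The equation of the spray is tested on vertical vectors: both sides
  become fundamental tensors, with first arguments the base part of \<open>S w\<close> and
  \<open>snd w\<close>, and positive definiteness identifies these arguments.\<close>

lemma spray_second_order:
  assumes S: "geodesic_spray M F S" and w: "w \<in> points (slit M)"
  shows "fst (S w i) = snd w i"
proof -
  have \<xi>: "S w \<in> tangent_space (slit M) w" using S w by (simp add: geodesic_spray_def vector_field_def)
  let ?s = "\<lambda>j. fst (S w j)"
  have s: "?s \<in> tangent_space M (fst w)" by (rule tangent_fst[OF M w \<xi>])
  have sw: "snd w \<in> tangent_space M (fst w)" using w by (simp add: points_slit)
  have "fund_tensor F w (?s - snd w) v = 0" if v: "v \<in> tangent_space M (fst w)" for v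
  proof -
    have "imap M w v \<in> tangent_space (slit M) w" using imap_vertical[OF M w v] by (simp add: vertical_def)
    then have "tderiv (slit M) (\<lambda>z. 1/2 * (F z)\<^sup>2) w (imap M w v) = finsler_form M F w (S w) (imap M w v)"
      using S w unfolding geodesic_spray_def by blast
    then have "fund_tensor F w ?s v = fund_tensor F w (snd w) v"
      using finsler_form_vertical[OF w \<xi> v] energy_vertical_derivative[OF w v] by simp
    moreover have "fund_tensor F w ?s v = fund_tensor F w (?s - snd w) v + fund_tensor F w (snd w) v"
      using fund_tensor_add_left[OF w v tangent_diff[OF M s sw] sw] by simp
    ultimately show ?thesis by simp
  qed
  then have "?s - snd w = 0" by (intro fund_tensor_nondegenerate[OF w tangent_diff[OF M s sw]])
  then show ?thesis by (simp add: fun_eq_iff)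
qed

end

section \<open>The canonical connection of a second order field\<close>

text \<open>Minus half of it gives the coefficients of the nonlinear connection.\<close>

definition spray_coeff :: "('p, 'i, 'e::euclidean_space) atlas \<Rightarrow>
    (('p, 'i, 'e) tpoint \<Rightarrow> ('i, 'e) tvec2) \<Rightarrow> 'i \<Rightarrow> ('p, 'i, 'e) tpoint \<Rightarrow> 'e \<Rightarrow> 'e"
  where "spray_coeff M S i w a =
    snd (frechet_derivative (\<lambda>z. S (param (slit M) i z) i) (at (chart (slit M) i w)) (0, a))"

lemma vector_field_zero:
  "smooth_atlas M \<Longrightarrow> openin (mtop M) B \<Longrightarrow> vector_field M B (\<lambda>p. 0)"
  unfolding vector_field_def using tangent_0 smooth_on_const by (auto simp: zero_fun_def)

lemma lie_bracket_zero: "lie_bracket M (\<lambda>p. 0) V p = 0"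
  if "smooth_atlas M" "vector_field M B V" "p \<in> B"
proof
  fix i
  show "lie_bracket M (\<lambda>p. 0) V p i = 0 i"
    using linear_0[OF has_derivative_linear[OF vector_field_component_derivative[OF that, of i]]]
    by (auto simp: lie_bracket_def)
qed

context
  fixes M :: "('p, 'i, 'e::euclidean_space) atlas"
  assumes M: "smooth_atlas M"
begin

text \<open>Brackets of projectable fields project to brackets, and the vertical endomorphism
  depends on the projection only. This is how brackets on the base enter the torsion.\<close>

lemma bracket_projectable:
  assumes X: "vector_field (slit M) (over M B) X" and Y: "vector_field (slit M) (over M B) Y"
    and U: "vector_field M B U" and V: "vector_field M B V"
    and XU: "\<And>z. z \<in> over M B \<Longrightarrow> (\<lambda>j. fst (X z j)) = U (fst z)"
    and YV: "\<And>z. z \<in> over M B \<Longrightarrow> (\<lambda>j. fst (Y z j)) = V (fst z)"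
    and w: "w \<in> over M B"
  shows "vert_endo M w (lie_bracket (slit M) X Y w) = imap M w (lie_bracket M U V (fst w))"
proof -
  note SA = slit_atlas[OF M]
  have wp: "w \<in> points (slit M)" and wB: "fst w \<in> B" using w by (auto simp: over_def)
  obtain i where i: "i \<in> charts_at M (fst w)" using chart_at_in[OF M] wp by (auto simp: points_slit)
  then have ii: "i \<in> index M" "fst w \<in> cdom M i" "i \<in> charts_at (slit M) w"
    using wp by (auto simp: charts_at_def cdom_slit points_slit)
  let ?z = "chart (slit M) i w"
  let ?O = "chart (slit M) i ` (over M B \<inter> cdom (slit M) i)"
  have O: "open ?O" "?z \<in> ?O"
    using smooth_on_slit_chart(1)[OF M _ ii(1)] X w wp ii by (auto simp: vector_field_def cdom_slit points_slit)
  \<comment> \<open>In the chart the base part of \<open>Z\<close> is the component of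
    \<open>R\<close> composed with \<open>fst\<close>, so its derivative ignores the fibre
    direction.\<close>
  have key: "fst (frechet_derivative (\<lambda>x. Z (param (slit M) i x) i) (at ?z) v) =
      frechet_derivative (\<lambda>x. R (param M i x) i) (at (chart M i (fst w))) (fst v)"
    if Z: "vector_field (slit M) (over M B) Z" and R: "vector_field M B R"
      and ZR: "\<And>z. z \<in> over M B \<Longrightarrow> (\<lambda>j. fst (Z z j)) = R (fst z)" for Z R v
  proof -
    have 1: "((\<lambda>x. fst (Z (param (slit M) i x) i)) has_derivative
        (\<lambda>v. fst (frechet_derivative (\<lambda>x. Z (param (slit M) i x) i) (at ?z) v))) (at ?z)"
      using vector_field_component_derivative[OF SA Z w ii(3)] by (intro has_derivative_fst)
    have "((\<lambda>x. R (param M i x) i) has_derivative frechet_derivative (\<lambda>x. R (param M i x) i) (at (chart M i (fst w)))) (at (fst ?z))"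
      using vector_field_component_derivative[OF M R wB i] by (simp add: chart_slit)
    from has_derivative_compose[OF has_derivative_fst[OF has_derivative_ident] this]
    have 2: "((\<lambda>x. R (param M i (fst x)) i) has_derivative
      (\<lambda>v. frechet_derivative (\<lambda>x. R (param M i x) i) (at (chart M i (fst w))) (fst v))) (at ?z)" .
    have "((\<lambda>x. fst (Z (param (slit M) i x) i)) has_derivative
      (\<lambda>v. frechet_derivative (\<lambda>x. R (param M i x) i) (at (chart M i (fst w))) (fst v))) (at ?z)"
    proof (subst has_derivative_cong_open[OF O])
      fix x assume "x \<in> ?O"
      then obtain z where z: "z \<in> over M B" "z \<in> cdom (slit M) i" "x = chart (slit M) i z" by auto
      then show "fst (Z (param (slit M) i x) i) = R (param M i (fst x)) i"
        using fun_cong[OF ZR[OF z(1)], of i] ii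
        by (simp add: param_chart[OF SA] fst_chart_slit cdom_slit param_chart[OF M])
    qed (rule 2)
    from fun_cong[OF has_derivative_unique[OF 1 this]] show ?thesis .
  qed
  have bT: "lie_bracket (slit M) X Y w \<in> tangent_space (slit M) w"
    by (rule lie_bracket_tangent[OF SA X Y w])
  have lT: "lie_bracket M U V (fst w) \<in> tangent_space M (fst w)"
    by (rule lie_bracket_tangent[OF M U V wB])
  have "fst (lie_bracket (slit M) X Y w i) = lie_bracket M U V (fst w) i"
    using fun_cong[OF XU[OF w], of i] fun_cong[OF YV[OF w], of i] i ii(3)
    by (simp add: lie_bracket_def key[OF X U XU] key[OF Y V YV])
  then have "(\<lambda>j. fst (lie_bracket (slit M) X Y w j)) = lie_bracket M U V (fst w)"
    by (intro tangent_eqI[OF M tangent_fst[OF M wp bT] lT i])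
  then show ?thesis using vert_endo_imap[OF M wp bT] by simp
qed

section \<open>Horizontal vectors of a second order field\<close>

context
  fixes S :: "('p, 'i, 'e) tpoint \<Rightarrow> ('i, 'e) tvec2"
  assumes S: "vector_field (slit M) (points (slit M)) S"
    and spray_semispray: "\<forall>w\<in>points (slit M). \<forall>i. fst (S w i) = snd w i"
begin

lemma spray_derivative:
  assumes w: "w \<in> points (slit M)" and i: "i \<in> charts_at M (fst w)"
  shows "((\<lambda>z. S (param (slit M) i z) i) has_derivative
      frechet_derivative (\<lambda>z. S (param (slit M) i z) i) (at (chart (slit M) i w))) (at (chart (slit M) i w))"
  using vector_field_component_derivative[OF slit_atlas[OF M] S w] i w by (simp add: charts_at_slit)

lemma spray_derivative_fst:
  assumes w: "w \<in> points (slit M)" and i: "i \<in> charts_at M (fst w)"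
  shows "fst (frechet_derivative (\<lambda>z. S (param (slit M) i z) i) (at (chart (slit M) i w)) v) = snd v"
proof -
  have ii: "i \<in> index M" "fst w \<in> cdom M i" using i by (auto simp: charts_at_def)
  let ?z = "chart (slit M) i w" and ?O = "chart (slit M) i ` (points (slit M) \<inter> cdom (slit M) i)"
  have O: "open ?O" "?z \<in> ?O"
    using smooth_on_slit_chart(1)[OF M openin_mtop_points[OF slit_atlas[OF M]] ii(1)] w ii
    by (auto simp: cdom_slit points_slit)
  have 1: "((\<lambda>z. fst (S (param (slit M) i z) i)) has_derivative
     (\<lambda>v. fst (frechet_derivative (\<lambda>z. S (param (slit M) i z) i) (at ?z) v))) (at ?z)"
    by (intro has_derivative_fst spray_derivative w i)
  have "((\<lambda>z. fst (S (param (slit M) i z) i)) has_derivative snd) (at ?z)"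
  proof (subst has_derivative_cong_open[OF O])
    fix x assume "x \<in> ?O"
    then show "fst (S (param (slit M) i x) i) = snd x"
      using ii by (auto simp: param_chart[OF slit_atlas[OF M]] spray_semispray snd_chart_slit)
  qed (auto intro!: derivative_eq_intros)
  from fun_cong[OF has_derivative_unique[OF 1 this]] show ?thesis .
qed

text \<open>Let \<open>Y\<close> have components (a, b) in the chart. As the base part of
  \<open>S\<close> is the fibre coordinate, J[S, Y] is (0, da(S) - b), and [S, JY] is (-a, da(S) -
  s(a)) with s = \<open>spray_coeff M S i w\<close>. The derivative of \<open>Y\<close> cancels in
  the difference, which therefore depends on \<open>Y w\<close> only.\<close>

lemma canonical_bracket:
  assumes w: "w \<in> A" and i: "i \<in> charts_at M (fst w)" and Y: "vector_field (slit M) A Y"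
  defines "R \<equiv> vert_endo M w (lie_bracket (slit M) S Y w) - lie_bracket (slit M) S (\<lambda>z. vert_endo M z (Y z)) w"
  shows "R \<in> tangent_space (slit M) w"
    and "R i = (fst (Y w i), spray_coeff M S i w (fst (Y w i)) - snd (Y w i))"
proof -
  note SA = slit_atlas[OF M]
  let ?JY = "\<lambda>z. vert_endo M z (Y z)"
  have A: "openin (mtop (slit M)) A" using Y by (simp add: vector_field_def)
  have Ap: "A \<subseteq> points (slit M)" using slit_field_points[OF M Y] by blast
  then have wp: "w \<in> points (slit M)" using w by blast
  have SAf: "vector_field (slit M) A S" by (rule vector_field_subset[OF SA S A Ap])
  have JY: "vector_field (slit M) A ?JY"
    using vertical_section_vert_endo[OF M Y] by (simp add: vertical_section_def)
  have b1: "lie_bracket (slit M) S Y w \<in> tangent_space (slit M) w" by (rule lie_bracket_tangent[OF SA SAf Y w])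
  have b2: "lie_bracket (slit M) S ?JY w \<in> tangent_space (slit M) w" by (rule lie_bracket_tangent[OF SA SAf JY w])
  have "vert_endo M w (lie_bracket (slit M) S Y w) \<in> tangent_space (slit M) w"
    using vert_endo_vertical[OF M wp b1] by (simp add: vertical_def)
  then show "R \<in> tangent_space (slit M) w" unfolding R_def by (rule tangent_diff[OF SA _ b2])
  have ii: "i \<in> index M" "fst w \<in> cdom M i" "i \<in> charts_at (slit M) w"
    using i wp by (auto simp: charts_at_def cdom_slit points_slit)
  let ?z = "chart (slit M) i w" and ?O = "chart (slit M) i ` (A \<inter> cdom (slit M) i)"
  have O: "open ?O" "?z \<in> ?O"
    using smooth_on_slit_chart(1)[OF M A ii(1)] w wp ii by (auto simp: cdom_slit points_slit)
  let ?dY = "frechet_derivative (\<lambda>x. Y (param (slit M) i x) i) (at ?z)"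
  have "((\<lambda>x. (0::'e, fst (Y (param (slit M) i x) i))) has_derivative (\<lambda>v. (0, fst (?dY v)))) (at ?z)"
    by (intro has_derivative_Pair has_derivative_const has_derivative_fst
        vector_field_component_derivative[OF SA Y w ii(3)])
  then have "((\<lambda>x. ?JY (param (slit M) i x) i) has_derivative (\<lambda>v. (0, fst (?dY v)))) (at ?z)"
  proof (subst has_derivative_cong_open[OF O])
    fix x assume "x \<in> ?O"
    then obtain z where z: "z \<in> A" "z \<in> cdom (slit M) i" "x = chart (slit M) i z" by auto
    then show "?JY (param (slit M) i x) i = (0, fst (Y (param (slit M) i x) i))"
      using ii vert_endo_eq[OF M slit_field_points[OF M Y] vector_field_tangent[OF SA Y], of z]
      by (simp add: param_chart[OF SA])
  qed
  note dJY = frechet_derivativeI[OF this]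
  have JYw: "?JY w i = (0, fst (Y w i))"
    using vert_endo_eq[OF M wp vector_field_tangent[OF SA Y w]] by simp
  show "R i = (fst (Y w i), spray_coeff M S i w (fst (Y w i)) - snd (Y w i))"
    unfolding R_def using ii(3) spray_derivative_fst[OF wp i]
    by (simp add: vert_endo_eq[OF M wp b1]) (simp add: lie_bracket_def dJY JYw spray_coeff_def prod_eq_iff)
qed

lemma canon_conn_tangent:
  assumes w: "w \<in> points (slit M)" and i: "i \<in> charts_at M (fst w)" and \<xi>: "\<xi> \<in> tangent_space (slit M) w"
  shows "canon_conn M S w \<xi> \<in> tangent_space (slit M) w"
    and "canon_conn M S w \<xi> i = (fst (\<xi> i), spray_coeff M S i w (fst (\<xi> i)) - snd (\<xi> i))"
proof -
  note SA = slit_atlas[OF M]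
  have ii: "i \<in> index (slit M)" "w \<in> cdom (slit M) i" "i \<in> charts_at (slit M) w"
    using i w by (auto simp: charts_at_def cdom_slit points_slit)
  define \<eta> where "\<eta> = coord_vec (slit M) i w (fst (\<xi> i), spray_coeff M S i w (fst (\<xi> i)) - snd (\<xi> i))"
  have \<eta>: "\<eta> \<in> tangent_space (slit M) w"
    "\<eta> i = (fst (\<xi> i), spray_coeff M S i w (fst (\<xi> i)) - snd (\<xi> i))"
    unfolding \<eta>_def using coord_vec_tangent[OF SA ii(3)] coord_vec_same[OF SA ii(3)] by auto
  have "canon_conn M S w \<xi> = \<eta>"
    unfolding canon_conn_def
  proof (rule the_equality)
    show "\<forall>A Y. vector_field (slit M) A Y \<and> w \<in> A \<and> Y w = \<xi> \<longrightarrow>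
      \<eta> = vert_endo M w (lie_bracket (slit M) S Y w) - lie_bracket (slit M) S (\<lambda>z. vert_endo M z (Y z)) w"
    proof (intro allI impI, elim conjE)
      fix A Y assume *: "vector_field (slit M) A Y" "w \<in> A" "Y w = \<xi>"
      show "\<eta> = vert_endo M w (lie_bracket (slit M) S Y w) - lie_bracket (slit M) S (\<lambda>z. vert_endo M z (Y z)) w"
        using canonical_bracket[OF *(2) i *(1)] *(3) \<eta> by (intro tangent_eqI[OF SA _ _ ii(3)]) auto
    qed
  next
    fix \<eta>' assume *: "\<forall>A Y. vector_field (slit M) A Y \<and> w \<in> A \<and> Y w = \<xi> \<longrightarrow>
      \<eta>' = vert_endo M w (lie_bracket (slit M) S Y w) - lie_bracket (slit M) S (\<lambda>z. vert_endo M z (Y z)) w"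
    \<comment> \<open>Uniqueness requires that some field takes the value \<open>\<xi>\<close> at
      \<open>w\<close>; otherwise the condition on \<open>\<eta>'\<close> would be vacuous. Constant
      components in one chart provide such a field.\<close>
    let ?Y = "\<lambda>z. coord_vec (slit M) i z (\<xi> i)"
    have Y: "vector_field (slit M) (cdom (slit M) i) ?Y"
      using coord_vec_field[OF SA openin_cdom[OF SA ii(1)] ii(1) order_refl smooth_on_const] .
    have Yw: "?Y w = \<xi>" by (rule coord_vec_component[OF SA \<xi> ii(3)])
    have "\<eta>' = vert_endo M w (lie_bracket (slit M) S ?Y w) - lie_bracket (slit M) S (\<lambda>z. vert_endo M z (?Y z)) w"
      using * Y ii(2) Yw by blast
    then show "\<eta>' = \<eta>"
      using canonical_bracket[OF ii(2) i Y] Yw \<eta> by (intro tangent_eqI[OF SA _ _ ii(3)]) auto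
  qed
  then show "canon_conn M S w \<xi> \<in> tangent_space (slit M) w"
    "canon_conn M S w \<xi> i = (fst (\<xi> i), spray_coeff M S i w (fst (\<xi> i)) - snd (\<xi> i))"
    using \<eta> by auto
qed

text \<open>In the chart, the canonical connection is the map (a, b) to (a, s(a) - b), with s the
  \<open>spray_coeff\<close>; its fixed points satisfy b = s(a)/2.\<close>

lemma horizontal_iff:
  assumes w: "w \<in> points (slit M)" and i: "i \<in> charts_at M (fst w)"
  shows "\<xi> \<in> horizontal M S w \<longleftrightarrow>
    \<xi> \<in> tangent_space (slit M) w \<and> snd (\<xi> i) = (1/2) *\<^sub>R spray_coeff M S i w (fst (\<xi> i))"
proof -
  note SA = slit_atlas[OF M]
  have ii: "i \<in> charts_at (slit M) w" using i w by (simp add: charts_at_slit)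
  have half: "s - b = b \<longleftrightarrow> b = (1/2) *\<^sub>R s" for s b :: 'e
  proof
    assume "s - b = b"
    then have "s = 2 *\<^sub>R b" by (simp add: scaleR_2 algebra_simps)
    then show "b = (1/2) *\<^sub>R s" by simp
  next
    assume "b = (1/2) *\<^sub>R s"
    moreover have "s = (1/2) *\<^sub>R s + (1/2) *\<^sub>R s" by (simp flip: scaleR_add_left)
    ultimately show "s - b = b" by (metis add_diff_cancel)
  qed
  show ?thesis
    using canon_conn_tangent[OF w i, of \<xi>] tangent_eqI[OF SA _ _ ii, of "canon_conn M S w \<xi>" \<xi>]
      half[of "spray_coeff M S i w (fst (\<xi> i))" "snd (\<xi> i)"]
    by (auto simp: horizontal_def prod_eq_iff)
qed

lemma hor_lift_props:
  assumes w: "w \<in> points (slit M)" and u: "u \<in> tangent_space M (fst w)"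
  shows "hor_lift M S w u \<in> horizontal M S w" "(\<lambda>j. fst (hor_lift M S w u j)) = u"
proof -
  note SA = slit_atlas[OF M]
  obtain i where i: "i \<in> charts_at M (fst w)" using chart_at_in[OF M] w by (auto simp: points_slit)
  have ii: "i \<in> charts_at (slit M) w" using i w by (simp add: charts_at_slit)
  have dp: "dproj M w \<xi> = (\<lambda>j. fst (\<xi> j))" if "\<xi> \<in> horizontal M S w" for \<xi>
    using dproj_eq[OF M w] that by (simp add: horizontal_def)
  have "\<exists>!\<xi>. \<xi> \<in> horizontal M S w \<and> dproj M w \<xi> = u"
  proof (rule ex1I)
    define \<eta> where "\<eta> = coord_vec (slit M) i w (u i, (1/2) *\<^sub>R spray_coeff M S i w (u i))"
    have \<eta>: "\<eta> \<in> tangent_space (slit M) w" "\<eta> i = (u i, (1/2) *\<^sub>R spray_coeff M S i w (u i))"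
      unfolding \<eta>_def using coord_vec_tangent[OF SA ii] coord_vec_same[OF SA ii] by auto
    have h: "\<eta> \<in> horizontal M S w" using \<eta> by (simp add: horizontal_iff[OF w i])
    have "dproj M w \<eta> = u"
      using tangent_eqI[OF M tangent_fst[OF M w \<eta>(1)] u i] \<eta> by (simp add: dp[OF h])
    then show "\<eta> \<in> horizontal M S w \<and> dproj M w \<eta> = u" using h by simp
    fix \<xi> assume \<xi>: "\<xi> \<in> horizontal M S w \<and> dproj M w \<xi> = u"
    then have "fst (\<xi> i) = u i" using dp by auto
    then show "\<xi> = \<eta>"
      using \<xi> \<eta> by (intro tangent_eqI[OF SA _ _ ii]) (auto simp: horizontal_iff[OF w i] prod_eq_iff)
  qed
  from theI'[OF this] show "hor_lift M S w u \<in> horizontal M S w" "(\<lambda>j. fst (hor_lift M S w u j)) = u"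
    using dp unfolding hor_lift_def by auto
qed

lemma hor_lift_tangent:
  "w \<in> points (slit M) \<Longrightarrow> u \<in> tangent_space M (fst w) \<Longrightarrow> hor_lift M S w u \<in> tangent_space (slit M) w"
  using hor_lift_props(1) by (simp add: horizontal_def)

lemma hor_lift_component:
  assumes w: "w \<in> points (slit M)" and u: "u \<in> tangent_space M (fst w)" and i: "i \<in> charts_at M (fst w)"
  shows "hor_lift M S w u i = (u i, (1/2) *\<^sub>R spray_coeff M S i w (u i))"
  using hor_lift_props(1)[OF w u] fun_cong[OF hor_lift_props(2)[OF w u], of i]
  by (simp add: horizontal_iff[OF w i] prod_eq_iff)

lemma hor_proj_eq:
  assumes w: "w \<in> points (slit M)" and \<xi>: "\<xi> \<in> tangent_space (slit M) w"
  shows "hor_proj M S w \<xi> = hor_lift M S w (\<lambda>j. fst (\<xi> j))"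
  unfolding hor_proj_def
proof (rule the_equality)
  note SA = slit_atlas[OF M]
  let ?u = "\<lambda>j. fst (\<xi> j)"
  have u: "?u \<in> tangent_space M (fst w)" by (rule tangent_fst[OF M w \<xi>])
  show "hor_lift M S w ?u \<in> horizontal M S w \<and> \<xi> - hor_lift M S w ?u \<in> vertical M w"
    using hor_lift_props[OF w u] tangent_diff[OF SA \<xi> hor_lift_tangent[OF w u]]
    by (auto simp: vertical_iff[OF M w] fun_eq_iff)
  fix \<eta> assume \<eta>: "\<eta> \<in> horizontal M S w \<and> \<xi> - \<eta> \<in> vertical M w"
  obtain i where i: "i \<in> charts_at M (fst w)" using chart_at_in[OF M] w by (auto simp: points_slit)
  have ii: "i \<in> charts_at (slit M) w" using i w by (simp add: charts_at_slit)
  have "fst (\<eta> i) = fst (\<xi> i)" using \<eta> by (auto simp: vertical_iff[OF M w])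
  then show "\<eta> = hor_lift M S w ?u"
    using \<eta> hor_lift_component[OF w u i] hor_lift_tangent[OF w u]
    by (intro tangent_eqI[OF SA _ _ ii]) (auto simp: horizontal_iff[OF w i] prod_eq_iff)
qed

text \<open>Horizontal lifts are definite descriptions made point by point. Smoothness is read off
  from their components, in which \<open>spray_coeff\<close> is a derivative of the smooth
  components of \<open>S\<close>.\<close>

lemma hor_lift_field:
  assumes U: "vector_field M B U"
  shows "vector_field (slit M) (over M B) (\<lambda>z. hor_lift M S z (U (fst z)))"
  unfolding vector_field_def
proof (intro conjI ballI)
  note SA = slit_atlas[OF M]
  show A: "openin (mtop (slit M)) (over M B)" using U openin_over[OF M] by (auto simp: vector_field_def)
  fix w assume "w \<in> over M B"
  then show "hor_lift M S w (U (fst w)) \<in> tangent_space (slit M) w"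
    using U by (intro hor_lift_tangent) (auto simp: over_def vector_field_def)
next
  note SA = slit_atlas[OF M]
  fix i assume "i \<in> index (slit M)"
  then have i: "i \<in> index M" by simp
  let ?B = "chart (slit M) i ` (over M B \<inter> cdom (slit M) i)"
  let ?P = "chart (slit M) i ` (points (slit M) \<inter> cdom (slit M) i)"
  have A: "openin (mtop (slit M)) (over M B)" using U openin_over[OF M] by (auto simp: vector_field_def)
  note s = smooth_on_slit_chart[OF M A i]
  have P: "open ?P" using smooth_on_slit_chart(1)[OF M openin_mtop_points[OF SA] i] .
  have BM: "open (chart M i ` (B \<inter> cdom M i))" using U i openin_mtop[OF M] by (auto simp: vector_field_def)
  have u: "smooth_on ?B (\<lambda>x. U (param M i (fst x)) i)"
    using i by (intro smooth_on_compose[OF s(1) BM _ s(2) vector_field_smooth[OF M U i]]) (auto simp: slit_image[OF M])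
  have "smooth_on ?B (\<lambda>x. frechet_derivative (\<lambda>z. S (param (slit M) i z) i) (at x) (0, U (param M i (fst x)) i))"
    using i by (intro smooth_on_frechet_compose[OF s(1) P _ smooth_on_ident _ vector_field_smooth[OF SA S]]
        smooth_on_Pair s(1) smooth_on_const u) (auto simp: over_def)
  then have "smooth_on ?B (\<lambda>x. (U (param M i (fst x)) i,
      (1/2) *\<^sub>R snd (frechet_derivative (\<lambda>z. S (param (slit M) i z) i) (at x) (0, U (param M i (fst x)) i))))"
    by (intro smooth_on_Pair s(1) u smooth_on_scaleR smooth_on_const smooth_on_snd)
  then show "smooth_on ?B (\<lambda>x. hor_lift M S (param (slit M) i x) (U (fst (param (slit M) i x))) i)"
  proof (subst smooth_on_cong[OF s(1)])
    fix x assume "x \<in> ?B"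
    then obtain w where w: "w \<in> over M B" "x = chart (slit M) i w" "w \<in> cdom (slit M) i" by auto
    then have iw: "i \<in> charts_at M (fst w)" using i by (simp add: charts_at_def cdom_slit)
    show "hor_lift M S (param (slit M) i x) (U (fst (param (slit M) i x))) i = (U (param M i (fst x)) i,
      (1/2) *\<^sub>R snd (frechet_derivative (\<lambda>z. S (param (slit M) i z) i) (at x) (0, U (param M i (fst x)) i)))"
      using w i U hor_lift_component[OF _ _ iw, of "U (fst w)"]
      by (simp add: param_chart[OF SA] fst_chart_slit cdom_slit param_chart[OF M] over_def vector_field_def spray_coeff_def)
  qed
qed

end

end

section \<open>Linear connections on the vertical bundle\<close>

lemma sum_apply: "(\<Sum>b\<in>I. f b) x = (\<Sum>b\<in>I. f b x)"
  for f :: "'a \<Rightarrow> 'b \<Rightarrow> 'c::comm_monoid_add"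
  by (induction I rule: infinite_finite_induct) auto

lemma vector_field_add:
  assumes M: "smooth_atlas M" and X: "vector_field M A X" and Y: "vector_field M A Y"
  shows "vector_field M A (\<lambda>p. X p + Y p)"
  using X Y tangent_add[OF M] openin_mtop_chart[OF M]
  by (auto simp: vector_field_def intro!: smooth_on_add)

lemma vector_field_scale:
  assumes M: "smooth_atlas M" and f: "smooth_fun M A f" and X: "vector_field M A X"
  shows "vector_field M A (\<lambda>p. f p *\<^sub>R X p)"
  using f X tangent_scale[OF M] openin_mtop_chart[OF M]
  by (auto simp: vector_field_def smooth_fun_def scaleR_fun_def o_def intro!: smooth_on_scaleR)

lemma tderiv_cong:
  assumes M: "smooth_atlas M" and A: "openin (mtop M) A" "p \<in> A" and fg: "\<And>q. q \<in> A \<Longrightarrow> f q = g q"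
  shows "tderiv M f p \<xi> = tderiv M g p \<xi>"
proof -
  define i where "i = chart_at M p"
  have "p \<in> points M" using A openin_mtop[OF M] by blast
  then have i: "i \<in> index M" "p \<in> cdom M i" using chart_at_in[OF M] by (auto simp: i_def charts_at_def)
  have "frechet_derivative (f \<circ> param M i) (at (chart M i p)) = frechet_derivative (g \<circ> param M i) (at (chart M i p))"
    using A i fg by (intro frechet_derivative_cong_open[OF openin_mtop_chart[OF M A(1) i(1)]])
      (auto simp: param_chart[OF M])
  then show ?thesis by (simp add: tderiv_def Let_def i_def)
qed

context
  fixes M :: "('p, 'i, 'e::euclidean_space) atlas"
  assumes M: "smooth_atlas M"
begin

lemma vertical_0: "w \<in> points (slit M) \<Longrightarrow> 0 \<in> vertical M w"
  using tangent_0[OF slit_atlas[OF M]] by (simp add: vertical_iff[OF M])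

lemma vertical_add: "w \<in> points (slit M) \<Longrightarrow> \<xi> \<in> vertical M w \<Longrightarrow> \<eta> \<in> vertical M w \<Longrightarrow> \<xi> + \<eta> \<in> vertical M w"
  using tangent_add[OF slit_atlas[OF M]] by (auto simp: vertical_iff[OF M])

lemma vertical_scale: "w \<in> points (slit M) \<Longrightarrow> \<xi> \<in> vertical M w \<Longrightarrow> c *\<^sub>R \<xi> \<in> vertical M w"
  using tangent_scale[OF slit_atlas[OF M]] by (auto simp: vertical_iff[OF M] scaleR_fun_def)

lemma vertical_section_field: "vertical_section M A Y \<Longrightarrow> vector_field (slit M) A Y"
  by (simp add: vertical_section_def)

lemma vertical_section_vertical: "vertical_section M A Y \<Longrightarrow> w \<in> A \<Longrightarrow> Y w \<in> vertical M w"
  by (simp add: vertical_section_def)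

lemma vertical_section_points: "vertical_section M A Y \<Longrightarrow> w \<in> A \<Longrightarrow> w \<in> points (slit M)"
  using slit_field_points[OF M vertical_section_field] .

lemma vertical_section_zero: "openin (mtop (slit M)) A \<Longrightarrow> vertical_section M A (\<lambda>z. 0)"
  unfolding vertical_section_def
  using vector_field_zero[OF slit_atlas[OF M]] vertical_0 openin_mtop[OF slit_atlas[OF M], of A] by auto

lemma vertical_section_add:
  assumes "vertical_section M A Y" "vertical_section M A Z"
  shows "vertical_section M A (\<lambda>z. Y z + Z z)"
  using assms vector_field_add[OF slit_atlas[OF M]] vertical_add vertical_section_points[OF assms(1)]
  by (auto simp: vertical_section_def)

lemma vertical_section_scale:
  assumes "smooth_fun (slit M) A f" "vertical_section M A Y"
  shows "vertical_section M A (\<lambda>z. f z *\<^sub>R Y z)"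
  using assms vector_field_scale[OF slit_atlas[OF M]] vertical_scale vertical_section_points[OF assms(2)]
  by (auto simp: vertical_section_def)

lemma vertical_section_cong:
  "vertical_section M A Y \<Longrightarrow> (\<And>z. z \<in> A \<Longrightarrow> Z z = Y z) \<Longrightarrow> vertical_section M A Z"
  unfolding vertical_section_def using vector_field_cong[OF slit_atlas[OF M]] by auto

lemma vertical_section_sum:
  assumes "openin (mtop (slit M)) A" "\<And>b. b \<in> I \<Longrightarrow> vertical_section M A (Y b)"
  shows "vertical_section M A (\<lambda>z. \<Sum>b\<in>I. Y b z)"
proof (cases "finite I")
  case True
  then show ?thesis using assms(2)
    by (induction I) (auto intro!: vertical_section_zero vertical_section_add assms(1))
qed (simp add: vertical_section_zero[OF assms(1)])

section \<open>Local dependence of a connection on its section\<close>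

context
  fixes nabla :: "('p, 'i, 'e) vconn"
  assumes nabla: "linear_connection M nabla"
begin

lemma conn_vertical:
  "vertical_section M A Y \<Longrightarrow> w \<in> A \<Longrightarrow> \<xi> \<in> tangent_space (slit M) w \<Longrightarrow> nabla w \<xi> Y \<in> vertical M w"
  using nabla unfolding linear_connection_def by blast

lemma conn_direction:
  "vertical_section M A Y \<Longrightarrow> w \<in> A \<Longrightarrow> \<xi> \<in> tangent_space (slit M) w \<Longrightarrow> \<eta> \<in> tangent_space (slit M) w \<Longrightarrow>
    nabla w (a *\<^sub>R \<xi> + b *\<^sub>R \<eta>) Y = a *\<^sub>R nabla w \<xi> Y + b *\<^sub>R nabla w \<eta> Y"
  using nabla unfolding linear_connection_def by blast

lemma conn_direction_add:
  "vertical_section M A Y \<Longrightarrow> w \<in> A \<Longrightarrow> \<xi> \<in> tangent_space (slit M) w \<Longrightarrow> \<eta> \<in> tangent_space (slit M) w \<Longrightarrow>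
    nabla w (\<xi> + \<eta>) Y = nabla w \<xi> Y + nabla w \<eta> Y"
  using conn_direction[of A Y w \<xi> \<eta> 1 1] by simp

lemma conn_direction_zero:
  "vertical_section M A Y \<Longrightarrow> w \<in> A \<Longrightarrow> nabla w 0 Y = 0"
  using conn_direction[of A Y w 0 0 0 0] tangent_0[OF slit_atlas[OF M]] by simp

lemma conn_add:
  "vertical_section M A Y \<Longrightarrow> vertical_section M A Z \<Longrightarrow> w \<in> A \<Longrightarrow> \<xi> \<in> tangent_space (slit M) w \<Longrightarrow>
    nabla w \<xi> (\<lambda>z. Y z + Z z) = nabla w \<xi> Y + nabla w \<xi> Z"
  using nabla unfolding linear_connection_def by blast

lemma conn_leibniz:
  "vertical_section M A Y \<Longrightarrow> w \<in> A \<Longrightarrow> \<xi> \<in> tangent_space (slit M) w \<Longrightarrow> smooth_fun (slit M) A f \<Longrightarrow>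
    nabla w \<xi> (\<lambda>z. f z *\<^sub>R Y z) = tderiv (slit M) f w \<xi> *\<^sub>R Y w + f w *\<^sub>R nabla w \<xi> Y"
  using nabla unfolding linear_connection_def by blast

lemma conn_cong:
  assumes "vertical_section M A Y" "w \<in> A" "\<xi> \<in> tangent_space (slit M) w" "\<And>z. z \<in> A \<Longrightarrow> Z z = Y z"
  shows "nabla w \<xi> Z = nabla w \<xi> Y"
  using nabla assms vertical_section_cong[OF assms(1,4)] unfolding linear_connection_def by metis

lemma conn_zero:
  assumes "openin (mtop (slit M)) A" "w \<in> A" "\<xi> \<in> tangent_space (slit M) w" "\<And>z. z \<in> A \<Longrightarrow> Z z = 0"
  shows "nabla w \<xi> Z = 0"
proof -
  note z = vertical_section_zero[OF assms(1)]
  have "nabla w \<xi> (\<lambda>z. 0 + 0) = nabla w \<xi> (\<lambda>z. 0) + nabla w \<xi> (\<lambda>z. 0)"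
    by (rule conn_add[OF z z assms(2,3)])
  then show ?thesis using conn_cong[OF z assms(2,3,4)] by simp
qed

lemma conn_sum:
  assumes A: "openin (mtop (slit M)) A" "w \<in> A" "\<xi> \<in> tangent_space (slit M) w"
    and I: "finite I" "\<And>b. b \<in> I \<Longrightarrow> vertical_section M A (Y b)"
  shows "nabla w \<xi> (\<lambda>z. \<Sum>b\<in>I. Y b z) = (\<Sum>b\<in>I. nabla w \<xi> (Y b))"
  using I
proof (induction I)
  case empty
  show ?case unfolding sum.empty by (rule conn_zero[OF A refl])
next
  case (insert b I)
  have Y: "vertical_section M A (Y b)" "\<And>c. c \<in> I \<Longrightarrow> vertical_section M A (Y c)" using insert.prems by auto
  have "vertical_section M A (\<lambda>z. \<Sum>c\<in>I. Y c z)" by (rule vertical_section_sum[OF A(1) Y(2)])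
  moreover have IH: "nabla w \<xi> (\<lambda>z. \<Sum>c\<in>I. Y c z) = (\<Sum>c\<in>I. nabla w \<xi> (Y c))"
    by (rule insert.IH, rule Y(2))
  ultimately have "nabla w \<xi> (\<lambda>z. Y b z + (\<Sum>c\<in>I. Y c z)) = nabla w \<xi> (Y b) + (\<Sum>c\<in>I. nabla w \<xi> (Y c))"
    using conn_add[OF Y(1) _ A(2,3)] by metis
  then show ?case by (simp only: sum.insert[OF insert(1,2)])
qed

text \<open>Expand \<open>Y\<close> in the frame of vertical coordinate fields and apply the Leibniz
  rule to each summand. The chart is \<open>chart_at M (fst w)\<close> because \<open>tderiv\<close>
  differentiates in that chart.\<close>

lemma conn_coordinates:
  assumes Y: "vertical_section M A Y" and w: "w \<in> A" and \<xi>: "\<xi> \<in> tangent_space (slit M) w"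
    and i: "i = chart_at M (fst w)" and Ai: "A \<subseteq> cdom (slit M) i"
  shows "nabla w \<xi> Y = (\<Sum>b\<in>Basis.
    (snd (frechet_derivative (\<lambda>x. Y (param (slit M) i x) i) (at (chart (slit M) i w)) (\<xi> i)) \<bullet> b) *\<^sub>R coord_vec (slit M) i w (0, b)
     + (snd (Y w i) \<bullet> b) *\<^sub>R nabla w \<xi> (\<lambda>z. coord_vec (slit M) i z (0, b)))"
proof -
  note SA = slit_atlas[OF M]
  note Yf = vertical_section_field[OF Y]
  have A: "openin (mtop (slit M)) A" using Yf by (simp add: vector_field_def)
  have pts: "z \<in> points (slit M)" if "z \<in> A" for z using vertical_section_points[OF Y that] .
  have ii: "i \<in> index (slit M)"
    using chart_at_in[OF M, of "fst w"] pts[OF w] by (simp add: i points_slit charts_at_def)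
  have iz: "i \<in> charts_at (slit M) z" "i \<in> charts_at M (fst z)" if "z \<in> A" for z
    using that Ai ii charts_at_slit[OF pts[OF that]] by (auto simp: charts_at_def)
  have img: "A \<inter> cdom (slit M) i = A" using Ai by blast
  have oA: "open (chart (slit M) i ` A)" using openin_mtop_chart[OF SA A ii] img by simp
  define E where "E b z = coord_vec (slit M) i z (0, b)" for b :: 'e and z
  define f where "f b z = snd (Y z i) \<bullet> b" for b :: 'e and z
  have E: "vertical_section M A (E b)" for b
    unfolding vertical_section_def
  proof (intro conjI ballI)
    show "vector_field (slit M) A (E b)" unfolding E_def by (rule coord_vec_field[OF SA A ii Ai smooth_on_const])
    fix z assume z: "z \<in> A"
    show "E b z \<in> vertical M z" unfolding E_def
      using coord_vec_tangent[OF SA iz(1)[OF z]] coord_vec_same[OF SA iz(1)[OF z]] vertical_iff_chart[OF M pts[OF z] iz(2)[OF z]]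
      by simp
  qed
  have f: "smooth_fun (slit M) A (f b)" for b
  proof (rule smooth_fun_chartI[OF SA A ii Ai])
    show "smooth_on (chart (slit M) i ` A) (f b \<circ> param (slit M) i)"
      using vector_field_smooth[OF SA Yf ii] unfolding img f_def o_def
      by (intro smooth_on_inner smooth_on_snd oA)
  qed
  have Yeq: "Y z = (\<Sum>b\<in>Basis. f b z *\<^sub>R E b z)" if z: "z \<in> A" for z
  proof (rule tangent_eqI[OF SA _ _ iz(1)[OF z]])
    show "Y z \<in> tangent_space (slit M) z" using Yf z by (simp add: vector_field_def)
    show "(\<Sum>b\<in>Basis. f b z *\<^sub>R E b z) \<in> tangent_space (slit M) z"
      by (intro tangent_sum[OF SA] tangent_scale[OF SA]) (simp add: E_def coord_vec_tangent[OF SA iz(1)[OF z]])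
    have "fst (Y z i) = 0" using vertical_section_vertical[OF Y z] by (simp add: vertical_iff[OF M pts[OF z]])
    moreover have "(\<Sum>b\<in>Basis. f b z *\<^sub>R E b z) i = (\<Sum>b\<in>Basis. f b z *\<^sub>R (0, b))"
      using coord_vec_same[OF SA iz(1)[OF z]]
      by (simp add: E_def scaleR_fun_def sum_apply)
    ultimately show "Y z i = (\<Sum>b\<in>Basis. f b z *\<^sub>R E b z) i"
      by (simp add: prod_eq_iff fst_sum snd_sum f_def euclidean_representation)
  qed
  have fE: "vertical_section M A (\<lambda>z. f b z *\<^sub>R E b z)" for b by (rule vertical_section_scale[OF f E])
  have td: "tderiv (slit M) (f b) w \<xi> =
      snd (frechet_derivative (\<lambda>x. Y (param (slit M) i x) i) (at (chart (slit M) i w)) (\<xi> i)) \<bullet> b" for b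
  proof -
    have "(f b \<circ> param (slit M) i has_derivative
      (\<lambda>v. snd (frechet_derivative (\<lambda>x. Y (param (slit M) i x) i) (at (chart (slit M) i w)) v) \<bullet> b)) (at (chart (slit M) i w))"
      unfolding f_def o_def
      by (intro has_derivative_inner_left has_derivative_snd vector_field_component_derivative[OF SA Yf w iz(1)[OF w]])
    then show ?thesis using i chart_at_slit[OF pts[OF w]] by (simp add: tderiv_def Let_def frechet_derivativeI)
  qed
  have "nabla w \<xi> Y = nabla w \<xi> (\<lambda>z. \<Sum>b\<in>Basis. f b z *\<^sub>R E b z)"
    by (rule conn_cong[OF vertical_section_sum[OF A fE] w \<xi> Yeq])
  also have "\<dots> = (\<Sum>b\<in>Basis. nabla w \<xi> (\<lambda>z. f b z *\<^sub>R E b z))"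
    by (rule conn_sum[OF A w \<xi> finite_Basis fE])
  also have "\<dots> = (\<Sum>b\<in>Basis. tderiv (slit M) (f b) w \<xi> *\<^sub>R E b w + f b w *\<^sub>R nabla w \<xi> (E b))"
    using conn_leibniz[OF E w \<xi> f] by simp
  finally show ?thesis unfolding td E_def f_def .
qed

text \<open>In the coordinate formula the section enters only through its value at \<open>w\<close>
  and its derivative along \<open>\<xi>\<close>. So sections that agree to first order in a single
  direction can be compared, without agreement on an open set.\<close>

lemma conn_jet:
  assumes Y: "vertical_section M A Y" and Z: "vertical_section M A Z"
    and w: "w \<in> A" and \<xi>: "\<xi> \<in> tangent_space (slit M) w" and i: "i = chart_at M (fst w)"
    and 0: "Y w = Z w"
    and 1: "frechet_derivative (\<lambda>x. Y (param (slit M) i x) i) (at (chart (slit M) i w)) (\<xi> i) =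
      frechet_derivative (\<lambda>x. Z (param (slit M) i x) i) (at (chart (slit M) i w)) (\<xi> i)"
  shows "nabla w \<xi> Y = nabla w \<xi> Z"
proof -
  note SA = slit_atlas[OF M]
  have wp: "w \<in> points (slit M)" using vertical_section_points[OF Y w] .
  have ii: "i \<in> index (slit M)" "w \<in> cdom (slit M) i"
    using chart_at_in[OF M, of "fst w"] wp by (auto simp: i points_slit charts_at_def cdom_slit)
  have A: "openin (mtop (slit M)) A" using Y by (simp add: vertical_section_def vector_field_def)
  have B: "openin (mtop (slit M)) (A \<inter> cdom (slit M) i)" using A openin_cdom[OF SA ii(1)] by (rule openin_Int)
  have w': "w \<in> A \<inter> cdom (slit M) i" using w ii by simp
  show ?thesis
    unfolding conn_coordinates[OF vertical_section_subset[OF M Y B Int_lower1] w' \<xi> i Int_lower2]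
      conn_coordinates[OF vertical_section_subset[OF M Z B Int_lower1] w' \<xi> i Int_lower2] 0 1 ..
qed

text \<open>The vertical endomorphism turns a field over \<open>U\<close> into the vertical lift of
  \<open>U\<close>, whatever its fibre part. Thus each term of the torsion is expressed by data on
  the base.\<close>

lemma torsion_projectable:
  assumes X: "vector_field (slit M) (over M B) X" and Y: "vector_field (slit M) (over M B) Y"
    and U: "vector_field M B U" and V: "vector_field M B V"
    and XU: "\<And>z. z \<in> over M B \<Longrightarrow> (\<lambda>j. fst (X z j)) = U (fst z)"
    and YV: "\<And>z. z \<in> over M B \<Longrightarrow> (\<lambda>j. fst (Y z j)) = V (fst z)"
    and w: "w \<in> over M B"
  shows "torsion M nabla X Y w = nabla w (X w) (vert_lift M V) - nabla w (Y w) (vert_lift M U)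
    - imap M w (lie_bracket M U V (fst w))"
proof -
  note SA = slit_atlas[OF M]
  have ve: "vert_endo M z (X z) = vert_lift M U z" "vert_endo M z (Y z) = vert_lift M V z" if "z \<in> over M B" for z
    using vert_endo_imap[OF M over_points[OF that] vector_field_tangent[OF SA X that]]
      vert_endo_imap[OF M over_points[OF that] vector_field_tangent[OF SA Y that]] XU[OF that] YV[OF that]
    by (simp_all add: vert_lift_def)
  have "nabla w (X w) (\<lambda>z. vert_endo M z (Y z)) = nabla w (X w) (vert_lift M V)"
    by (rule conn_cong[OF vertical_section_vert_lift[OF M V] w vector_field_tangent[OF SA X w] ve(2)])
  moreover have "nabla w (Y w) (\<lambda>z. vert_endo M z (X z)) = nabla w (Y w) (vert_lift M U)"
    by (rule conn_cong[OF vertical_section_vert_lift[OF M U] w vector_field_tangent[OF SA Y w] ve(1)])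
  moreover have "vert_endo M w (lie_bracket (slit M) X Y w) = imap M w (lie_bracket M U V (fst w))"
    by (rule bracket_projectable[OF M X Y U V XU YV w])
  ultimately show ?thesis by (simp only: torsion_def)
qed

text \<open>A vertical field projects to the zero field, so the bracket term and the second
  covariant derivative drop out. Information on the torsion thereby becomes information on
  derivatives in vertical directions.\<close>

lemma torsion_vertical:
  assumes X: "vector_field (slit M) (over M B) X" and Y: "vector_field (slit M) (over M B) Y"
    and V: "vector_field M B V"
    and X0: "\<And>z. z \<in> over M B \<Longrightarrow> X z \<in> vertical M z"
    and YV: "\<And>z. z \<in> over M B \<Longrightarrow> (\<lambda>j. fst (Y z j)) = V (fst z)"
    and w: "w \<in> over M B"
  shows "torsion M nabla X Y w = nabla w (X w) (vert_lift M V)"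
proof -
  note SA = slit_atlas[OF M]
  have B: "openin (mtop M) B" using V by (simp add: vector_field_def)
  note 0 = vector_field_zero[OF M B]
  have wB: "fst w \<in> B" "w \<in> points (slit M)" using w by (auto simp: over_def)
  have "(\<lambda>j. fst (X z j)) = 0" if "z \<in> over M B" for z
    using X0[OF that] vertical_iff[OF M over_points[OF that]] by auto
  then have "torsion M nabla X Y w = nabla w (X w) (vert_lift M V) - nabla w (Y w) (vert_lift M (\<lambda>p. 0))
    - imap M w (lie_bracket M (\<lambda>p. 0) V (fst w))"
    by (intro torsion_projectable[OF X Y 0 V _ YV w])
  moreover have "nabla w (Y w) (vert_lift M (\<lambda>p. 0)) = 0"
  proof (rule conn_zero[OF openin_over[OF M B] w vector_field_tangent[OF SA Y w]])
    fix z assume "z \<in> over M B"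
    then show "vert_lift M (\<lambda>p. 0) z = 0"
      using vert_lift_eq[OF M over_points, of z B "\<lambda>p. 0"] tangent_0[OF M] by (auto simp: fun_eq_iff zero_prod_def)
  qed
  moreover have "imap M w 0 = 0" using imap_eq[OF M wB(2) tangent_0[OF M]] by (auto simp: fun_eq_iff zero_prod_def)
  ultimately show ?thesis by (simp add: lie_bracket_zero[OF M V wB(1)])
qed

lemma nabla_metric_vert_lift:
  assumes T: "vector_field M B T" and V: "vector_field M B V" and w: "w \<in> over M B"
  shows "nabla_metric M F nabla X (vert_lift M T) (vert_lift M V) w =
    tderiv (slit M) (\<lambda>z. fund_tensor F z (T (fst z)) (V (fst z))) w (X w)
    - fund_tensor F w (imap_inv M w (nabla w (X w) (vert_lift M T))) (V (fst w))
    - fund_tensor F w (T (fst w)) (imap_inv M w (nabla w (X w) (vert_lift M V)))"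
proof -
  have inv: "imap_inv M z (vert_lift M R z) = R (fst z)" if "vector_field M B R" "z \<in> over M B" for R z
    using that imap_inv_imap[OF M over_points[OF that(2)]] by (auto simp: vert_lift_def over_def vector_field_def)
  have "tderiv (slit M) (\<lambda>z. fund_vert M F z (vert_lift M T z) (vert_lift M V z)) w (X w) =
    tderiv (slit M) (\<lambda>z. fund_tensor F z (T (fst z)) (V (fst z))) w (X w)"
    using inv[OF T] inv[OF V] T openin_over[OF M]
    by (intro tderiv_cong[OF slit_atlas[OF M] _ w]) (auto simp: fund_vert_def vector_field_def)
  then show ?thesis by (simp add: nabla_metric_def fund_vert_def inv[OF T w] inv[OF V w])
qed

end

end

section \<open>Lifts of the canonical connection\<close>

context
  fixes M :: "('p, 'i, 'e::euclidean_space) atlas" and F S and nabla :: "('p, 'i, 'e) vconn"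
  assumes M: "smooth_atlas M" and F: "finsler_metric M F" and G: "geodesic_spray M F S"
    and nabla: "linear_connection M nabla"
begin

lemma spray_field: "vector_field (slit M) (points (slit M)) S"
  using G by (simp add: geodesic_spray_def)

lemma spray_semispray: "\<forall>w\<in>points (slit M). \<forall>i. fst (S w i) = snd w i"
  using spray_second_order[OF M F G] by blast

lemmas hor_tangent = hor_lift_tangent[OF M spray_field spray_semispray]
lemmas hor_fst = hor_lift_props(2)[OF M spray_field spray_semispray]
lemmas hor_field = hor_lift_field[OF M spray_field spray_semispray]

lemma field_tangent: "vector_field M B U \<Longrightarrow> w \<in> over M B \<Longrightarrow> U (fst w) \<in> tangent_space M (fst w)"
  by (simp add: over_def vector_field_def)

lemma imap_zero: "w \<in> points (slit M) \<Longrightarrow> imap M w 0 = 0"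
  using imap_eq[OF M _ tangent_0[OF M]] by (auto simp: fun_eq_iff zero_prod_def)

section \<open>Symmetry of the affine connections\<close>

lemma horizontal_torsion:
  assumes T: "T2 M S nabla \<or> T3 M nabla" and U: "vector_field M B U" and V: "vector_field M B V" and w: "w \<in> over M B"
  shows "nabla w (hor_lift M S w (U (fst w))) (vert_lift M V) - nabla w (hor_lift M S w (V (fst w))) (vert_lift M U)
    = imap M w (lie_bracket M U V (fst w))"
proof -
  have proj: "hor_proj M S z (hor_lift M S z (R (fst z))) = hor_lift M S z (R (fst z))"
    if "vector_field M B R" "z \<in> over M B" for R z
    using hor_proj_eq[OF M spray_field spray_semispray over_points[OF that(2)] hor_tangent[OF over_points[OF that(2)] field_tangent[OF that]]]
      hor_fst[OF over_points[OF that(2)] field_tangent[OF that]] by simp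
  \<comment> \<open>(T3) applies to the horizontal lifts themselves, but (T2) to their horizontal
    projections, which are known to be the same only over \<open>B\<close>. So the torsion is
    computed for any \<open>X\<close> and \<open>Y\<close> that coincide with the lifts
    there.\<close>
  have *: "torsion M nabla X Y w = nabla w (hor_lift M S w (U (fst w))) (vert_lift M V)
      - nabla w (hor_lift M S w (V (fst w))) (vert_lift M U) - imap M w (lie_bracket M U V (fst w))"
    if X: "\<And>z. z \<in> over M B \<Longrightarrow> X z = hor_lift M S z (U (fst z))"
      and Y: "\<And>z. z \<in> over M B \<Longrightarrow> Y z = hor_lift M S z (V (fst z))" for X Y
  proof -
    have "torsion M nabla X Y w = nabla w (X w) (vert_lift M V) - nabla w (Y w) (vert_lift M U)
        - imap M w (lie_bracket M U V (fst w))"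
    proof (rule torsion_projectable[OF M nabla _ _ U V _ _ w])
      show "vector_field (slit M) (over M B) X" "vector_field (slit M) (over M B) Y"
        using vector_field_cong[OF slit_atlas[OF M] hor_field] U V X Y by auto
    qed (simp_all add: X Y hor_fst over_points field_tangent[OF U] field_tangent[OF V])
    then show ?thesis by (simp add: X[OF w] Y[OF w])
  qed
  let ?X = "\<lambda>z. hor_lift M S z (U (fst z))" and ?Y = "\<lambda>z. hor_lift M S z (V (fst z))"
  have "\<exists>X Y. torsion M nabla X Y w = 0 \<and> (\<forall>z\<in>over M B. X z = ?X z) \<and> (\<forall>z\<in>over M B. Y z = ?Y z)"
    using T
  proof
    assume "T2 M S nabla"
    then have "torsion M nabla (\<lambda>z. hor_proj M S z (?X z)) (\<lambda>z. hor_proj M S z (?Y z)) w = 0"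
      using hor_field[OF U] hor_field[OF V] w unfolding T2_def by blast
    then show ?thesis
      using proj[OF U] proj[OF V] by (intro exI[of _ "\<lambda>z. hor_proj M S z (?X z)"] exI[of _ "\<lambda>z. hor_proj M S z (?Y z)"]) auto
  next
    assume "T3 M nabla"
    then have "torsion M nabla ?X ?Y w = 0"
      using hor_field[OF U] hor_field[OF V] w unfolding T3_def by blast
    then show ?thesis by blast
  qed
  then obtain X Y where XY: "torsion M nabla X Y w = 0"
    "\<And>z. z \<in> over M B \<Longrightarrow> X z = ?X z" "\<And>z. z \<in> over M B \<Longrightarrow> Y z = ?Y z" by blast
  show ?thesis using *[of X Y] XY by simp
qed

lemma aff_symmetric:
  assumes T: "T2 M S nabla \<or> T3 M nabla" and U: "vector_field M Q U" and V: "vector_field M Q V"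
    and W: "vector_field M Q W" and p: "p \<in> Q" "W p \<noteq> 0"
  shows "aff M S nabla W U V p - aff M S nabla W V U p = lie_bracket M U V p"
proof -
  have pM: "p \<in> points M" using p U openin_mtop[OF M] by (auto simp: vector_field_def)
  have w: "(p, W p) \<in> over M Q" "(p, W p) \<in> points (slit M)"
    using p pM W by (auto simp: over_def points_slit vector_field_def)
  have v: "nabla (p, W p) (hor_lift M S (p, W p) (X p)) (vert_lift M Y) \<in> vertical M (p, W p)"
    if "vector_field M Q X" "vector_field M Q Y" for X Y
    using that w hor_tangent[OF w(2)] field_tangent[OF that(1) w(1)]
    by (intro conn_vertical[OF M nabla vertical_section_vert_lift[OF M]]) auto
  have l: "lie_bracket M U V p \<in> tangent_space M p" by (rule lie_bracket_tangent[OF M U V p(1)])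
  show ?thesis
    using horizontal_torsion[OF T U V w(1)] imap_inv_imap[OF M w(2)] l
    by (simp add: aff_def aff_vec_def imap_inv_diff[OF M w(2) v[OF U V] v[OF V U], symmetric])
qed

definition const_field :: "'i \<Rightarrow> 'p \<Rightarrow> ('i \<Rightarrow> 'e) \<Rightarrow> 'p \<Rightarrow> 'i \<Rightarrow> 'e"
  where "const_field i p n = (\<lambda>q. coord_vec M i q (n i))"

section \<open>Covariant derivatives in vertical directions\<close>

context
  fixes B i
  assumes B: "openin (mtop M) B" and i: "i \<in> index M" "B \<subseteq> cdom M i"
begin

lemma const_field: "vector_field M B (const_field i p n)"
  unfolding const_field_def by (rule coord_vec_field[OF M B i smooth_on_const])

lemma const_field_at: "p \<in> B \<Longrightarrow> n \<in> tangent_space M p \<Longrightarrow> const_field i p n p = n"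
  unfolding const_field_def using i by (intro coord_vec_component[OF M]) (auto simp: charts_at_def)

lemma vert_lift_const_field: "w \<in> over M B \<Longrightarrow> n \<in> tangent_space M (fst w) \<Longrightarrow>
    vert_lift M (const_field i (fst w) n) w = imap M w n"
  by (simp add: vert_lift_def const_field_at over_def)

text \<open>The torsion of a vertical field through \<open>imap M w n\<close> and the horizontal
  lift of \<open>V\<close> is exactly this covariant derivative.\<close>

lemma vertical_derivative_T3:
  assumes T: "T3 M nabla" and w: "w \<in> over M B" and n: "n \<in> tangent_space M (fst w)" and V: "vector_field M B V"
  shows "nabla w (imap M w n) (vert_lift M V) = 0"
proof -
  let ?X = "vert_lift M (const_field i (fst w) n)" and ?Y = "\<lambda>z. hor_lift M S z (V (fst z))"
  have X: "vertical_section M (over M B) ?X" by (rule vertical_section_vert_lift[OF M const_field])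
  have "torsion M nabla ?X ?Y w = nabla w (?X w) (vert_lift M V)"
    using vertical_section_vertical[OF M X] hor_fst[OF over_points field_tangent[OF V]]
    by (intro torsion_vertical[OF M nabla vertical_section_field[OF M X] hor_field[OF V] V _ _ w]) auto
  moreover have "torsion M nabla ?X ?Y w = 0"
    using T vertical_section_field[OF M X] hor_field[OF V] w unfolding T3_def by blast
  ultimately show ?thesis by (simp add: vert_lift_const_field[OF w n])
qed

text \<open>(M4) carries no explicit value for \<open>C'(0, \<cdot>, \<cdot>)\<close>; that it vanishes is obtained from (M4) itself
  in the direction \<open>0\<close>.\<close>

lemma nabla_metric_vertical:
  assumes MM: "M6 M F nabla \<or> M4 M F S nabla" and w: "w \<in> over M B" and n: "n \<in> tangent_space M (fst w)"
    and T: "vector_field M B T" and V: "vector_field M B V"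
  shows "nabla_metric M F nabla (vert_lift M (const_field i (fst w) n)) (vert_lift M T) (vert_lift M V) w = 0"
  using MM
proof
  note TV = vertical_section_vert_lift[OF M T] vertical_section_vert_lift[OF M V]
  have X: "vertical_section M (over M B) (vert_lift M (const_field i (fst w) n))"
    by (rule vertical_section_vert_lift[OF M const_field])
  note Xf = vertical_section_field[OF M X]
  {
    assume "M6 M F nabla"
    then show ?thesis using Xf TV w unfolding M6_def by blast
  next
    assume M4: "M4 M F S nabla"
    note SA = slit_atlas[OF M]
    have wp: "w \<in> points (slit M)" by (rule over_points[OF w])
    have oB: "openin (mtop (slit M)) (over M B)" by (rule openin_over[OF M B])
    have Tw: "T (fst w) \<in> tangent_space M (fst w)" "V (fst w) \<in> tangent_space M (fst w)"
      using field_tangent[OF T w] field_tangent[OF V w] by auto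
    have t0: "0 \<in> tangent_space M (fst w)" by (rule tangent_0[OF M])
    have i0: "imap_inv M w 0 = 0" using imap_inv_imap[OF M wp t0] by (simp add: imap_zero[OF wp])
    have f0: "fund_tensor F w 0 v = 0" "fund_tensor F w v 0 = 0" if "v \<in> tangent_space M (fst w)" for v
      using fund_tensor_add_left[OF M F wp that t0 t0] fund_tensor_add_right[OF M F wp that t0 t0] by simp_all
    \<comment> \<open>The right side of (M4) sees the direction only through its image under the
      vertical endomorphism, which kills vertical vectors. So the zero field gives the same value,
      and there the left side vanishes by linearity in the direction.\<close>
    have "vert_endo M w (vert_lift M (const_field i (fst w) n) w) = vert_endo M w 0"
      using vertical_section_vertical[OF M X w] tangent_0[OF SA]
      by (simp add: vert_endo_eq[OF M wp] vertical_iff[OF M wp])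
    then have "nabla_metric M F nabla (vert_lift M (const_field i (fst w) n)) (vert_lift M T) (vert_lift M V) w =
      nabla_metric M F nabla (\<lambda>z. 0) (vert_lift M T) (vert_lift M V) w"
      using M4 Xf vector_field_zero[OF SA oB] TV w unfolding M4_def by metis
    also have "\<dots> = tderiv (slit M) (\<lambda>z. fund_tensor F z (T (fst z)) (V (fst z))) w 0"
      unfolding nabla_metric_vert_lift[OF M nabla T V w]
      using Tw by (simp add: conn_direction_zero[OF M nabla TV(1) w] conn_direction_zero[OF M nabla TV(2) w] i0 f0)
    also have "\<dots> = 0"
    proof -
      define j where "j = chart_at M (fst w)"
      have j: "j \<in> index M" "w \<in> cdom (slit M) j"
        using chart_at_in[OF M, of "fst w"] wp by (auto simp: j_def points_slit charts_at_def cdom_slit)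
      have "linear (frechet_derivative ((\<lambda>z. fund_tensor F z (T (fst z)) (V (fst z))) \<circ> param (slit M) j) (at (chart (slit M) j w)))"
        using w j by (intro smooth_on_linear[OF fund_tensor_fields_smooth[OF M F T V j(1)]]) auto
      from linear_0[OF this] show ?thesis
        by (simp add: tderiv_def Let_def chart_at_slit[OF wp] j_def)
    qed
    finally show ?thesis .
  }
qed

lemma vertical_derivative_M7:
  assumes M7: "M7 M F nabla" and MM: "M6 M F nabla \<or> M4 M F S nabla"
    and w: "w \<in> over M B" and n: "n \<in> tangent_space M (fst w)"
    and T: "vector_field M B T" and V: "vector_field M B V"
  shows "fund_tensor F w (imap_inv M w (nabla w (imap M w n) (vert_lift M T))) (V (fst w)) =
    cartan_tensor F w n (T (fst w)) (V (fst w))"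
proof -
  note SA = slit_atlas[OF M]
  have wp: "w \<in> points (slit M)" by (rule over_points[OF w])
  let ?N = "const_field i (fst w) n"
  define g where "g T V = fund_tensor F w (imap_inv M w (nabla w (imap M w n) (vert_lift M T))) (V (fst w))" for T V
  have N: "?N (fst w) = n" using w n by (intro const_field_at) (auto simp: over_def)
  have it: "imap M w n \<in> tangent_space (slit M) w" using imap_vertical[OF M wp n] by (simp add: vertical_def)
  have D: "imap_inv M w (nabla w (imap M w n) (vert_lift M R)) \<in> tangent_space M (fst w)" if "vector_field M B R" for R
    by (intro imap_inv_vertical[OF M wp] conn_vertical[OF M nabla vertical_section_vert_lift[OF M that] w it])
  \<comment> \<open>On horizontal lifts the torsion inside \<open>C_flat\<close> has a vertical
    first argument and reduces to a vertical derivative of the lift of \<open>R\<close>. Hence (M7)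
    says that the form \<open>g\<close> is symmetric.\<close>
  have C: "C_flat M F nabla (\<lambda>z. hor_lift M S z (?N (fst z))) (\<lambda>z. hor_lift M S z (R (fst z)))
      (\<lambda>z. hor_lift M S z (R' (fst z))) w = g R R'"
    if R: "vector_field M B R" "vector_field M B R'" for R R'
  proof -
    let ?X = "\<lambda>z. vert_endo M z (hor_lift M S z (?N (fst z)))" and ?Y = "\<lambda>z. hor_lift M S z (R (fst z))"
    have X: "vertical_section M (over M B) ?X" by (rule vertical_section_vert_endo[OF M hor_field[OF const_field]])
    have ve: "vert_endo M w (hor_lift M S w u) = imap M w u" if "u \<in> tangent_space M (fst w)" for u
      using vert_endo_imap[OF M wp hor_tangent[OF wp that]] hor_fst[OF wp that] by simp
    have "torsion M nabla ?X ?Y w = nabla w (?X w) (vert_lift M R)"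
      using vertical_section_vertical[OF M X] hor_fst[OF over_points field_tangent[OF R(1)]]
      by (intro torsion_vertical[OF M nabla vertical_section_field[OF M X] hor_field[OF R(1)] R(1) _ _ w]) auto
    then show ?thesis
      using n by (simp add: C_flat_def fund_vert_def ve N field_tangent[OF R(2) w] imap_inv_imap[OF M wp] g_def)
  qed
  have "g T V = g V T"
    using M7 hor_field[OF const_field] hor_field[OF T] hor_field[OF V] w
    unfolding M7_def C[OF T V, symmetric] C[OF V T, symmetric] by blast
  \<comment> \<open>The left side is the covariant derivative of the fundamental tensor along
    \<open>imap M w n\<close>, whose first term is a vertical derivative and hence twice the Cartan
    tensor.\<close>
  moreover have "2 * cartan_tensor F w n (T (fst w)) (V (fst w)) - g T V - g V T = 0"
    using nabla_metric_vertical[OF MM w n T V]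
      fund_tensor_sym[OF M F wp field_tangent[OF T w] D[OF V]]
    unfolding nabla_metric_vert_lift[OF M nabla T V w] vert_lift_const_field[OF w n]
      fund_tensor_fields_vertical_derivative[OF M F T V w n]
    by (simp add: g_def)
  ultimately show ?thesis by (simp add: g_def)
qed

end

section \<open>Covariant derivatives along dW(U)\<close>

context
  fixes B i p W U
  assumes lift: "is_lift M S nabla" and i: "i = chart_at M p" and Bi: "B \<subseteq> cdom M i" and p: "p \<in> B"
    and W: "vector_field M B W" and W0: "\<And>q. q \<in> B \<Longrightarrow> W q \<noteq> 0" and U: "vector_field M B U"
begin

text \<open>\<open>dW(U)\<close> at \<open>p\<close>, and the vector whose vertical lift is its vertical part.\<close>

definition pushed :: "('i, 'e) tvec2"
  where "pushed = coord_vec (slit M) i (p, W p)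
    (U p i, frechet_derivative (\<lambda>x. W (param M i x) i) (at (chart M i p)) (U p i))"

definition pushed_vert :: "'i \<Rightarrow> 'e"
  where "pushed_vert = imap_inv M (p, W p) (pushed - hor_lift M S (p, W p) (U p))"

lemma B_open: "openin (mtop M) B"
  using W by (simp add: vector_field_def)

lemma p_chart: "p \<in> points M" "i \<in> index M" "i \<in> charts_at M p"
proof -
  show "p \<in> points M" using p B_open openin_mtop[OF M] by auto
  then show "i \<in> charts_at M p" unfolding i by (rule chart_at_in[OF M])
  then show "i \<in> index M" by (simp add: charts_at_def)
qed

lemma W_over: "q \<in> B \<Longrightarrow> (q, W q) \<in> over M B"
  using W W0 B_open openin_mtop[OF M] by (auto simp: over_def points_slit vector_field_def)

lemma W_slit: "(p, W p) \<in> points (slit M)" "i \<in> charts_at (slit M) (p, W p)"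
  using over_points[OF W_over[OF p]] p_chart charts_at_slit[of "(p, W p)" M] by auto

lemma pushed_tangent: "pushed \<in> tangent_space (slit M) (p, W p)"
  unfolding pushed_def by (rule coord_vec_tangent[OF slit_atlas[OF M] W_slit(2)])

lemma pushed_component:
  "pushed i = (U p i, frechet_derivative (\<lambda>x. W (param M i x) i) (at (chart M i p)) (U p i))"
  unfolding pushed_def using coord_vec_same[OF slit_atlas[OF M] W_slit(2)] by simp

lemma U_tangent: "U p \<in> tangent_space M p"
  using U p by (simp add: vector_field_def)

lemma pushed_fst: "(\<lambda>j. fst (pushed j)) = U p"
  using tangent_fst[OF M W_slit(1) pushed_tangent] U_tangent
  by (intro tangent_eqI[OF M _ _ p_chart(3)]) (auto simp: pushed_component)

lemma pushed_ver_proj: "ver_proj M S (p, W p) pushed = pushed - hor_lift M S (p, W p) (U p)"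
  by (simp add: ver_proj_def hor_proj_eq[OF M spray_field spray_semispray W_slit(1) pushed_tangent] pushed_fst)

lemma pushed_vertical: "pushed - hor_lift M S (p, W p) (U p) \<in> vertical M (p, W p)"
proof -
  have "U p \<in> tangent_space M (fst (p, W p))" using U_tangent by simp
  note h = hor_tangent[OF W_slit(1) this] hor_fst[OF W_slit(1) this]
  show ?thesis
    using tangent_diff[OF slit_atlas[OF M] pushed_tangent h(1)] fun_cong[OF h(2)] fun_cong[OF pushed_fst]
    by (auto simp: vertical_iff[OF M W_slit(1)])
qed

lemma pushed_vert_tangent: "pushed_vert \<in> tangent_space M p"
  using imap_inv_vertical(1)[OF M W_slit(1) pushed_vertical] by (simp add: pushed_vert_def)

lemma pushed_split: "pushed = hor_lift M S (p, W p) (U p) + imap M (p, W p) pushed_vert"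
  using imap_inv_vertical(2)[OF M W_slit(1) pushed_vertical] by (simp add: pushed_vert_def)

lemma conn_pushed:
  assumes V: "vector_field M B V"
  shows "imap_inv M (p, W p) (nabla (p, W p) pushed (vert_lift M V)) =
    aff M S nabla W U V p + imap_inv M (p, W p) (nabla (p, W p) (imap M (p, W p) pushed_vert) (vert_lift M V))"
proof -
  note s = vertical_section_vert_lift[OF M V]
  have h: "hor_lift M S (p, W p) (U p) \<in> tangent_space (slit M) (p, W p)"
    using hor_tangent[OF W_slit(1)] U_tangent by simp
  have v: "imap M (p, W p) pushed_vert \<in> tangent_space (slit M) (p, W p)"
    using imap_vertical[OF M W_slit(1)] pushed_vert_tangent by (simp add: vertical_def)
  show ?thesis
    unfolding aff_def aff_vec_def
    by (subst pushed_split, subst conn_direction_add[OF M nabla s W_over[OF p] h v],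
        rule imap_inv_add[OF M W_slit(1)]) (intro conn_vertical[OF M nabla s W_over[OF p]] h v)+
qed

text \<open>The canonical field and the vertical lift of \<open>W\<close> agree along the image of \<open>W\<close>, to which
  \<open>dW(U)\<close> is tangent.\<close>

lemma conn_pushed_W: "imap_inv M (p, W p) (nabla (p, W p) pushed (vert_lift M W)) = pushed_vert"
proof -
  note SA = slit_atlas[OF M]
  let ?w = "(p, W p)"
  have oB: "openin (mtop (slit M)) (over M B)" by (rule openin_over[OF M B_open])
  have sub: "over M B \<subseteq> points (slit M)" by (auto simp: over_points)
  note C = vertical_section_subset[OF M vertical_section_canonical[OF M] oB sub]
  note Wv = vertical_section_vert_lift[OF M W]
  have Wp: "W p \<in> tangent_space M p" using W p by (simp add: vector_field_def)
  let ?z = "chart (slit M) i ?w" and ?O = "chart (slit M) i ` (over M B \<inter> cdom (slit M) i)"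
  let ?dW = "frechet_derivative (\<lambda>x. W (param M i x) i) (at (chart M i p))"
  have O: "open ?O" "?z \<in> ?O"
    using smooth_on_slit_chart(1)[OF M oB p_chart(2)] W_over[OF p] W_slit by (auto simp: charts_at_def)
  have "nabla ?w pushed (canonical_field M) = nabla ?w pushed (vert_lift M W)"
  proof (rule conn_jet[OF M nabla C Wv W_over[OF p] pushed_tangent])
    show "i = chart_at M (fst ?w)" using i by simp
    show "canonical_field M ?w = vert_lift M W ?w"
      using canonical_field_eq[OF M W_slit(1)] vert_lift_eq[OF M W_slit(1), of W] Wp by simp
    have "((\<lambda>x. canonical_field M (param (slit M) i x) i) has_derivative (\<lambda>v. (0, snd v))) (at ?z)"
    proof (subst has_derivative_cong_open[OF O])
      fix x assume "x \<in> ?O"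
      then show "canonical_field M (param (slit M) i x) i = (0, snd x)"
        using p_chart by (auto simp: param_chart[OF SA] canonical_field_eq[OF M] over_points snd_chart_slit)
    qed (auto intro!: derivative_eq_intros)
    moreover have "((\<lambda>x. vert_lift M W (param (slit M) i x) i) has_derivative (\<lambda>v. (0, ?dW (fst v)))) (at ?z)"
    proof (subst has_derivative_cong_open[OF O])
      fix x assume "x \<in> ?O"
      then obtain z where z: "z \<in> over M B" "z \<in> cdom (slit M) i" "x = chart (slit M) i z" by auto
      then show "vert_lift M W (param (slit M) i x) i = (0, W (param M i (fst x)) i)"
        using p_chart vert_lift_eq[where V = W, OF M over_points[OF z(1)] field_tangent[OF W z(1)]]
        by (simp add: param_chart[OF SA] fst_chart_slit param_chart[OF M] cdom_slit)
    next
      have "((\<lambda>x. W (param M i x) i) has_derivative ?dW) (at (fst ?z))"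
        using vector_field_component_derivative[OF M W p p_chart(3)] by (simp add: fst_chart_slit)
      from has_derivative_compose[OF has_derivative_fst[OF has_derivative_ident] this]
      show "((\<lambda>x. (0, W (param M i (fst x)) i)) has_derivative (\<lambda>v. (0, ?dW (fst v)))) (at ?z)"
        by (intro has_derivative_Pair has_derivative_const)
    qed
    \<comment> \<open>On (U, dW(U)) both derivatives take the value (0, dW(U)): the canonical field
      reads the fibre part of the argument, the vertical lift applies dW to its base part.\<close>
    ultimately show "frechet_derivative (\<lambda>x. canonical_field M (param (slit M) i x) i) (at ?z) (pushed i) =
        frechet_derivative (\<lambda>x. vert_lift M W (param (slit M) i x) i) (at ?z) (pushed i)"
      by (simp add: frechet_derivativeI pushed_component)
  qed
  \<comment> \<open>The derivative of the canonical field is known from the defining property of a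
    lift: it is the vertical projection of \<open>pushed\<close>.\<close>
  then have "nabla ?w pushed (vert_lift M W) = pushed - hor_lift M S ?w (U p)"
    using lift W_slit(1) pushed_tangent pushed_ver_proj unfolding is_lift_def by metis
  then show ?thesis by (simp add: pushed_vert_def)
qed

lemma aff_W_eq_pushed_vert:
  assumes "nabla (p, W p) (imap M (p, W p) pushed_vert) (vert_lift M W) = 0"
  shows "aff M S nabla W U W p = pushed_vert"
proof -
  have "0 \<in> tangent_space M (fst (p, W p))" by (rule tangent_0[OF M])
  then have "imap_inv M (p, W p) 0 = 0"
    using imap_inv_imap[OF M W_slit(1)] imap_zero[OF W_slit(1)] by metis
  then show ?thesis using conn_pushed[OF W] conn_pushed_W assms by simp
qed

text \<open>The function on the base is the pull-back of the one on \<open>slit M\<close> by the map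
  q to (q, W q), so this is the chain rule.\<close>

lemma tderiv_along_W:
  assumes T: "vector_field M B T" and V: "vector_field M B V"
  shows "tderiv M (\<lambda>q. fund_tensor F (q, W q) (T q) (V q)) p (U p) =
    tderiv (slit M) (\<lambda>z. fund_tensor F z (T (fst z)) (V (fst z))) (p, W p) pushed"
proof -
  let ?h = "(\<lambda>z. fund_tensor F z (T (fst z)) (V (fst z))) \<circ> param (slit M) i"
  let ?dW = "frechet_derivative (\<lambda>x. W (param M i x) i) (at (chart M i p))"
  let ?z = "chart (slit M) i (p, W p)"
  have O: "open (chart M i ` (B \<inter> cdom M i))" "chart M i p \<in> chart M i ` (B \<inter> cdom M i)"
    using openin_mtop_chart[OF M B_open p_chart(2)] p Bi by auto
  have "(?h has_derivative frechet_derivative ?h (at ?z)) (at ?z)"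
    using W_over[OF p] W_slit
    by (intro smooth_on_has_derivative[OF fund_tensor_fields_smooth[OF M F T V p_chart(2)]]) (auto simp: charts_at_def)
  moreover have "?z = (chart M i p, W (param M i (chart M i p)) i)"
    using p Bi p_chart by (simp add: chart_slit param_chart[OF M] subset_iff)
  ultimately have 1: "(?h has_derivative frechet_derivative ?h (at ?z)) (at (chart M i p, W (param M i (chart M i p)) i))"
    by simp
  have "((\<lambda>x. (x, W (param M i x) i)) has_derivative (\<lambda>v. (v, ?dW v))) (at (chart M i p))"
    by (intro has_derivative_Pair has_derivative_ident vector_field_component_derivative[OF M W p p_chart(3)])
  from has_derivative_compose[OF this 1]
  have "((\<lambda>x. ?h (x, W (param M i x) i)) has_derivative (\<lambda>v. frechet_derivative ?h (at ?z) (v, ?dW v))) (at (chart M i p))" .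
  then have "((\<lambda>q. fund_tensor F (q, W q) (T q) (V q)) \<circ> param M i has_derivative
      (\<lambda>v. frechet_derivative ?h (at ?z) (v, ?dW v))) (at (chart M i p))"
  proof (subst has_derivative_cong_open[OF O])
    fix x assume "x \<in> chart M i ` (B \<inter> cdom M i)"
    then obtain q where q: "q \<in> B" "q \<in> cdom M i" "x = chart M i q" by auto
    have iq: "i \<in> charts_at M q" using q p_chart by (simp add: charts_at_def)
    have Wq: "W q \<in> tangent_space M q" using W q by (simp add: vector_field_def)
    have "W q i \<noteq> 0" using tangent_component_nonzero[OF M Wq W0[OF q(1)] iq] .
    then have "param (slit M) i (chart M i q, W q i) = (q, W q)"
      using param_slit[OF M p_chart(2) q(2)] coord_vec_component[OF M Wq iq] by simp
    then show "((\<lambda>q. fund_tensor F (q, W q) (T q) (V q)) \<circ> param M i) x = ?h (x, W (param M i x) i)"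
      using q p_chart by (simp add: param_chart[OF M])
  qed
  then show ?thesis
    using chart_at_slit[OF W_slit(1)]
    by (simp add: tderiv_def Let_def i[symmetric] frechet_derivativeI pushed_component)
qed

text \<open>The metric conditions are stated for vector fields, so the vector \<open>pushed\<close>
  is extended with constant components in the chart.\<close>

definition pushed_field :: "('p, 'i, 'e) tpoint \<Rightarrow> ('i, 'e) tvec2"
  where "pushed_field = (\<lambda>z. coord_vec (slit M) i z (pushed i))"

lemma pushed_field: "vector_field (slit M) (over M B) pushed_field"
  unfolding pushed_field_def
  using coord_vec_field[OF slit_atlas[OF M] openin_over[OF M B_open] _ over_cdom[OF M p_chart(2) Bi] smooth_on_const]
    p_chart by simp

lemma pushed_field_at: "pushed_field (p, W p) = pushed"
  unfolding pushed_field_def by (rule coord_vec_component[OF slit_atlas[OF M] pushed_tangent W_slit(2)])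

text \<open>Covariant derivatives along \<open>pushed\<close> are those along the horizontal lift,
  which define the affine connection, plus those along the vertical part. The latter are subtracted
  inside \<open>nabla_metric\<close> and have to be added back.\<close>

lemma aff_metric_eq:
  assumes T: "vector_field M B T" and V: "vector_field M B V"
  shows "aff_metric M F S nabla W U T V p =
    nabla_metric M F nabla pushed_field (vert_lift M T) (vert_lift M V) (p, W p)
    + fund_tensor F (p, W p) (imap_inv M (p, W p) (nabla (p, W p) (imap M (p, W p) pushed_vert) (vert_lift M T))) (V p)
    + fund_tensor F (p, W p) (T p) (imap_inv M (p, W p) (nabla (p, W p) (imap M (p, W p) pushed_vert) (vert_lift M V)))"
proof -
  let ?w = "(p, W p)"
  have h: "hor_lift M S ?w (U p) \<in> tangent_space (slit M) ?w"
    using hor_tangent[OF W_slit(1)] U_tangent by simp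
  have v: "imap M ?w pushed_vert \<in> tangent_space (slit M) ?w"
    using imap_vertical[OF M W_slit(1)] pushed_vert_tangent by (simp add: vertical_def)
  have t: "imap_inv M ?w (nabla ?w \<xi> (vert_lift M R)) \<in> tangent_space M (fst ?w)"
    if "vector_field M B R" "\<xi> \<in> tangent_space (slit M) ?w" for R \<xi>
    using conn_vertical[OF M nabla vertical_section_vert_lift[OF M that(1)] W_over[OF p] that(2)]
    by (intro imap_inv_vertical[OF M W_slit(1)])
  have a: "aff M S nabla W U R p \<in> tangent_space M (fst ?w)" if "vector_field M B R" for R
    using t[OF that h] by (simp add: aff_def aff_vec_def)
  have TV: "T p \<in> tangent_space M (fst ?w)" "V p \<in> tangent_space M (fst ?w)"
    using T V p by (auto simp: vector_field_def)
  show ?thesis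
    unfolding aff_metric_def nabla_metric_vert_lift[OF M nabla T V W_over[OF p]] pushed_field_at
      conn_pushed[OF T] conn_pushed[OF V] tderiv_along_W[OF T V]
    using fund_tensor_add_left[OF M F W_slit(1) TV(2) a[OF T] t[OF T v]]
      fund_tensor_add_right[OF M F W_slit(1) TV(1) a[OF V] t[OF V v]] by simp
qed

lemma vertical_args:
  assumes T: "vector_field M B T"
  shows "imap_inv M (p, W p) (vert_lift M T (p, W p)) = T p"
  using imap_inv_imap[OF M W_slit(1)] T p by (simp add: vert_lift_def vector_field_def)

lemma cartan_vert_pushed:
  assumes T: "vector_field M B T" and V: "vector_field M B V"
  shows "cartan_vert M F (p, W p) (ver_proj M S (p, W p) (pushed_field (p, W p))) (vert_lift M T (p, W p)) (vert_lift M V (p, W p))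
    = cartan_tensor F (p, W p) pushed_vert (T p) (V p)"
  by (simp add: cartan_vert_def vertical_args T V pushed_field_at pushed_ver_proj pushed_vert_def)

lemma cartan_deriv_vert_pushed:
  assumes T: "vector_field M B T" and V: "vector_field M B V"
  shows "cartan_deriv_vert M F S (p, W p) (vert_endo M (p, W p) (pushed_field (p, W p))) (vert_lift M T (p, W p)) (vert_lift M V (p, W p))
    = cartan_deriv M F S (p, W p) (U p) (T p) (V p)"
  using imap_inv_imap[OF M W_slit(1), of "U p"] U_tangent
  by (simp add: cartan_deriv_vert_def vertical_args T V pushed_field_at
      vert_endo_imap[OF M W_slit(1) pushed_tangent] pushed_fst)

lemma aff_metric_T3:
  assumes T3: "T3 M nabla" and T: "vector_field M B T" and V: "vector_field M B V"
  shows "aff M S nabla W U W p = pushed_vert"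
    and "aff_metric M F S nabla W U T V p = nabla_metric M F nabla pushed_field (vert_lift M T) (vert_lift M V) (p, W p)"
proof -
  have 0: "nabla (p, W p) (imap M (p, W p) pushed_vert) (vert_lift M R) = 0" if "vector_field M B R" for R
    using vertical_derivative_T3[OF B_open p_chart(2) Bi T3 W_over[OF p] _ that] pushed_vert_tangent by simp
  show "aff M S nabla W U W p = pushed_vert" by (rule aff_W_eq_pushed_vert[OF 0[OF W]])
  have z: "0 \<in> tangent_space M (fst (p, W p))" by (rule tangent_0[OF M])
  have i0: "imap_inv M (p, W p) 0 = 0"
    using imap_inv_imap[OF M W_slit(1) z] imap_zero[OF W_slit(1)] by metis
  have "T p \<in> tangent_space M (fst (p, W p))" "V p \<in> tangent_space M (fst (p, W p))"
    using T V p by (auto simp: vector_field_def)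
  then have "fund_tensor F (p, W p) 0 (V p) = 0" "fund_tensor F (p, W p) (T p) 0 = 0"
    using fund_tensor_add_left[OF M F W_slit(1) _ z z, of "V p"] fund_tensor_add_right[OF M F W_slit(1) _ z z, of "T p"]
    by auto
  then show "aff_metric M F S nabla W U T V p = nabla_metric M F nabla pushed_field (vert_lift M T) (vert_lift M V) (p, W p)"
    by (simp add: aff_metric_eq[OF T V] 0 T V i0)
qed

lemma aff_metric_M7:
  assumes M7: "M7 M F nabla" and MM: "M6 M F nabla \<or> M4 M F S nabla"
    and T: "vector_field M B T" and V: "vector_field M B V"
  shows "aff M S nabla W U W p = pushed_vert"
    and "aff_metric M F S nabla W U T V p =
      nabla_metric M F nabla pushed_field (vert_lift M T) (vert_lift M V) (p, W p)
      + 2 * cartan_tensor F (p, W p) pushed_vert (T p) (V p)"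
proof -
  let ?w = "(p, W p)"
  have n: "pushed_vert \<in> tangent_space M (fst ?w)" using pushed_vert_tangent by simp
  have v: "imap M ?w pushed_vert \<in> tangent_space (slit M) ?w"
    using imap_vertical[OF M W_slit(1) n] by (simp add: vertical_def)
  let ?D = "\<lambda>R. nabla ?w (imap M ?w pushed_vert) (vert_lift M R)"
  have C: "fund_tensor F ?w (imap_inv M ?w (?D R)) (R' p) = cartan_tensor F ?w pushed_vert (R p) (R' p)"
    if "vector_field M B R" "vector_field M B R'" for R R'
    using vertical_derivative_M7[OF B_open p_chart(2) Bi M7 MM W_over[OF p] n that] by simp
  have Dv: "?D R \<in> vertical M ?w" if "vector_field M B R" for R
    by (rule conn_vertical[OF M nabla vertical_section_vert_lift[OF M that] W_over[OF p] v])
  \<comment> \<open>\<open>C\<close> determines pairings with values of fields, so each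
    \<open>u\<close> is extended to a field; nondegeneracy then turns the vanishing pairings into
    the vanishing of the vector.\<close>
  have "imap_inv M ?w (?D W) = 0"
  proof (rule fund_tensor_nondegenerate[OF M F W_slit(1) imap_inv_vertical(1)[OF M W_slit(1) Dv[OF W]]])
    fix u assume u: "u \<in> tangent_space M (fst ?w)"
    note c = const_field[OF B_open p_chart(2) Bi, of p u]
    have "const_field i p u p = u" using const_field_at[OF B_open p_chart(2) Bi p] u by simp
    then show "fund_tensor F ?w (imap_inv M ?w (?D W)) u = 0"
      using C[OF W c] cartan_tensor_self[OF M F W_slit(1) n u] by simp
  qed
  then have "?D W = 0" using imap_inv_vertical(2)[OF M W_slit(1) Dv[OF W]] imap_zero[OF W_slit(1)] by metis
  then show "aff M S nabla W U W p = pushed_vert" by (rule aff_W_eq_pushed_vert)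
  have TV: "T p \<in> tangent_space M (fst ?w)" "V p \<in> tangent_space M (fst ?w)"
    using T V p by (auto simp: vector_field_def)
  have "fund_tensor F ?w (T p) (imap_inv M ?w (?D V)) = cartan_tensor F ?w pushed_vert (T p) (V p)"
    using fund_tensor_sym[OF M F W_slit(1) TV(1) imap_inv_vertical(1)[OF M W_slit(1) Dv[OF V]]] C[OF V T]
      cartan_tensor_sym(1)[OF M F W_slit(1) n TV] by simp
  then show "aff_metric M F S nabla W U T V p =
      nabla_metric M F nabla pushed_field (vert_lift M T) (vert_lift M V) ?w
      + 2 * cartan_tensor F ?w pushed_vert (T p) (V p)"
    unfolding aff_metric_eq[OF T V] C[OF T V] by simp
qed

section \<open>The four connections\<close>

lemma aff_metric_cases:
  assumes T: "vector_field M B T" and V: "vector_field M B V"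
  shows "cartan_connection M F S nabla \<or> chern_rund_connection M F S nabla \<Longrightarrow>
      aff_metric M F S nabla W U T V p = 2 * cartan_tensor F (p, W p) (aff M S nabla W U W p) (T p) (V p)"
    and "berwald_connection M F S nabla \<or> hashiguchi_connection M F S nabla \<Longrightarrow>
      aff_metric M F S nabla W U T V p = 2 * cartan_tensor F (p, W p) (aff M S nabla W U W p) (T p) (V p)
        + 2 * cartan_deriv M F S (p, W p) (U p) (T p) (V p)"
proof -
  note s = pushed_field vertical_section_vert_lift[OF M T] vertical_section_vert_lift[OF M V]
  note w = W_over[OF p]
  let ?N = "nabla_metric M F nabla pushed_field (vert_lift M T) (vert_lift M V) (p, W p)"
  have M3: "?N = 2 * cartan_tensor F (p, W p) pushed_vert (T p) (V p)" if "M3 M F S nabla"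
    using that s w unfolding M3_def cartan_vert_pushed[OF T V, symmetric] by blast
  have M4: "?N = 2 * cartan_deriv M F S (p, W p) (U p) (T p) (V p)" if "M4 M F S nabla"
    using that s w unfolding M4_def cartan_deriv_vert_pushed[OF T V, symmetric] by blast
  have M5: "?N = 2 * cartan_tensor F (p, W p) pushed_vert (T p) (V p) + 2 * cartan_deriv M F S (p, W p) (U p) (T p) (V p)"
    if "M5 M F S nabla"
    using that s w unfolding M5_def cartan_deriv_vert_pushed[OF T V, symmetric] cartan_vert_pushed[OF T V, symmetric] by blast
  have M6: "?N = 0" if "M6 M F nabla" using that s w unfolding M6_def by blast
  show "aff_metric M F S nabla W U T V p = 2 * cartan_tensor F (p, W p) (aff M S nabla W U W p) (T p) (V p)"
    if "cartan_connection M F S nabla \<or> chern_rund_connection M F S nabla"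
    using that M3 M6 aff_metric_T3[OF _ T V] aff_metric_M7[OF _ _ T V]
    by (auto simp: cartan_connection_def chern_rund_connection_def)
  show "aff_metric M F S nabla W U T V p = 2 * cartan_tensor F (p, W p) (aff M S nabla W U W p) (T p) (V p)
        + 2 * cartan_deriv M F S (p, W p) (U p) (T p) (V p)"
    if "berwald_connection M F S nabla \<or> hashiguchi_connection M F S nabla"
    using that M4 M5 aff_metric_T3[OF _ T V] aff_metric_M7[OF _ _ T V]
    by (auto simp: berwald_connection_def hashiguchi_connection_def)
qed

end

end

theorem theorem4p8:
  fixes M :: "('p, 'i, 'e::euclidean_space) atlas"
    and F :: "('p, 'i, 'e) tpoint \<Rightarrow> real"
    and S :: "('p, 'i, 'e) tpoint \<Rightarrow> ('i, 'e) tvec2"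
    and Q :: "'p set"
    and W U V T :: "'p \<Rightarrow> 'i \<Rightarrow> 'e"
  assumes "smooth_manifold M" and "finsler_metric M F" and "geodesic_spray M F S"
    and "openin (mtop M) Q"
    and "vector_field M Q W" and "\<forall>p\<in>Q. W p \<noteq> 0"
    and "vector_field M Q U" and "vector_field M Q V" and "vector_field M Q T"
  shows
    "(\<forall>nabla. cartan_connection M F S nabla \<or> chern_rund_connection M F S nabla \<longrightarrow>
       (\<forall>p\<in>Q.
          aff M S nabla W U V p - aff M S nabla W V U p = lie_bracket M U V p \<and>
          aff_metric M F S nabla W U T V p =
            2 * cartan_tensor F (p, W p) (aff M S nabla W U W p) (T p) (V p))) \<and>
     (\<forall>nabla. berwald_connection M F S nabla \<or> hashiguchi_connection M F S nabla \<longrightarrow>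
       (\<forall>p\<in>Q.
          aff M S nabla W U V p - aff M S nabla W V U p = lie_bracket M U V p \<and>
          aff_metric M F S nabla W U T V p =
            2 * cartan_tensor F (p, W p) (aff M S nabla W U W p) (T p) (V p)
            + 2 * cartan_deriv M F S (p, W p) (U p) (T p) (V p)))"
proof -
  note M = smooth_manifold_atlas[OF assms(1)] and Q = assms(4)
  have sym: "aff M S nabla W U V p - aff M S nabla W V U p = lie_bracket M U V p"
    if "is_lift M S nabla" "T2 M S nabla \<or> T3 M nabla" "p \<in> Q" for nabla p
    using that assms(6) by (intro aff_symmetric[OF M assms(2,3) _ _ assms(7,8,5)]) (auto simp: is_lift_def)
  have metric: "cartan_connection M F S nabla \<or> chern_rund_connection M F S nabla \<Longrightarrow>
      aff_metric M F S nabla W U T V p = 2 * cartan_tensor F (p, W p) (aff M S nabla W U W p) (T p) (V p)"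
    "berwald_connection M F S nabla \<or> hashiguchi_connection M F S nabla \<Longrightarrow>
      aff_metric M F S nabla W U T V p = 2 * cartan_tensor F (p, W p) (aff M S nabla W U W p) (T p) (V p)
        + 2 * cartan_deriv M F S (p, W p) (U p) (T p) (V p)"
    if lift: "is_lift M S nabla" and p: "p \<in> Q" for nabla p
  proof -
    define i where "i = chart_at M p"
    have "p \<in> points M" using p Q openin_mtop[OF M] by blast
    then have i: "i \<in> index M" "p \<in> cdom M i" using chart_at_in[OF M] by (auto simp: i_def charts_at_def)
    \<comment> \<open>The metric identity is checked point by point on the part of \<open>Q\<close>
      inside the chart \<open>chart_at M p\<close>, where the extensions with constant components
      are available.\<close>
    let ?B = "Q \<inter> cdom M i"
    have B: "openin (mtop M) ?B" using Q openin_cdom[OF M i(1)] by (rule openin_Int)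
    have pB: "p \<in> ?B" using p i by simp
    have nabla: "linear_connection M nabla" using lift by (simp add: is_lift_def)
    have W0: "\<And>q. q \<in> ?B \<Longrightarrow> W q \<noteq> 0" using assms(6) by simp
    note sub = vector_field_subset[OF M _ B Int_lower1]
    note * = aff_metric_cases[OF M assms(2,3) nabla lift i_def Int_lower2 pB sub[OF assms(5)] W0 sub[OF assms(7)]
        sub[OF assms(9)] sub[OF assms(8)]]
    show "cartan_connection M F S nabla \<or> chern_rund_connection M F S nabla \<Longrightarrow>
      aff_metric M F S nabla W U T V p = 2 * cartan_tensor F (p, W p) (aff M S nabla W U W p) (T p) (V p)"
      by (rule *(1))
    show "berwald_connection M F S nabla \<or> hashiguchi_connection M F S nabla \<Longrightarrow>
      aff_metric M F S nabla W U T V p = 2 * cartan_tensor F (p, W p) (aff M S nabla W U W p) (T p) (V p)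
        + 2 * cartan_deriv M F S (p, W p) (U p) (T p) (V p)"
      by (rule *(2))
  qed
  show ?thesis
    using sym metric
    by (auto simp: cartan_connection_def chern_rund_connection_def berwald_connection_def hashiguchi_connection_def)
qed

end
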